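(* Let $(\mathcal{M},c)$ be a cocomplete and complete abelian coabelian braided monoidal category satisfying AB5, and assume that the tensor product commutes with direct sums. Let $H$ be a braided bialgebra in $(\mathcal{M},c)$ and let $(M,\mu_M^r,\mu_M^l,\rho_M^r,\rho_M^l)$ be an object of ${}_H^H\mathcal{M}_H^H$. Let $T=T_H(M)$ and $T^c=T_H^c(M)$. Then there is a unique algebra homomorphism $F=F_{H,M}:T\to T^c$ such that $F i_0^T=i_0^{T^c}$ and $F i_1^T=i_1^{T^c}$. Moreover $F$ is a graded bialgebra homomorphism such that $F_0=\mathrm{Id}_H$ and $F_1=\mathrm{Id}_M$. Write $F=\psi_F\circ\varphi_F$ for the canonical factorization through the image, where $\varphi_F:T\to\mathrm{Im}(F)$ and $\psi_F:\mathrm{Im}(F)\to T^c$ are graded braided bialgebra homomorphisms, $\varphi_F$ is an epimorphism and $\psi_F$ is a monomorphism in $\mathcal{M}$. Then: 1) $\mathrm{Im}(F)$ is a graded braided bialgebra such that $\mathrm{Im}(F)_0=H$ and $\mathrm{Im}(F)_1=M$. 2) $\varphi_F$ is the unique algebra homomorphism $T\to\mathrm{Im}(F)$ such that $\varphi_F\circ i_0^T=i_0^{\mathrm{Im}(F)}$ and $\varphi_F\circ i_1^T=i_1^{\mathrm{Im}(F)}$. 3) $\psi_F$ is the unique coalgebra homomorphism $\mathrm{Im}(F)\to T^c$ such that $p_0^{T^c}\circ\psi_F=p_0^{\mathrm{Im}(F)}$ and $p_1^{T^c}\circ\psi_F=p_1^{\mathrm{Im}(F)}$.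
   Context: Monoidal categories: associativity constraints are suppressed. A monoidal category $\mathcal{M}$ is abelian (resp. coabelian) monoidal if $\mathcal{M}$ is abelian and all functors $X\otimes(-)$ and $(-)\otimes X$ are additive and right (resp. left) exact. $c$ denotes the braiding. Graded objects: a graded object is $X=\bigoplus_{n\in\mathbb{N}}X_n$ with canonical injections $i_n^X$ and projections $p_n^X$; $(X\otimes Y)_n=\bigoplus_{a+b=n}X_a\otimes Y_b$. A morphism $f:X\to Y$ is graded if $f=\bigoplus_nf_n$ with $f_n:X_n\to Y_n$. A graded (co)algebra is a (co)algebra whose underlying object is graded and whose (co)multiplication is a graded morphism. Braided bialgebra: $(H,m,u,\Delta,\varepsilon)$ with $(H,m,u)$ an algebra, $(H,\Delta,\varepsilon)$ a coalgebra in $\mathcal{M}$, such that $\Delta m=(m\otimes m)(H\otimes c_{H,H}\otimes H)(\Delta\otimes\Delta)$, $\varepsilon m=m_{\mathbf 1}(\varepsilon\otimes\varepsilon)$ ($m_{\mathbf 1}:\mathbf1\otimes\mathbf1\to\mathbf1$ the unit constraint), $\Delta u=(u\otimes u)m_{\mathbf 1}^{-1}$ and $\varepsilon u=\mathrm{Id}_{\mathbf 1}$. A graded braided bialgebra is a braided bialgebra with a grading making it both a graded algebra and a graded coalgebra; a graded (braided) bialgebra homomorphism is a graded morphism that is an algebra and a coalgebra homomorphism. Hopf bimodules: an object of ${}_H^H\mathcal{M}_H^H$ is $(M,\mu_M^r,\mu_M^l,\rho_M^r,\rho_M^l)$ with $(M,\mu_M^r,\mu_M^l)$ an $H$-bimodule,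 $(M,\rho_M^r,\rho_M^l)$ an $H$-bicomodule and $\rho^l_M\mu^l_M=(m_H\otimes\mu_M^l)(H\otimes c_{H,H}\otimes M)(\Delta_H\otimes\rho_M^l)$, $\rho^l_M\mu^r_M=(m_H\otimes\mu_M^r)(H\otimes c_{M,H}\otimes H)(\rho_M^l\otimes\Delta_H)$, $\rho^r_M\mu^l_M=(\mu_M^l\otimes m_H)(H\otimes c_{H,M}\otimes H)(\Delta_H\otimes\rho_M^r)$, $\rho^r_M\mu^r_M=(\mu_M^r\otimes m_H)(M\otimes c_{H,H}\otimes H)(\rho_M^r\otimes\Delta_H)$. Tensor bialgebra: $T_H(M)=\bigoplus_nM^{\otimes_Hn}$ ($M^{\otimes_H0}=H$; $\otimes_H$ is the usual coequalizer) with the algebra structure given by the canonical morphisms $M^{\otimes_Hp}\otimes M^{\otimes_Hq}\to M^{\otimes_H(p+q)}$ and unit $i_0u_H$; it is a graded braided bialgebra with $\Delta_T,\varepsilon_T$ the unique algebra homomorphisms such that $\Delta_Ti_0=(i_0\otimes i_0)\Delta_H$, $\Delta_Ti_1=(i_0\otimes i_1)\rho_M^l+(i_1\otimes i_0)\rho_M^r$, $\varepsilon_Ti_0=\varepsilon_H$, $\varepsilon_Ti_1=0$ (where $T\otimes T$ has multiplication $(m_T\otimes m_T)(T\otimes c_{T,T}\otimes T)$). Cotensor bialgebra: $T_H^c(M)=\bigoplus_nM^{\square_Hn}$ ($M^{\square_H0}=H$; $V\square_HW$ is the equalizer of $\rho_V\otimes W,V\otimes\rho_W$) with comultiplication given by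 the canonical morphisms $M^{\square_H(p+q)}\to M^{\square_Hp}\otimes M^{\square_Hq}$ and counit $\varepsilon_Hp_0$; it is a graded braided bialgebra with $m_{T^c},u_{T^c}$ the unique coalgebra homomorphisms such that $p_0m_{T^c}=m_H(p_0\otimes p_0)$, $p_1m_{T^c}=\mu_M^l(p_0\otimes p_1)+\mu_M^r(p_1\otimes p_0)$, $p_0u_{T^c}=u_H$, $p_1u_{T^c}=0$ (where $T^c\otimes T^c$ has comultiplication $(T^c\otimes c_{T^c,T^c}\otimes T^c)(\Delta_{T^c}\otimes\Delta_{T^c})$). Image of a graded bialgebra homomorphism $f=\bigoplus_nf_n:A\to A'$: writing $f_n=\psi_n\varphi_n$ with $\varphi_n:A_n\to\mathrm{Im}(f_n)$ epi and $\psi_n$ mono, one has $\mathrm{Im}(f)=\bigoplus_n\mathrm{Im}(f_n)$, $\varphi_f=\bigoplus_n\varphi_n$, $\psi_f=\bigoplus_n\psi_n$; $\mathrm{Im}(f)$ carries the unique graded braided bialgebra structure for which $\varphi_f$ and $\psi_f$ are graded braided bialgebra homomorphisms. When $f_n$ is an identity, one chooses $\varphi_n=\psi_n=\mathrm{Id}$. *)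

theory Defs
  imports Main
begin

section \<open>Categories, functors, limits and colimits\<close>

record ('o, 'm) category =
  Obj :: "'o set"
  Arr :: "'m set"
  Dom :: "'m \<Rightarrow> 'o"
  Cod :: "'m \<Rightarrow> 'o"
  Idn :: "'o \<Rightarrow> 'm"  ("\<one>\<index>")
  Comp :: "'m \<Rightarrow> 'm \<Rightarrow> 'm"  (infixl "\<cdot>\<index>" 60)

definition hom :: "('o, 'm, 'z) category_scheme \<Rightarrow> 'o \<Rightarrow> 'o \<Rightarrow> 'm set" where
  "hom C X Y = {f \<in> Arr C. Dom C f = X \<and> Cod C f = Y}"

locale category =
  fixes C :: "('o, 'm, 'z) category_scheme" (structure)
  assumes Dom_Obj: "f \<in> Arr C \<Longrightarrow> Dom C f \<in> Obj C"
    and Cod_Obj: "f \<in> Arr C \<Longrightarrow> Cod C f \<in> Obj C"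
    and Idn_hom: "X \<in> Obj C \<Longrightarrow> \<one> X \<in> hom C X X"
    and Comp_hom: "f \<in> hom C X Y \<Longrightarrow> g \<in> hom C Y Z \<Longrightarrow> g \<cdot> f \<in> hom C X Z"
    and Idn_left: "f \<in> hom C X Y \<Longrightarrow> \<one> Y \<cdot> f = f"
    and Idn_right: "f \<in> hom C X Y \<Longrightarrow> f \<cdot> \<one> X = f"
    and Comp_assoc: "f \<in> hom C X Y \<Longrightarrow> g \<in> hom C Y Z \<Longrightarrow> h \<in> hom C Z W \<Longrightarrow>
      h \<cdot> g \<cdot> f = h \<cdot> (g \<cdot> f)"

definition inverse_arrows :: "('o, 'm, 'z) category_scheme \<Rightarrow> 'm \<Rightarrow> 'm \<Rightarrow> bool" where
  "inverse_arrows C f g \<longleftrightarrow> f \<in> Arr C \<and> g \<in> hom C (Cod C f) (Dom C f) \<and>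
     g \<cdot>\<^bsub>C\<^esub> f = \<one>\<^bsub>C\<^esub> (Dom C f) \<and> f \<cdot>\<^bsub>C\<^esub> g = \<one>\<^bsub>C\<^esub> (Cod C f)"

definition iso :: "('o, 'm, 'z) category_scheme \<Rightarrow> 'm \<Rightarrow> bool" where
  "iso C f \<longleftrightarrow> (\<exists>g. inverse_arrows C f g)"

definition inverse_of :: "('o, 'm, 'z) category_scheme \<Rightarrow> 'm \<Rightarrow> 'm" where
  "inverse_of C f = (THE g. inverse_arrows C f g)"

definition monic :: "('o, 'm, 'z) category_scheme \<Rightarrow> 'm \<Rightarrow> bool" where
  "monic C f \<longleftrightarrow> f \<in> Arr C \<and>
     (\<forall>X. \<forall>g \<in> hom C X (Dom C f). \<forall>h \<in> hom C X (Dom C f).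
        f \<cdot>\<^bsub>C\<^esub> g = f \<cdot>\<^bsub>C\<^esub> h \<longrightarrow> g = h)"

definition epic :: "('o, 'm, 'z) category_scheme \<Rightarrow> 'm \<Rightarrow> bool" where
  "epic C f \<longleftrightarrow> f \<in> Arr C \<and>
     (\<forall>X. \<forall>g \<in> hom C (Cod C f) X. \<forall>h \<in> hom C (Cod C f) X.
        g \<cdot>\<^bsub>C\<^esub> f = h \<cdot>\<^bsub>C\<^esub> f \<longrightarrow> g = h)"

definition is_equalizer ::
    "('o, 'm, 'z) category_scheme \<Rightarrow> 'm \<Rightarrow> 'm \<Rightarrow> 'm \<Rightarrow> bool" where
  "is_equalizer C f g e \<longleftrightarrow> f \<in> Arr C \<and> g \<in> hom C (Dom C f) (Cod C f) \<and>
     e \<in> hom C (Dom C e) (Dom C f) \<and> f \<cdot>\<^bsub>C\<^esub> e = g \<cdot>\<^bsub>C\<^esub> e \<and>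
     (\<forall>X. \<forall>h \<in> hom C X (Dom C f). f \<cdot>\<^bsub>C\<^esub> h = g \<cdot>\<^bsub>C\<^esub> h \<longrightarrow>
        (\<exists>!k. k \<in> hom C X (Dom C e) \<and> e \<cdot>\<^bsub>C\<^esub> k = h))"

definition is_coequalizer ::
    "('o, 'm, 'z) category_scheme \<Rightarrow> 'm \<Rightarrow> 'm \<Rightarrow> 'm \<Rightarrow> bool" where
  "is_coequalizer C f g q \<longleftrightarrow> f \<in> Arr C \<and> g \<in> hom C (Dom C f) (Cod C f) \<and>
     q \<in> hom C (Cod C f) (Cod C q) \<and> q \<cdot>\<^bsub>C\<^esub> f = q \<cdot>\<^bsub>C\<^esub> g \<and>
     (\<forall>X. \<forall>h \<in> hom C (Cod C f) X. h \<cdot>\<^bsub>C\<^esub> f = h \<cdot>\<^bsub>C\<^esub> g \<longrightarrow>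
        (\<exists>!k. k \<in> hom C (Cod C q) X \<and> k \<cdot>\<^bsub>C\<^esub> q = h))"

definition is_coproduct :: "('o, 'm, 'z) category_scheme \<Rightarrow>
    'i set \<Rightarrow> ('i \<Rightarrow> 'o) \<Rightarrow> 'o \<Rightarrow> ('i \<Rightarrow> 'm) \<Rightarrow> bool" where
  "is_coproduct C I X S i \<longleftrightarrow> S \<in> Obj C \<and> (\<forall>n \<in> I. i n \<in> hom C (X n) S) \<and>
     (\<forall>Y f. Y \<in> Obj C \<and> (\<forall>n \<in> I. f n \<in> hom C (X n) Y) \<longrightarrow>
        (\<exists>!h. h \<in> hom C S Y \<and> (\<forall>n \<in> I. h \<cdot>\<^bsub>C\<^esub> i n = f n)))"

text \<open>Functors are given by an object part \<open>F\<close> and an arrow part \<open>F'\<close>.\<close>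

definition is_functor :: "('p, 'n, 'y) category_scheme \<Rightarrow> ('o, 'm, 'z) category_scheme \<Rightarrow>
    ('p \<Rightarrow> 'o) \<Rightarrow> ('n \<Rightarrow> 'm) \<Rightarrow> bool" where
  "is_functor J C F F' \<longleftrightarrow>
     (\<forall>j \<in> Obj J. F j \<in> Obj C \<and> F' (\<one>\<^bsub>J\<^esub> j) = \<one>\<^bsub>C\<^esub> (F j)) \<and>
     (\<forall>u \<in> Arr J. F' u \<in> hom C (F (Dom J u)) (F (Cod J u))) \<and>
     (\<forall>u \<in> Arr J. \<forall>v \<in> Arr J. Dom J v = Cod J u \<longrightarrow>
        F' (v \<cdot>\<^bsub>J\<^esub> u) = F' v \<cdot>\<^bsub>C\<^esub> F' u)"

definition is_nat_trans :: "('p, 'n, 'y) category_scheme \<Rightarrow> ('o, 'm, 'z) category_scheme \<Rightarrow>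
    ('p \<Rightarrow> 'o) \<Rightarrow> ('n \<Rightarrow> 'm) \<Rightarrow> ('p \<Rightarrow> 'o) \<Rightarrow> ('n \<Rightarrow> 'm) \<Rightarrow> ('p \<Rightarrow> 'm) \<Rightarrow> bool" where
  "is_nat_trans J C F F' G G' t \<longleftrightarrow>
     (\<forall>j \<in> Obj J. t j \<in> hom C (F j) (G j)) \<and>
     (\<forall>u \<in> Arr J. t (Cod J u) \<cdot>\<^bsub>C\<^esub> F' u = G' u \<cdot>\<^bsub>C\<^esub> t (Dom J u))"

definition is_cone :: "('p, 'n, 'y) category_scheme \<Rightarrow> ('o, 'm, 'z) category_scheme \<Rightarrow>
    ('p \<Rightarrow> 'o) \<Rightarrow> ('n \<Rightarrow> 'm) \<Rightarrow> 'o \<Rightarrow> ('p \<Rightarrow> 'm) \<Rightarrow> bool" where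
  "is_cone J C F F' X t \<longleftrightarrow> X \<in> Obj C \<and> (\<forall>j \<in> Obj J. t j \<in> hom C X (F j)) \<and>
     (\<forall>u \<in> Arr J. F' u \<cdot>\<^bsub>C\<^esub> t (Dom J u) = t (Cod J u))"

definition is_cocone :: "('p, 'n, 'y) category_scheme \<Rightarrow> ('o, 'm, 'z) category_scheme \<Rightarrow>
    ('p \<Rightarrow> 'o) \<Rightarrow> ('n \<Rightarrow> 'm) \<Rightarrow> 'o \<Rightarrow> ('p \<Rightarrow> 'm) \<Rightarrow> bool" where
  "is_cocone J C F F' X t \<longleftrightarrow> X \<in> Obj C \<and> (\<forall>j \<in> Obj J. t j \<in> hom C (F j) X) \<and>
     (\<forall>u \<in> Arr J. t (Cod J u) \<cdot>\<^bsub>C\<^esub> F' u = t (Dom J u))"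

definition is_limit :: "('p, 'n, 'y) category_scheme \<Rightarrow> ('o, 'm, 'z) category_scheme \<Rightarrow>
    ('p \<Rightarrow> 'o) \<Rightarrow> ('n \<Rightarrow> 'm) \<Rightarrow> 'o \<Rightarrow> ('p \<Rightarrow> 'm) \<Rightarrow> bool" where
  "is_limit J C F F' X t \<longleftrightarrow> is_cone J C F F' X t \<and>
     (\<forall>Y s. is_cone J C F F' Y s \<longrightarrow>
        (\<exists>!h. h \<in> hom C Y X \<and> (\<forall>j \<in> Obj J. t j \<cdot>\<^bsub>C\<^esub> h = s j)))"

definition is_colimit :: "('p, 'n, 'y) category_scheme \<Rightarrow> ('o, 'm, 'z) category_scheme \<Rightarrow>
    ('p \<Rightarrow> 'o) \<Rightarrow> ('n \<Rightarrow> 'm) \<Rightarrow> 'o \<Rightarrow> ('p \<Rightarrow> 'm) \<Rightarrow> bool" where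
  "is_colimit J C F F' X t \<longleftrightarrow> is_cocone J C F F' X t \<and>
     (\<forall>Y s. is_cocone J C F F' Y s \<longrightarrow>
        (\<exists>!h. h \<in> hom C X Y \<and> (\<forall>j \<in> Obj J. h \<cdot>\<^bsub>C\<^esub> t j = s j)))"

text \<open>A notion of smallness is a predicate on the sets over an index type \<open>'u\<close> that is
  inherited by sets of smaller or equal cardinality and holds for some infinite set. The sets that
  belong to (or are equipotent to members of) a Grothendieck universe are an instance; so are all
  sets over an infinite type, or the countable sets.\<close>

definition smallness :: "('u set \<Rightarrow> bool) \<Rightarrow> bool" where
  "smallness small \<longleftrightarrow> (\<exists>A. infinite A \<and> small A) \<and>
     (\<forall>A B f. small A \<and> inj_on f B \<and> f ` B \<subseteq> A \<longrightarrow> small B)"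

definition small_category :: "('u set \<Rightarrow> bool) \<Rightarrow> ('u, 'u) category \<Rightarrow> bool" where
  "small_category small J \<longleftrightarrow> category J \<and> small (Obj J) \<and> small (Arr J)"

definition complete :: "('u set \<Rightarrow> bool) \<Rightarrow> ('o, 'm, 'z) category_scheme \<Rightarrow> bool" where
  "complete small C \<longleftrightarrow> (\<forall>J F F'. small_category small J \<and> is_functor J C F F' \<longrightarrow>
     (\<exists>X t. is_limit J C F F' X t))"

definition cocomplete :: "('u set \<Rightarrow> bool) \<Rightarrow> ('o, 'm, 'z) category_scheme \<Rightarrow> bool" where
  "cocomplete small C \<longleftrightarrow> (\<forall>J F F'. small_category small J \<and> is_functor J C F F' \<longrightarrow>
     (\<exists>X t. is_colimit J C F F' X t))"

definition filtered :: "('p, 'n, 'y) category_scheme \<Rightarrow> bool" where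
  "filtered J \<longleftrightarrow> Obj J \<noteq> {} \<and>
     (\<forall>i \<in> Obj J. \<forall>j \<in> Obj J. \<exists>k u v. u \<in> hom J i k \<and> v \<in> hom J j k) \<and>
     (\<forall>i j u v. u \<in> hom J i j \<and> v \<in> hom J i j \<longrightarrow>
        (\<exists>k. \<exists>w \<in> hom J j k. w \<cdot>\<^bsub>J\<^esub> u = w \<cdot>\<^bsub>J\<^esub> v))"


section \<open>Braided monoidal categories\<close>

record ('o, 'm) braided_category = "('o, 'm) category" +
  TenO :: "'o \<Rightarrow> 'o \<Rightarrow> 'o"  (infixl "\<otimes>\<^sub>o\<index>" 75)
  TenA :: "'m \<Rightarrow> 'm \<Rightarrow> 'm"  (infixl "\<otimes>\<index>" 70)
  UnitO :: "'o"  ("\<I>\<index>")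
  Assoc :: "'o \<Rightarrow> 'o \<Rightarrow> 'o \<Rightarrow> 'm"  ("\<a>\<index>")
  LUnit :: "'o \<Rightarrow> 'm"  ("\<l>\<index>")
  RUnit :: "'o \<Rightarrow> 'm"  ("\<r>\<index>")
  Braid :: "'o \<Rightarrow> 'o \<Rightarrow> 'm"  ("\<c>\<index>")

locale monoidal_category = category C
  for C :: "('o, 'm, 'z) braided_category_scheme" (structure) +
  assumes TenO_Obj: "X \<in> Obj C \<Longrightarrow> Y \<in> Obj C \<Longrightarrow> X \<otimes>\<^sub>o Y \<in> Obj C"
    and TenA_hom: "f \<in> hom C X Y \<Longrightarrow> g \<in> hom C Z W \<Longrightarrow>
      f \<otimes> g \<in> hom C (X \<otimes>\<^sub>o Z) (Y \<otimes>\<^sub>o W)"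
    and TenA_Idn: "X \<in> Obj C \<Longrightarrow> Y \<in> Obj C \<Longrightarrow> \<one> X \<otimes> \<one> Y = \<one> (X \<otimes>\<^sub>o Y)"
    and TenA_Comp: "f \<in> hom C X Y \<Longrightarrow> g \<in> hom C Y Z \<Longrightarrow>
      f' \<in> hom C X' Y' \<Longrightarrow> g' \<in> hom C Y' Z' \<Longrightarrow>
      (g \<cdot> f) \<otimes> (g' \<cdot> f') = (g \<otimes> g') \<cdot> (f \<otimes> f')"
    and UnitO_Obj: "\<I> \<in> Obj C"
    and Assoc_hom: "X \<in> Obj C \<Longrightarrow> Y \<in> Obj C \<Longrightarrow> Z \<in> Obj C \<Longrightarrow>
      \<a> X Y Z \<in> hom C ((X \<otimes>\<^sub>o Y) \<otimes>\<^sub>o Z) (X \<otimes>\<^sub>o (Y \<otimes>\<^sub>o Z))"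
    and Assoc_iso: "X \<in> Obj C \<Longrightarrow> Y \<in> Obj C \<Longrightarrow> Z \<in> Obj C \<Longrightarrow> iso C (\<a> X Y Z)"
    and Assoc_natural: "f \<in> hom C X X' \<Longrightarrow> g \<in> hom C Y Y' \<Longrightarrow> h \<in> hom C Z Z' \<Longrightarrow>
      \<a> X' Y' Z' \<cdot> (f \<otimes> g \<otimes> h) = (f \<otimes> (g \<otimes> h)) \<cdot> \<a> X Y Z"
    and LUnit_hom: "X \<in> Obj C \<Longrightarrow> \<l> X \<in> hom C (\<I> \<otimes>\<^sub>o X) X"
    and LUnit_iso: "X \<in> Obj C \<Longrightarrow> iso C (\<l> X)"
    and LUnit_natural: "f \<in> hom C X Y \<Longrightarrow> \<l> Y \<cdot> (\<one> \<I> \<otimes> f) = f \<cdot> \<l> X"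
    and RUnit_hom: "X \<in> Obj C \<Longrightarrow> \<r> X \<in> hom C (X \<otimes>\<^sub>o \<I>) X"
    and RUnit_iso: "X \<in> Obj C \<Longrightarrow> iso C (\<r> X)"
    and RUnit_natural: "f \<in> hom C X Y \<Longrightarrow> \<r> Y \<cdot> (f \<otimes> \<one> \<I>) = f \<cdot> \<r> X"
    and pentagon: "X \<in> Obj C \<Longrightarrow> Y \<in> Obj C \<Longrightarrow> Z \<in> Obj C \<Longrightarrow> W \<in> Obj C \<Longrightarrow>
      (\<one> X \<otimes> \<a> Y Z W) \<cdot> \<a> X (Y \<otimes>\<^sub>o Z) W \<cdot> (\<a> X Y Z \<otimes> \<one> W) =
      \<a> X Y (Z \<otimes>\<^sub>o W) \<cdot> \<a> (X \<otimes>\<^sub>o Y) Z W"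
    and triangle: "X \<in> Obj C \<Longrightarrow> Y \<in> Obj C \<Longrightarrow>
      (\<one> X \<otimes> \<l> Y) \<cdot> \<a> X \<I> Y = \<r> X \<otimes> \<one> Y"

locale braided_monoidal_category = monoidal_category +
  assumes Braid_hom: "X \<in> Obj C \<Longrightarrow> Y \<in> Obj C \<Longrightarrow>
      \<c> X Y \<in> hom C (X \<otimes>\<^sub>o Y) (Y \<otimes>\<^sub>o X)"
    and Braid_iso: "X \<in> Obj C \<Longrightarrow> Y \<in> Obj C \<Longrightarrow> iso C (\<c> X Y)"
    and Braid_natural: "f \<in> hom C X X' \<Longrightarrow> g \<in> hom C Y Y' \<Longrightarrow>
      \<c> X' Y' \<cdot> (f \<otimes> g) = (g \<otimes> f) \<cdot> \<c> X Y"
    and hexagon1: "X \<in> Obj C \<Longrightarrow> Y \<in> Obj C \<Longrightarrow> Z \<in> Obj C \<Longrightarrow>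
      \<a> Y Z X \<cdot> \<c> X (Y \<otimes>\<^sub>o Z) \<cdot> \<a> X Y Z =
      (\<one> Y \<otimes> \<c> X Z) \<cdot> \<a> Y X Z \<cdot> (\<c> X Y \<otimes> \<one> Z)"
    and hexagon2: "X \<in> Obj C \<Longrightarrow> Y \<in> Obj C \<Longrightarrow> Z \<in> Obj C \<Longrightarrow>
      \<c> (X \<otimes>\<^sub>o Y) Z =
      \<a> Z X Y \<cdot> (\<c> X Z \<otimes> \<one> Y) \<cdot> inverse_of C (\<a> X Z Y) \<cdot>
        (\<one> X \<otimes> \<c> Y Z) \<cdot> \<a> X Y Z"


section \<open>Abelian categories and abelian/coabelian monoidal categories\<close>

record ('o, 'm) preadditive_braided_category = "('o, 'm) braided_category" +
  Plus :: "'m \<Rightarrow> 'm \<Rightarrow> 'm"  (infixl "\<oplus>\<index>" 55)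
  Zero :: "'o \<Rightarrow> 'o \<Rightarrow> 'm"  ("\<zero>\<index>")

locale preadditive_category = category C
  for C :: "('o, 'm, 'z) preadditive_braided_category_scheme" (structure) +
  assumes Zero_hom: "X \<in> Obj C \<Longrightarrow> Y \<in> Obj C \<Longrightarrow> \<zero> X Y \<in> hom C X Y"
    and Plus_hom: "f \<in> hom C X Y \<Longrightarrow> g \<in> hom C X Y \<Longrightarrow> f \<oplus> g \<in> hom C X Y"
    and Plus_assoc: "f \<in> hom C X Y \<Longrightarrow> g \<in> hom C X Y \<Longrightarrow> h \<in> hom C X Y \<Longrightarrow>
      (f \<oplus> g) \<oplus> h = f \<oplus> (g \<oplus> h)"
    and Plus_comm: "f \<in> hom C X Y \<Longrightarrow> g \<in> hom C X Y \<Longrightarrow> f \<oplus> g = g \<oplus> f"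
    and Plus_Zero: "f \<in> hom C X Y \<Longrightarrow> f \<oplus> \<zero> X Y = f"
    and Plus_inverse: "f \<in> hom C X Y \<Longrightarrow> \<exists>g \<in> hom C X Y. f \<oplus> g = \<zero> X Y"
    and Comp_Plus_left: "f \<in> hom C X Y \<Longrightarrow> g \<in> hom C Y Z \<Longrightarrow> g' \<in> hom C Y Z \<Longrightarrow>
      (g \<oplus> g') \<cdot> f = (g \<cdot> f) \<oplus> (g' \<cdot> f)"
    and Comp_Plus_right: "f \<in> hom C X Y \<Longrightarrow> f' \<in> hom C X Y \<Longrightarrow> g \<in> hom C Y Z \<Longrightarrow>
      g \<cdot> (f \<oplus> f') = (g \<cdot> f) \<oplus> (g \<cdot> f')"

definition is_kernel ::
    "('o, 'm, 'z) preadditive_braided_category_scheme \<Rightarrow> 'm \<Rightarrow> 'm \<Rightarrow> bool" where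
  "is_kernel C f k \<longleftrightarrow> is_equalizer C f (\<zero>\<^bsub>C\<^esub> (Dom C f) (Cod C f)) k"

definition is_cokernel ::
    "('o, 'm, 'z) preadditive_braided_category_scheme \<Rightarrow> 'm \<Rightarrow> 'm \<Rightarrow> bool" where
  "is_cokernel C f q \<longleftrightarrow> is_coequalizer C f (\<zero>\<^bsub>C\<^esub> (Dom C f) (Cod C f)) q"

locale abelian_category = preadditive_category +
  assumes zero_object: "\<exists>N \<in> Obj C. \<one> N = \<zero> N N"
    and biproducts: "X \<in> Obj C \<Longrightarrow> Y \<in> Obj C \<Longrightarrow>
      \<exists>S i j p q. i \<in> hom C X S \<and> j \<in> hom C Y S \<and> p \<in> hom C S X \<and> q \<in> hom C S Y \<and>
        p \<cdot> i = \<one> X \<and> q \<cdot> j = \<one> Y \<and> p \<cdot> j = \<zero> Y X \<and> q \<cdot> i = \<zero> X Y \<and>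
        (i \<cdot> p) \<oplus> (j \<cdot> q) = \<one> S"
    and kernels: "f \<in> Arr C \<Longrightarrow> \<exists>k. is_kernel C f k"
    and cokernels: "f \<in> Arr C \<Longrightarrow> \<exists>q. is_cokernel C f q"
    and monic_normal: "monic C f \<Longrightarrow> \<exists>g. is_kernel C g f"
    and epic_normal: "epic C f \<Longrightarrow> \<exists>g. is_cokernel C g f"

definition short_exact ::
    "('o, 'm, 'z) preadditive_braided_category_scheme \<Rightarrow> 'm \<Rightarrow> 'm \<Rightarrow> bool" where
  "short_exact C f g \<longleftrightarrow> is_kernel C g f \<and> is_cokernel C f g"

text \<open>AB5: cocomplete, and filtered colimits of (short) exact sequences are exact.\<close>

definition AB5 :: "('u set \<Rightarrow> bool) \<Rightarrow>
    ('o, 'm, 'z) preadditive_braided_category_scheme \<Rightarrow> bool" where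
  "AB5 small C \<longleftrightarrow> cocomplete small C \<and>
     (\<forall>J X X' Y Y' Z Z' f g A s B t D v f0 g0.
        small_category small J \<and> filtered J \<and>
        is_functor J C X X' \<and> is_functor J C Y Y' \<and> is_functor J C Z Z' \<and>
        is_nat_trans J C X X' Y Y' f \<and> is_nat_trans J C Y Y' Z Z' g \<and>
        (\<forall>j \<in> Obj J. short_exact C (f j) (g j)) \<and>
        is_colimit J C X X' A s \<and> is_colimit J C Y Y' B t \<and> is_colimit J C Z Z' D v \<and>
        f0 \<in> hom C A B \<and> (\<forall>j \<in> Obj J. f0 \<cdot>\<^bsub>C\<^esub> s j = t j \<cdot>\<^bsub>C\<^esub> f j) \<and>
        g0 \<in> hom C B D \<and> (\<forall>j \<in> Obj J. g0 \<cdot>\<^bsub>C\<^esub> t j = v j \<cdot>\<^bsub>C\<^esub> g j) \<longrightarrow>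
        short_exact C f0 g0)"

text \<open>Additivity and exactness of an endofunctor, given by its arrow part \<open>F'\<close>. Right exactness:
  exact sequences \<open>X \<rightarrow> Y \<rightarrow> Z \<rightarrow> 0\<close> (that is, \<open>Y \<rightarrow> Z\<close> is a cokernel of \<open>X \<rightarrow> Y\<close>) are preserved;
  left exactness is dual.\<close>

definition additive ::
    "('o, 'm, 'z) preadditive_braided_category_scheme \<Rightarrow> ('m \<Rightarrow> 'm) \<Rightarrow> bool" where
  "additive C F' \<longleftrightarrow> (\<forall>X Y. \<forall>f \<in> hom C X Y. \<forall>g \<in> hom C X Y.
     F' (f \<oplus>\<^bsub>C\<^esub> g) = F' f \<oplus>\<^bsub>C\<^esub> F' g)"

definition right_exact ::
    "('o, 'm, 'z) preadditive_braided_category_scheme \<Rightarrow> ('m \<Rightarrow> 'm) \<Rightarrow> bool" where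
  "right_exact C F' \<longleftrightarrow> (\<forall>f g. is_cokernel C f g \<longrightarrow> is_cokernel C (F' f) (F' g))"

definition left_exact ::
    "('o, 'm, 'z) preadditive_braided_category_scheme \<Rightarrow> ('m \<Rightarrow> 'm) \<Rightarrow> bool" where
  "left_exact C F' \<longleftrightarrow> (\<forall>f g. is_kernel C f g \<longrightarrow> is_kernel C (F' f) (F' g))"

definition abelian_monoidal ::
    "('o, 'm, 'z) preadditive_braided_category_scheme \<Rightarrow> bool" where
  "abelian_monoidal C \<longleftrightarrow> monoidal_category C \<and> abelian_category C \<and>
     (\<forall>X \<in> Obj C.
        additive C (\<lambda>f. \<one>\<^bsub>C\<^esub> X \<otimes>\<^bsub>C\<^esub> f) \<and> right_exact C (\<lambda>f. \<one>\<^bsub>C\<^esub> X \<otimes>\<^bsub>C\<^esub> f) \<and>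
        additive C (\<lambda>f. f \<otimes>\<^bsub>C\<^esub> \<one>\<^bsub>C\<^esub> X) \<and> right_exact C (\<lambda>f. f \<otimes>\<^bsub>C\<^esub> \<one>\<^bsub>C\<^esub> X))"

definition coabelian_monoidal ::
    "('o, 'm, 'z) preadditive_braided_category_scheme \<Rightarrow> bool" where
  "coabelian_monoidal C \<longleftrightarrow> monoidal_category C \<and> abelian_category C \<and>
     (\<forall>X \<in> Obj C.
        additive C (\<lambda>f. \<one>\<^bsub>C\<^esub> X \<otimes>\<^bsub>C\<^esub> f) \<and> left_exact C (\<lambda>f. \<one>\<^bsub>C\<^esub> X \<otimes>\<^bsub>C\<^esub> f) \<and>
        additive C (\<lambda>f. f \<otimes>\<^bsub>C\<^esub> \<one>\<^bsub>C\<^esub> X) \<and> left_exact C (\<lambda>f. f \<otimes>\<^bsub>C\<^esub> \<one>\<^bsub>C\<^esub> X))"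

definition tensor_commutes_with_direct_sums :: "('u set \<Rightarrow> bool) \<Rightarrow>
    ('o, 'm, 'z) preadditive_braided_category_scheme \<Rightarrow> bool" where
  "tensor_commutes_with_direct_sums small C \<longleftrightarrow>
     (\<forall>(I :: 'u set) Y S i X. small I \<and> is_coproduct C I Y S i \<and> X \<in> Obj C \<longrightarrow>
        is_coproduct C I (\<lambda>n. X \<otimes>\<^sub>o\<^bsub>C\<^esub> Y n) (X \<otimes>\<^sub>o\<^bsub>C\<^esub> S)
          (\<lambda>n. \<one>\<^bsub>C\<^esub> X \<otimes>\<^bsub>C\<^esub> i n) \<and>
        is_coproduct C I (\<lambda>n. Y n \<otimes>\<^sub>o\<^bsub>C\<^esub> X) (S \<otimes>\<^sub>o\<^bsub>C\<^esub> X)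
          (\<lambda>n. i n \<otimes>\<^bsub>C\<^esub> \<one>\<^bsub>C\<^esub> X))"


section \<open>Bialgebras, Hopf bimodules and graded bialgebras\<close>

record ('o, 'm) bialg =
  carr :: 'o
  mult :: 'm
  unt :: 'm
  comult :: 'm
  counit :: 'm

record ('o, 'm) hopf_bimod =
  mcarr :: 'o
  ract :: 'm
  lact :: 'm
  rcoact :: 'm
  lcoact :: 'm

record ('o, 'm) graded_obj =
  tot :: 'o
  cmp :: "nat \<Rightarrow> 'o"
  inc :: "nat \<Rightarrow> 'm"
  prj :: "nat \<Rightarrow> 'm"

record ('o, 'm) graded_bialg = "('o, 'm) bialg" +
  grading :: "('o, 'm) graded_obj"

locale braided_data =
  fixes C :: "('o, 'm, 'z) preadditive_braided_category_scheme" (structure)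
begin

abbreviation assoc_inv :: "'o \<Rightarrow> 'o \<Rightarrow> 'o \<Rightarrow> 'm"  ("\<a>\<inverse>") where
  "\<a>\<inverse> X Y Z \<equiv> inverse_of C (\<a> X Y Z)"

text \<open>\<open>swap_middle X Y Z W : (X \<otimes> Y) \<otimes> (Z \<otimes> W) \<rightarrow> (X \<otimes> Z) \<otimes> (Y \<otimes> W)\<close> is
  \<open>X \<otimes> c\<^sub>Y\<^sub>,\<^sub>Z \<otimes> W\<close> with the associativity constraints written out.\<close>

definition swap_middle :: "'o \<Rightarrow> 'o \<Rightarrow> 'o \<Rightarrow> 'o \<Rightarrow> 'm" where
  "swap_middle X Y Z W =
     \<a>\<inverse> X Z (Y \<otimes>\<^sub>o W) \<cdot> (\<one> X \<otimes> \<a> Z Y W) \<cdot> (\<one> X \<otimes> (\<c> Y Z \<otimes> \<one> W)) \<cdot>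
     (\<one> X \<otimes> \<a>\<inverse> Y Z W) \<cdot> \<a> X Y (Z \<otimes>\<^sub>o W)"

definition algebra :: "'o \<Rightarrow> 'm \<Rightarrow> 'm \<Rightarrow> bool" where
  "algebra A m u \<longleftrightarrow> A \<in> Obj C \<and> m \<in> hom C (A \<otimes>\<^sub>o A) A \<and> u \<in> hom C \<I> A \<and>
     m \<cdot> (m \<otimes> \<one> A) = m \<cdot> (\<one> A \<otimes> m) \<cdot> \<a> A A A \<and>
     m \<cdot> (u \<otimes> \<one> A) = \<l> A \<and> m \<cdot> (\<one> A \<otimes> u) = \<r> A"

definition coalgebra :: "'o \<Rightarrow> 'm \<Rightarrow> 'm \<Rightarrow> bool" where
  "coalgebra A d e \<longleftrightarrow> A \<in> Obj C \<and> d \<in> hom C A (A \<otimes>\<^sub>o A) \<and> e \<in> hom C A \<I> \<and>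
     \<a> A A A \<cdot> (d \<otimes> \<one> A) \<cdot> d = (\<one> A \<otimes> d) \<cdot> d \<and>
     \<l> A \<cdot> (e \<otimes> \<one> A) \<cdot> d = \<one> A \<and> \<r> A \<cdot> (\<one> A \<otimes> e) \<cdot> d = \<one> A"

definition braided_bialgebra :: "('o, 'm, 'x) bialg_scheme \<Rightarrow> bool" where
  "braided_bialgebra H \<longleftrightarrow>
     algebra (carr H) (mult H) (unt H) \<and> coalgebra (carr H) (comult H) (counit H) \<and>
     comult H \<cdot> mult H =
       (mult H \<otimes> mult H) \<cdot> swap_middle (carr H) (carr H) (carr H) (carr H) \<cdot>
       (comult H \<otimes> comult H) \<and>
     counit H \<cdot> mult H = \<l> \<I> \<cdot> (counit H \<otimes> counit H) \<and>
     comult H \<cdot> unt H = (unt H \<otimes> unt H) \<cdot> inverse_of C (\<l> \<I>) \<and>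
     counit H \<cdot> unt H = \<one> \<I>"

definition algebra_hom ::
    "('o, 'm, 'x) bialg_scheme \<Rightarrow> ('o, 'm, 'y) bialg_scheme \<Rightarrow> 'm \<Rightarrow> bool" where
  "algebra_hom A B f \<longleftrightarrow> f \<in> hom C (carr A) (carr B) \<and>
     f \<cdot> mult A = mult B \<cdot> (f \<otimes> f) \<and> f \<cdot> unt A = unt B"

definition coalgebra_hom ::
    "('o, 'm, 'x) bialg_scheme \<Rightarrow> ('o, 'm, 'y) bialg_scheme \<Rightarrow> 'm \<Rightarrow> bool" where
  "coalgebra_hom A B f \<longleftrightarrow> f \<in> hom C (carr A) (carr B) \<and>
     comult B \<cdot> f = (f \<otimes> f) \<cdot> comult A \<and> counit B \<cdot> f = counit A"

definition bimodule :: "('o, 'm, 'x) bialg_scheme \<Rightarrow> 'o \<Rightarrow> 'm \<Rightarrow> 'm \<Rightarrow> bool" where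
  "bimodule H M r l \<longleftrightarrow> M \<in> Obj C \<and> r \<in> hom C (M \<otimes>\<^sub>o carr H) M \<and> l \<in> hom C (carr H \<otimes>\<^sub>o M) M \<and>
     l \<cdot> (mult H \<otimes> \<one> M) = l \<cdot> (\<one> (carr H) \<otimes> l) \<cdot> \<a> (carr H) (carr H) M \<and>
     l \<cdot> (unt H \<otimes> \<one> M) = \<l> M \<and>
     r \<cdot> (r \<otimes> \<one> (carr H)) = r \<cdot> (\<one> M \<otimes> mult H) \<cdot> \<a> M (carr H) (carr H) \<and>
     r \<cdot> (\<one> M \<otimes> unt H) = \<r> M \<and>
     r \<cdot> (l \<otimes> \<one> (carr H)) = l \<cdot> (\<one> (carr H) \<otimes> r) \<cdot> \<a> (carr H) M (carr H)"

definition bicomodule :: "('o, 'm, 'x) bialg_scheme \<Rightarrow> 'o \<Rightarrow> 'm \<Rightarrow> 'm \<Rightarrow> bool" where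
  "bicomodule H M r l \<longleftrightarrow> M \<in> Obj C \<and> r \<in> hom C M (M \<otimes>\<^sub>o carr H) \<and> l \<in> hom C M (carr H \<otimes>\<^sub>o M) \<and>
     \<a> (carr H) (carr H) M \<cdot> (comult H \<otimes> \<one> M) \<cdot> l = (\<one> (carr H) \<otimes> l) \<cdot> l \<and>
     \<l> M \<cdot> (counit H \<otimes> \<one> M) \<cdot> l = \<one> M \<and>
     \<a> M (carr H) (carr H) \<cdot> (r \<otimes> \<one> (carr H)) \<cdot> r = (\<one> M \<otimes> comult H) \<cdot> r \<and>
     \<r> M \<cdot> (\<one> M \<otimes> counit H) \<cdot> r = \<one> M \<and>
     \<a> (carr H) M (carr H) \<cdot> (l \<otimes> \<one> (carr H)) \<cdot> r = (\<one> (carr H) \<otimes> r) \<cdot> l"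

definition hopf_bimodule ::
    "('o, 'm, 'x) bialg_scheme \<Rightarrow> ('o, 'm, 'y) hopf_bimod_scheme \<Rightarrow> bool" where
  "hopf_bimodule H M \<longleftrightarrow>
     bimodule H (mcarr M) (ract M) (lact M) \<and> bicomodule H (mcarr M) (rcoact M) (lcoact M) \<and>
     lcoact M \<cdot> lact M = (mult H \<otimes> lact M) \<cdot>
       swap_middle (carr H) (carr H) (carr H) (mcarr M) \<cdot> (comult H \<otimes> lcoact M) \<and>
     lcoact M \<cdot> ract M = (mult H \<otimes> ract M) \<cdot>
       swap_middle (carr H) (mcarr M) (carr H) (carr H) \<cdot> (lcoact M \<otimes> comult H) \<and>
     rcoact M \<cdot> lact M = (lact M \<otimes> mult H) \<cdot>
       swap_middle (carr H) (carr H) (mcarr M) (carr H) \<cdot> (comult H \<otimes> rcoact M) \<and>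
     rcoact M \<cdot> ract M = (ract M \<otimes> mult H) \<cdot>
       swap_middle (mcarr M) (carr H) (carr H) (carr H) \<cdot> (rcoact M \<otimes> comult H)"

definition graded_object :: "('o, 'm) graded_obj \<Rightarrow> bool" where
  "graded_object X \<longleftrightarrow> (\<forall>n. cmp X n \<in> Obj C) \<and>
     is_coproduct C UNIV (cmp X) (tot X) (inc X) \<and>
     (\<forall>n. prj X n \<in> hom C (tot X) (cmp X n)) \<and>
     (\<forall>n k. prj X n \<cdot> inc X k = (if n = k then \<one> (cmp X n) else \<zero> (cmp X k) (cmp X n)))"

text \<open>\<open>f = \<Oplus>\<^sub>n f\<^sub>n\<close>\<close>

definition is_direct_sum_of ::
    "('o, 'm) graded_obj \<Rightarrow> ('o, 'm) graded_obj \<Rightarrow> 'm \<Rightarrow> (nat \<Rightarrow> 'm) \<Rightarrow> bool" where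
  "is_direct_sum_of X Y f fn \<longleftrightarrow> f \<in> hom C (tot X) (tot Y) \<and>
     (\<forall>n. fn n \<in> hom C (cmp X n) (cmp Y n) \<and> f \<cdot> inc X n = inc Y n \<cdot> fn n)"

definition graded_morphism ::
    "('o, 'm) graded_obj \<Rightarrow> ('o, 'm) graded_obj \<Rightarrow> 'm \<Rightarrow> bool" where
  "graded_morphism X Y f \<longleftrightarrow> (\<exists>fn. is_direct_sum_of X Y f fn)"

text \<open>\<open>Z\<close> is \<open>X \<otimes> Y\<close> with the grading \<open>Z\<^sub>n = \<Oplus>\<^bsub>a+b=n\<^esub> X\<^sub>a \<otimes> Y\<^sub>b\<close>.\<close>

definition graded_tensor ::
    "('o, 'm) graded_obj \<Rightarrow> ('o, 'm) graded_obj \<Rightarrow> ('o, 'm) graded_obj \<Rightarrow> bool" where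
  "graded_tensor X Y Z \<longleftrightarrow> graded_object Z \<and> tot Z = tot X \<otimes>\<^sub>o tot Y \<and>
     (\<exists>j. \<forall>n.
        is_coproduct C {(a, b). a + b = n} (\<lambda>(a, b). cmp X a \<otimes>\<^sub>o cmp Y b) (cmp Z n) (j n) \<and>
        (\<forall>a b. a + b = n \<longrightarrow> inc Z n \<cdot> j n (a, b) = inc X a \<otimes> inc Y b))"

definition graded_braided_bialgebra :: "('o, 'm) graded_bialg \<Rightarrow> bool" where
  "graded_braided_bialgebra A \<longleftrightarrow> braided_bialgebra A \<and>
     graded_object (grading A) \<and> tot (grading A) = carr A \<and>
     (\<exists>Z. graded_tensor (grading A) (grading A) Z \<and>
        graded_morphism Z (grading A) (mult A) \<and> graded_morphism (grading A) Z (comult A))"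

definition graded_bialgebra_hom ::
    "('o, 'm) graded_bialg \<Rightarrow> ('o, 'm) graded_bialg \<Rightarrow> 'm \<Rightarrow> bool" where
  "graded_bialgebra_hom A B f \<longleftrightarrow>
     graded_morphism (grading A) (grading B) f \<and> algebra_hom A B f \<and> coalgebra_hom A B f"


section \<open>Tensor and cotensor bialgebras\<close>

text \<open>\<open>q : V \<otimes> W \<rightarrow> Q\<close> exhibits \<open>Q\<close> as \<open>V \<otimes>\<^sub>H W\<close>, for a right module \<open>(V, r)\<close> and a left module
  \<open>(W, l)\<close>; \<open>e : E \<rightarrow> V \<otimes> W\<close> exhibits \<open>E\<close> as the cotensor product, for a right comodule \<open>(V, r)\<close>
  and a left comodule \<open>(W, l)\<close>.\<close>

definition is_tensor_over ::
    "('o, 'm, 'x) bialg_scheme \<Rightarrow> 'o \<Rightarrow> 'm \<Rightarrow> 'o \<Rightarrow> 'm \<Rightarrow> 'o \<Rightarrow> 'm \<Rightarrow> bool" where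
  "is_tensor_over H V r W l Q q \<longleftrightarrow> q \<in> hom C (V \<otimes>\<^sub>o W) Q \<and>
     is_coequalizer C (r \<otimes> \<one> W) ((\<one> V \<otimes> l) \<cdot> \<a> V (carr H) W) q"

definition is_cotensor_over ::
    "('o, 'm, 'x) bialg_scheme \<Rightarrow> 'o \<Rightarrow> 'm \<Rightarrow> 'o \<Rightarrow> 'm \<Rightarrow> 'o \<Rightarrow> 'm \<Rightarrow> bool" where
  "is_cotensor_over H V r W l E e \<longleftrightarrow> e \<in> hom C E (V \<otimes>\<^sub>o W) \<and>
     is_equalizer C (r \<otimes> \<one> W) (\<a>\<inverse> V (carr H) W \<cdot> (\<one> V \<otimes> l)) e"

text \<open>Any choice of the iterated tensor powers over \<open>H\<close>: \<open>P n\<close> is the \<open>n\<close>-th power with its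
  left and right \<open>H\<close>-actions \<open>L n\<close> and \<open>R n\<close>, where \<open>P (n + 1) = P n \<otimes>\<^sub>H M\<close> with projection
  \<open>\<pi> n : P n \<otimes> M \<rightarrow> P (n + 1)\<close> for \<open>n \<ge> 1\<close>. The canonical morphism
  \<open>\<chi> p q : P p \<otimes> P q \<rightarrow> P (p + q)\<close> is an action if \<open>p = 0\<close> or \<open>q = 0\<close>, and otherwise the projection
  onto \<open>P p \<otimes>\<^sub>H P q\<close> followed by its associativity isomorphism to \<open>P (p + q)\<close>. All clauses
  except the choice of coequalizers determine their data uniquely, because the functors
  \<open>X \<otimes> (-)\<close> and \<open>(-) \<otimes> X\<close> preserve epimorphisms.\<close>

definition tensor_powers :: "('o, 'm, 'x) bialg_scheme \<Rightarrow> ('o, 'm, 'y) hopf_bimod_scheme \<Rightarrow>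
    (nat \<Rightarrow> 'o) \<Rightarrow> (nat \<Rightarrow> 'm) \<Rightarrow> (nat \<Rightarrow> 'm) \<Rightarrow> (nat \<Rightarrow> 'm) \<Rightarrow> (nat \<Rightarrow> nat \<Rightarrow> 'm) \<Rightarrow> bool" where
  "tensor_powers H M P L R \<pi> \<chi> \<longleftrightarrow>
     P 0 = carr H \<and> L 0 = mult H \<and> R 0 = mult H \<and>
     P 1 = mcarr M \<and> L 1 = lact M \<and> R 1 = ract M \<and>
     (\<forall>n \<ge> 1.
        is_tensor_over H (P n) (R n) (mcarr M) (lact M) (P (Suc n)) (\<pi> n) \<and>
        L (Suc n) \<in> hom C (carr H \<otimes>\<^sub>o P (Suc n)) (P (Suc n)) \<and>
        L (Suc n) \<cdot> (\<one> (carr H) \<otimes> \<pi> n) =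
          \<pi> n \<cdot> (L n \<otimes> \<one> (mcarr M)) \<cdot> \<a>\<inverse> (carr H) (P n) (mcarr M) \<and>
        R (Suc n) \<in> hom C (P (Suc n) \<otimes>\<^sub>o carr H) (P (Suc n)) \<and>
        R (Suc n) \<cdot> (\<pi> n \<otimes> \<one> (carr H)) =
          \<pi> n \<cdot> (\<one> (P n) \<otimes> ract M) \<cdot> \<a> (P n) (mcarr M) (carr H)) \<and>
     (\<forall>n. \<chi> 0 n = L n \<and> \<chi> n 0 = R n) \<and>
     (\<forall>p \<ge> 1. \<chi> p 1 = \<pi> p \<and>
        (\<forall>q \<ge> 1.
           \<chi> p (Suc q) \<in> hom C (P p \<otimes>\<^sub>o P (Suc q)) (P (p + Suc q)) \<and>
           \<chi> p (Suc q) \<cdot> (\<one> (P p) \<otimes> \<pi> q) =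
             \<pi> (p + q) \<cdot> (\<chi> p q \<otimes> \<one> (mcarr M)) \<cdot> \<a>\<inverse> (P p) (P q) (mcarr M)))"

text \<open>Dually for the cotensor powers, with coactions \<open>L n\<close> and \<open>R n\<close>, inclusions
  \<open>\<iota> n : P (n + 1) \<rightarrow> P n \<otimes> M\<close> and canonical morphisms \<open>\<zeta> p q : P (p + q) \<rightarrow> P p \<otimes> P q\<close>.\<close>

definition cotensor_powers :: "('o, 'm, 'x) bialg_scheme \<Rightarrow> ('o, 'm, 'y) hopf_bimod_scheme \<Rightarrow>
    (nat \<Rightarrow> 'o) \<Rightarrow> (nat \<Rightarrow> 'm) \<Rightarrow> (nat \<Rightarrow> 'm) \<Rightarrow> (nat \<Rightarrow> 'm) \<Rightarrow> (nat \<Rightarrow> nat \<Rightarrow> 'm) \<Rightarrow> bool" where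
  "cotensor_powers H M P L R \<iota> \<zeta> \<longleftrightarrow>
     P 0 = carr H \<and> L 0 = comult H \<and> R 0 = comult H \<and>
     P 1 = mcarr M \<and> L 1 = lcoact M \<and> R 1 = rcoact M \<and>
     (\<forall>n \<ge> 1.
        is_cotensor_over H (P n) (R n) (mcarr M) (lcoact M) (P (Suc n)) (\<iota> n) \<and>
        L (Suc n) \<in> hom C (P (Suc n)) (carr H \<otimes>\<^sub>o P (Suc n)) \<and>
        (\<one> (carr H) \<otimes> \<iota> n) \<cdot> L (Suc n) =
          \<a> (carr H) (P n) (mcarr M) \<cdot> (L n \<otimes> \<one> (mcarr M)) \<cdot> \<iota> n \<and>
        R (Suc n) \<in> hom C (P (Suc n)) (P (Suc n) \<otimes>\<^sub>o carr H) \<and>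
        (\<iota> n \<otimes> \<one> (carr H)) \<cdot> R (Suc n) =
          \<a>\<inverse> (P n) (mcarr M) (carr H) \<cdot> (\<one> (P n) \<otimes> rcoact M) \<cdot> \<iota> n) \<and>
     (\<forall>n. \<zeta> 0 n = L n \<and> \<zeta> n 0 = R n) \<and>
     (\<forall>p \<ge> 1. \<zeta> p 1 = \<iota> p \<and>
        (\<forall>q \<ge> 1.
           \<zeta> p (Suc q) \<in> hom C (P (p + Suc q)) (P p \<otimes>\<^sub>o P (Suc q)) \<and>
           (\<one> (P p) \<otimes> \<iota> q) \<cdot> \<zeta> p (Suc q) =
             \<a> (P p) (P q) (mcarr M) \<cdot> (\<zeta> p q \<otimes> \<one> (mcarr M)) \<cdot> \<iota> (p + q)))"

text \<open>\<open>T\<close> is a model of the tensor bialgebra (which is defined up to the choice of coequalizers and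
  direct sums). That its comultiplication and counit are algebra homomorphisms is part of
  \<open>braided_bialgebra\<close>; they are determined by the displayed values on degrees 0 and 1.\<close>

definition tensor_bialgebra :: "('o, 'm, 'x) bialg_scheme \<Rightarrow> ('o, 'm, 'y) hopf_bimod_scheme \<Rightarrow>
    ('o, 'm) graded_bialg \<Rightarrow> bool" where
  "tensor_bialgebra H M T \<longleftrightarrow> graded_braided_bialgebra T \<and>
     (let i = inc (grading T) in
        (\<exists>L R \<pi> \<chi>. tensor_powers H M (cmp (grading T)) L R \<pi> \<chi> \<and>
           (\<forall>p q. mult T \<cdot> (i p \<otimes> i q) = i (p + q) \<cdot> \<chi> p q)) \<and>
        unt T = i 0 \<cdot> unt H \<and>
        comult T \<cdot> i 0 = (i 0 \<otimes> i 0) \<cdot> comult H \<and>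
        comult T \<cdot> i 1 = ((i 0 \<otimes> i 1) \<cdot> lcoact M) \<oplus> ((i 1 \<otimes> i 0) \<cdot> rcoact M) \<and>
        counit T \<cdot> i 0 = counit H \<and> counit T \<cdot> i 1 = \<zero> (mcarr M) \<I>)"

definition cotensor_bialgebra :: "('o, 'm, 'x) bialg_scheme \<Rightarrow> ('o, 'm, 'y) hopf_bimod_scheme \<Rightarrow>
    ('o, 'm) graded_bialg \<Rightarrow> bool" where
  "cotensor_bialgebra H M T \<longleftrightarrow> graded_braided_bialgebra T \<and>
     (let p = prj (grading T) in
        (\<exists>L R \<iota> \<zeta>. cotensor_powers H M (cmp (grading T)) L R \<iota> \<zeta> \<and>
           (\<forall>a b. (p a \<otimes> p b) \<cdot> comult T = \<zeta> a b \<cdot> p (a + b))) \<and>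
        counit T = counit H \<cdot> p 0 \<and>
        p 0 \<cdot> mult T = mult H \<cdot> (p 0 \<otimes> p 0) \<and>
        p 1 \<cdot> mult T = (lact M \<cdot> (p 0 \<otimes> p 1)) \<oplus> (ract M \<cdot> (p 1 \<otimes> p 0)) \<and>
        p 0 \<cdot> unt T = unt H \<and> p 1 \<cdot> unt T = \<zero> \<I> (mcarr M))"


section \<open>Images of graded morphisms\<close>

text \<open>\<open>G = \<Oplus>\<^sub>n Im(F\<^sub>n)\<close> with \<open>\<phi> = \<Oplus>\<^sub>n \<phi>\<^sub>n\<close> and \<open>\<psi> = \<Oplus>\<^sub>n \<psi>\<^sub>n\<close>, where the factorization of \<open>F\<^sub>n\<close> is
  chosen to be trivial if \<open>F\<^sub>n\<close> is an identity.\<close>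

definition graded_image :: "('o, 'm) graded_obj \<Rightarrow> ('o, 'm) graded_obj \<Rightarrow> 'm \<Rightarrow>
    ('o, 'm) graded_obj \<Rightarrow> 'm \<Rightarrow> 'm \<Rightarrow> bool" where
  "graded_image X Y F G \<phi> \<psi> \<longleftrightarrow> graded_object G \<and>
     (\<exists>Fn \<phi>n \<psi>n. is_direct_sum_of X Y F Fn \<and>
        is_direct_sum_of X G \<phi> \<phi>n \<and> is_direct_sum_of G Y \<psi> \<psi>n \<and>
        (\<forall>n. epic C (\<phi>n n) \<and> monic C (\<psi>n n) \<and> Fn n = \<psi>n n \<cdot> \<phi>n n \<and>
           (Fn n = \<one> (cmp X n) \<longrightarrow> \<phi>n n = \<one> (cmp X n) \<and> \<psi>n n = \<one> (cmp X n))))"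

definition image_bialgebra :: "('o, 'm) graded_bialg \<Rightarrow> ('o, 'm) graded_bialg \<Rightarrow>
    ('o, 'm) graded_obj \<Rightarrow> 'm \<Rightarrow> 'm \<Rightarrow> ('o, 'm) graded_bialg \<Rightarrow> bool" where
  "image_bialgebra A B G \<phi> \<psi> I \<longleftrightarrow> graded_braided_bialgebra I \<and> grading I = G \<and>
     graded_bialgebra_hom A I \<phi> \<and> graded_bialgebra_hom I B \<psi>"

end

end

theory Submission
  imports Defs "HOL-Library.Nat_Bijection"
begin

text \<open>Since \<open>M\<^sup>n \<otimes> M \<rightarrow> M\<^sup>n\<^sup>+\<^sup>1\<close> is epic, a multiplicative morphism out of \<open>T\<close> is determined by its
  restrictions to degrees 0 and 1, whatever product its target carries; dually, a comultiplicative
  morphism into \<open>T\<^sup>c\<close> is determined by its components in degrees 0 and 1. The inclusions of these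
  degrees into \<open>T\<^sup>c\<close> are compatible with the products and actions, so they extend to an algebra
  homomorphism \<open>F\<close>; it is a coalgebra homomorphism because \<open>\<Delta>F\<close> and \<open>(F \<otimes> F)\<Delta>\<close> are multiplicative
  and agree in degrees 0 and 1. As \<open>\<phi> \<otimes> \<phi>\<close> is epic and \<open>\<psi> \<otimes> \<psi>\<close> is monic, the structure of the image is
  obtained by diagonal fill-in, and its axioms by cancelling \<open>\<phi>\<close> or \<open>\<psi>\<close>. AB5 is used only to see that
  the projections of a countable direct sum are jointly monic.\<close>

section \<open>Morphisms with computed domain and codomain\<close>

text \<open>Both bialgebras are direct sums, so the two sides are not symmetric: maps out of
  \<open>T\<close> are formal, while a map into \<open>T\<^sup>c\<close> is controlled by its
  components only once the projections are known to be jointly monic. The recursive construction of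
  \<open>F\<close> has its own obstacle. Passing from degree n to n + 1 means descending along the
  coequalizer \<open>P n \<otimes> M \<rightarrow> P (n + 1)\<close>, which requires right
  H-linearity of the map in degree n; so linearity is part of the induction, on the left as well,
  because products with degree 0 are the actions. Generation in low degrees also explains
  gradedness: up to an epimorphism, \<open>F\<close> in degree n + 1 is a product in
  \<open>T\<^sup>c\<close> of something of degree n with something of degree 1. Exactness of the
  tensor product enters through one fact, that tensor products of monomorphisms are monic and those
  of epimorphisms are epic; the braiding enters through naturality of the middle
  interchange.\<close>

locale braided_abelian = braided_data C + braided_monoidal_category C + abelian_category C
  for C :: "('o, 'm, 'z) preadditive_braided_category_scheme" (structure) +
  fixes small :: "'u set \<Rightarrow> bool"
  assumes smallness: "smallness small"
    and abelian: "abelian_monoidal C"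
    and coabelian: "coabelian_monoidal C"
    and cocomplete: "cocomplete small C"
    and AB5: "AB5 small C"
    and tensor_sums: "tensor_commutes_with_direct_sums small C"
begin

text \<open>Hom membership is replaced by equations for \<open>Dom\<close> and \<open>Cod\<close>,
  so that the simplifier can settle composability by computing both ends of a term; the typing rules
  below serve this purpose.\<close>

lemma mem_hom [simp]: "f \<in> hom C X Y \<longleftrightarrow> f \<in> Arr C \<and> Dom C f = X \<and> Cod C f = Y"
  by (simp add: hom_def)

lemma hom_Obj: "f \<in> hom C X Y \<Longrightarrow> X \<in> Obj C \<and> Y \<in> Obj C"
  using Dom_Obj Cod_Obj by auto

declare Dom_Obj [simp] Cod_Obj [simp] TenO_Obj [simp] UnitO_Obj [simp]

section \<open>Computing domains and codomains\<close>

lemma Idn_type [simp]: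
  assumes "X \<in> Obj C"
  shows "\<one> X \<in> Arr C" "Dom C (\<one> X) = X" "Cod C (\<one> X) = X"
  using Idn_hom[OF assms] by auto

lemma Comp_type [simp]:
  assumes "f \<in> Arr C" "g \<in> Arr C" "Cod C f = Dom C g"
  shows "g \<cdot> f \<in> Arr C" "Dom C (g \<cdot> f) = Dom C f" "Cod C (g \<cdot> f) = Cod C g"
  using Comp_hom[of f "Dom C f" "Cod C f" g "Cod C g"] assms by auto

lemma TenA_type [simp]:
  assumes "f \<in> Arr C" "g \<in> Arr C"
  shows "f \<otimes> g \<in> Arr C" "Dom C (f \<otimes> g) = Dom C f \<otimes>\<^sub>o Dom C g"
    "Cod C (f \<otimes> g) = Cod C f \<otimes>\<^sub>o Cod C g"
  using TenA_hom[of f "Dom C f" "Cod C f" g "Dom C g" "Cod C g"] assms by auto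

lemma Zero_type [simp]:
  assumes "X \<in> Obj C" "Y \<in> Obj C"
  shows "\<zero> X Y \<in> Arr C" "Dom C (\<zero> X Y) = X" "Cod C (\<zero> X Y) = Y"
  using Zero_hom[OF assms] by auto

lemma Plus_type [simp]:
  assumes "f \<in> Arr C" "g \<in> Arr C" "Dom C g = Dom C f" "Cod C g = Cod C f"
  shows "f \<oplus> g \<in> Arr C" "Dom C (f \<oplus> g) = Dom C f" "Cod C (f \<oplus> g) = Cod C f"
  using Plus_hom[of f "Dom C f" "Cod C f" g] assms by auto

lemma Assoc_type [simp]:
  assumes "X \<in> Obj C" "Y \<in> Obj C" "Z \<in> Obj C"
  shows "\<a> X Y Z \<in> Arr C" "Dom C (\<a> X Y Z) = (X \<otimes>\<^sub>o Y) \<otimes>\<^sub>o Z"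
    "Cod C (\<a> X Y Z) = X \<otimes>\<^sub>o (Y \<otimes>\<^sub>o Z)"
  using Assoc_hom[OF assms] by auto

lemma LUnit_type [simp]:
  assumes "X \<in> Obj C"
  shows "\<l> X \<in> Arr C" "Dom C (\<l> X) = \<I> \<otimes>\<^sub>o X" "Cod C (\<l> X) = X"
  using LUnit_hom[OF assms] by auto

lemma RUnit_type [simp]:
  assumes "X \<in> Obj C"
  shows "\<r> X \<in> Arr C" "Dom C (\<r> X) = X \<otimes>\<^sub>o \<I>" "Cod C (\<r> X) = X"
  using RUnit_hom[OF assms] by auto

lemma Braid_type [simp]:
  assumes "X \<in> Obj C" "Y \<in> Obj C"
  shows "\<c> X Y \<in> Arr C" "Dom C (\<c> X Y) = X \<otimes>\<^sub>o Y" "Cod C (\<c> X Y) = Y \<otimes>\<^sub>o X"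
  using Braid_hom[OF assms] by auto

lemma Idn_left' [simp]: "f \<in> Arr C \<Longrightarrow> Cod C f = Y \<Longrightarrow> \<one> Y \<cdot> f = f"
  and Idn_right' [simp]: "f \<in> Arr C \<Longrightarrow> Dom C f = X \<Longrightarrow> f \<cdot> \<one> X = f"
  using Idn_left Idn_right by auto

lemma Comp_assoc' [simp]:
  "f \<in> Arr C \<Longrightarrow> g \<in> Arr C \<Longrightarrow> h \<in> Arr C \<Longrightarrow> Cod C f = Dom C g \<Longrightarrow> Cod C g = Dom C h \<Longrightarrow>
    h \<cdot> g \<cdot> f = h \<cdot> (g \<cdot> f)"
  using Comp_assoc[of f "Dom C f" "Cod C f" g "Cod C g" h "Cod C h"] by auto

lemma interchange [simp]:
  "f \<in> Arr C \<Longrightarrow> g \<in> Arr C \<Longrightarrow> f' \<in> Arr C \<Longrightarrow> g' \<in> Arr C \<Longrightarrow>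
    Cod C f = Dom C g \<Longrightarrow> Cod C f' = Dom C g' \<Longrightarrow>
    (g \<otimes> g') \<cdot> (f \<otimes> f') = (g \<cdot> f) \<otimes> (g' \<cdot> f')"
  using TenA_Comp[of f "Dom C f" "Cod C f" g "Cod C g" f' "Dom C f'" "Cod C f'" g' "Cod C g'"]
  by auto

text \<open>Composites are normalised to right-nested form by \<open>Comp_assoc'\<close>, where two
  adjacent tensor layers need not form a subterm; the trailing factor \<open>x\<close> makes the
  interchange law applicable there.\<close>

lemma interchange_Comp [simp]:
  assumes "f \<in> Arr C" "g \<in> Arr C" "f' \<in> Arr C" "g' \<in> Arr C"
    "Cod C f = Dom C g" "Cod C f' = Dom C g'" "x \<in> Arr C" "Cod C x = Dom C f \<otimes>\<^sub>o Dom C f'"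
  shows "(g \<otimes> g') \<cdot> ((f \<otimes> f') \<cdot> x) = ((g \<cdot> f) \<otimes> (g' \<cdot> f')) \<cdot> x"
proof -
  have "(g \<otimes> g') \<cdot> ((f \<otimes> f') \<cdot> x) = ((g \<otimes> g') \<cdot> (f \<otimes> f')) \<cdot> x"
    using assms by (simp del: interchange)
  then show ?thesis using assms by simp
qed

lemma TenA_Idn' [simp]: "X \<in> Obj C \<Longrightarrow> Y \<in> Obj C \<Longrightarrow> \<one> X \<otimes> \<one> Y = \<one> (X \<otimes>\<^sub>o Y)"
  by (rule TenA_Idn)

text \<open>The same device for an arbitrary equation between two composites: it is carried over to
  right-nested composites with a further factor \<open>x\<close>.\<close>

lemma Comp_eq_Comp:
  assumes "g \<cdot> f = g' \<cdot> f'" "f \<in> Arr C" "g \<in> Arr C" "f' \<in> Arr C" "g' \<in> Arr C" "x \<in> Arr C"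
    "Cod C x = Dom C f" "Cod C x = Dom C f'" "Cod C f = Dom C g" "Cod C f' = Dom C g'"
  shows "g \<cdot> (f \<cdot> x) = g' \<cdot> (f' \<cdot> x)"
proof -
  have "g \<cdot> (f \<cdot> x) = (g \<cdot> f) \<cdot> x" using assms(2-) by simp
  also have "\<dots> = g' \<cdot> (f' \<cdot> x)" unfolding assms(1) using assms(2-) by simp
  finally show ?thesis .
qed

text \<open>Two inverses of \<open>f\<close> agree by associativity, so the definite description in
  \<open>inverse_of\<close> denotes.\<close>

lemma inverse_arrows_inverse_of:
  assumes "iso C f"
  shows "inverse_arrows C f (inverse_of C f)"
proof -
  obtain g where g: "inverse_arrows C f g"
    using assms by (auto simp: iso_def)
  have "h = g" if h: "inverse_arrows C f h" for h
  proof -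
    have "h = h \<cdot> (f \<cdot> g)" using g h by (simp add: inverse_arrows_def)
    also have "\<dots> = (h \<cdot> f) \<cdot> g"
      using g h Comp_assoc'[of g f h] by (simp add: inverse_arrows_def del: Comp_assoc')
    also have "\<dots> = g" using g h by (simp add: inverse_arrows_def)
    finally show ?thesis .
  qed
  with g show ?thesis
    unfolding inverse_of_def by (rule theI)
qed

lemma inverse_of_type [simp]:
  assumes "iso C f"
  shows "inverse_of C f \<in> Arr C" "Dom C (inverse_of C f) = Cod C f" "Cod C (inverse_of C f) = Dom C f"
    "inverse_of C f \<cdot> f = \<one> (Dom C f)" "f \<cdot> inverse_of C f = \<one> (Cod C f)" "f \<in> Arr C"
  using inverse_arrows_inverse_of[OF assms] by (auto simp: inverse_arrows_def)

lemma inverse_of_cancel [simp]: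
  assumes "iso C f" "x \<in> Arr C"
  shows "Cod C x = Dom C f \<Longrightarrow> inverse_of C f \<cdot> (f \<cdot> x) = x"
    "Cod C x = Cod C f \<Longrightarrow> f \<cdot> (inverse_of C f \<cdot> x) = x"
proof -
  show "inverse_of C f \<cdot> (f \<cdot> x) = x" if "Cod C x = Dom C f"
  proof -
    have "inverse_of C f \<cdot> (f \<cdot> x) = (inverse_of C f \<cdot> f) \<cdot> x"
      using assms that by (simp del: inverse_of_type(4))
    then show ?thesis using assms that by simp
  qed
  show "f \<cdot> (inverse_of C f \<cdot> x) = x" if "Cod C x = Cod C f"
  proof -
    have "f \<cdot> (inverse_of C f \<cdot> x) = (f \<cdot> inverse_of C f) \<cdot> x"
      using assms that by (simp del: inverse_of_type(5))
    then show ?thesis using assms that by simp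
  qed
qed

declare Assoc_iso [simp] LUnit_iso [simp] RUnit_iso [simp] Braid_iso [simp]

text \<open>Composing a commutative square with the inverses of two opposite sides; naturality of
  the inverse associator follows in this way from that of the associator.\<close>

lemma inverse_natural:
  assumes "a \<cdot> f = g \<cdot> b" "iso C a" "iso C b" "f \<in> Arr C" "g \<in> Arr C"
    "Cod C f = Dom C a" "Cod C b = Dom C g" "Dom C f = Dom C b" "Cod C g = Cod C a"
  shows "inverse_of C a \<cdot> g = f \<cdot> inverse_of C b"
proof -
  have "inverse_of C a \<cdot> g = inverse_of C a \<cdot> ((g \<cdot> b) \<cdot> inverse_of C b)"
    using assms(2-) by simp
  also have "\<dots> = f \<cdot> inverse_of C b"
    unfolding assms(1)[symmetric] using assms(2-) by simp
  finally show ?thesis .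
qed

section \<open>Naturality of the associator and of its inverse\<close>

lemma Assoc_natural' [simp]:
  assumes "f \<in> Arr C" "g \<in> Arr C" "h \<in> Arr C" "X = Cod C f" "Y = Cod C g" "Z = Cod C h"
  shows "\<a> X Y Z \<cdot> (f \<otimes> g \<otimes> h) = (f \<otimes> (g \<otimes> h)) \<cdot> \<a> (Dom C f) (Dom C g) (Dom C h)"
  using Assoc_natural[of f _ _ g _ _ h] assms by simp

lemma Assoc_natural_Comp [simp]:
  assumes "f \<in> Arr C" "g \<in> Arr C" "h \<in> Arr C" "X = Cod C f" "Y = Cod C g" "Z = Cod C h"
    "x \<in> Arr C" "Cod C x = Dom C f \<otimes>\<^sub>o Dom C g \<otimes>\<^sub>o Dom C h"
  shows "\<a> X Y Z \<cdot> ((f \<otimes> g \<otimes> h) \<cdot> x) = (f \<otimes> (g \<otimes> h)) \<cdot> (\<a> (Dom C f) (Dom C g) (Dom C h) \<cdot> x)"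
  using Comp_eq_Comp[OF Assoc_natural'[OF assms(1-6)]] assms by simp

lemma Assoc_inv_natural [simp]:
  assumes "f \<in> Arr C" "g \<in> Arr C" "h \<in> Arr C" "X = Cod C f" "Y = Cod C g" "Z = Cod C h"
  shows "\<a>\<inverse> X Y Z \<cdot> (f \<otimes> (g \<otimes> h)) = (f \<otimes> g \<otimes> h) \<cdot> \<a>\<inverse> (Dom C f) (Dom C g) (Dom C h)"
  using assms by (intro inverse_natural[OF Assoc_natural'[OF assms]]) simp_all

lemma Assoc_inv_natural_Comp [simp]:
  assumes "f \<in> Arr C" "g \<in> Arr C" "h \<in> Arr C" "X = Cod C f" "Y = Cod C g" "Z = Cod C h"
    "x \<in> Arr C" "Cod C x = Dom C f \<otimes>\<^sub>o (Dom C g \<otimes>\<^sub>o Dom C h)"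
  shows "\<a>\<inverse> X Y Z \<cdot> ((f \<otimes> (g \<otimes> h)) \<cdot> x) =
    (f \<otimes> g \<otimes> h) \<cdot> (\<a>\<inverse> (Dom C f) (Dom C g) (Dom C h) \<cdot> x)"
  using Comp_eq_Comp[OF Assoc_inv_natural[OF assms(1-6)]] assms by simp

text \<open>The simplifier merges tensor layers by the interchange law, which hides instances of the
  naturality of the associator; the following rules recover them.\<close>

lemma Assoc_natural_split [simp]:
  assumes "f \<in> Arr C" "g \<in> Arr C" "h \<in> Arr C" "X = Cod C f" "Y = Cod C g" "Z = Cod C h"
    "k \<in> Arr C" "Cod C k = Dom C f \<otimes>\<^sub>o Dom C g"
  shows "\<a> X Y Z \<cdot> (((f \<otimes> g) \<cdot> k) \<otimes> h) =
      (f \<otimes> (g \<otimes> h)) \<cdot> (\<a> (Dom C f) (Dom C g) (Dom C h) \<cdot> (k \<otimes> \<one> (Dom C h)))"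
    "x \<in> Arr C \<Longrightarrow> Cod C x = Dom C k \<otimes>\<^sub>o Dom C h \<Longrightarrow> \<a> X Y Z \<cdot> ((((f \<otimes> g) \<cdot> k) \<otimes> h) \<cdot> x) =
      (f \<otimes> (g \<otimes> h)) \<cdot> (\<a> (Dom C f) (Dom C g) (Dom C h) \<cdot> ((k \<otimes> \<one> (Dom C h)) \<cdot> x))"
proof -
  have *: "((f \<otimes> g) \<cdot> k) \<otimes> h = (f \<otimes> g \<otimes> h) \<cdot> (k \<otimes> \<one> (Dom C h))"
    using assms by simp
  show "\<a> X Y Z \<cdot> (((f \<otimes> g) \<cdot> k) \<otimes> h) =
      (f \<otimes> (g \<otimes> h)) \<cdot> (\<a> (Dom C f) (Dom C g) (Dom C h) \<cdot> (k \<otimes> \<one> (Dom C h)))"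
    unfolding * using assms by (simp del: interchange interchange_Comp)
  show "\<a> X Y Z \<cdot> ((((f \<otimes> g) \<cdot> k) \<otimes> h) \<cdot> x) =
      (f \<otimes> (g \<otimes> h)) \<cdot> (\<a> (Dom C f) (Dom C g) (Dom C h) \<cdot> ((k \<otimes> \<one> (Dom C h)) \<cdot> x))"
    if "x \<in> Arr C" "Cod C x = Dom C k \<otimes>\<^sub>o Dom C h"
    unfolding * using assms that by (simp del: interchange interchange_Comp)
qed

lemma Assoc_inv_natural_split [simp]:
  assumes "f \<in> Arr C" "g \<in> Arr C" "h \<in> Arr C" "X = Cod C f" "Y = Cod C g" "Z = Cod C h"
    "k \<in> Arr C" "Cod C k = Dom C g \<otimes>\<^sub>o Dom C h"
  shows "\<a>\<inverse> X Y Z \<cdot> (f \<otimes> ((g \<otimes> h) \<cdot> k)) =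
      (f \<otimes> g \<otimes> h) \<cdot> (\<a>\<inverse> (Dom C f) (Dom C g) (Dom C h) \<cdot> (\<one> (Dom C f) \<otimes> k))"
    "x \<in> Arr C \<Longrightarrow> Cod C x = Dom C f \<otimes>\<^sub>o Dom C k \<Longrightarrow> \<a>\<inverse> X Y Z \<cdot> ((f \<otimes> ((g \<otimes> h) \<cdot> k)) \<cdot> x) =
      (f \<otimes> g \<otimes> h) \<cdot> (\<a>\<inverse> (Dom C f) (Dom C g) (Dom C h) \<cdot> ((\<one> (Dom C f) \<otimes> k) \<cdot> x))"
proof -
  have *: "f \<otimes> ((g \<otimes> h) \<cdot> k) = (f \<otimes> (g \<otimes> h)) \<cdot> (\<one> (Dom C f) \<otimes> k)"
    using assms by simp
  show "\<a>\<inverse> X Y Z \<cdot> (f \<otimes> ((g \<otimes> h) \<cdot> k)) =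
      (f \<otimes> g \<otimes> h) \<cdot> (\<a>\<inverse> (Dom C f) (Dom C g) (Dom C h) \<cdot> (\<one> (Dom C f) \<otimes> k))"
    unfolding * using assms by (simp del: interchange interchange_Comp)
  show "\<a>\<inverse> X Y Z \<cdot> ((f \<otimes> ((g \<otimes> h) \<cdot> k)) \<cdot> x) =
      (f \<otimes> g \<otimes> h) \<cdot> (\<a>\<inverse> (Dom C f) (Dom C g) (Dom C h) \<cdot> ((\<one> (Dom C f) \<otimes> k) \<cdot> x))"
    if "x \<in> Arr C" "Cod C x = Dom C f \<otimes>\<^sub>o Dom C k"
    unfolding * using assms that by (simp del: interchange interchange_Comp)
qed

section \<open>The middle interchange\<close>

lemma swap_middle_type [simp]:
  assumes "X \<in> Obj C" "Y \<in> Obj C" "Z \<in> Obj C" "W \<in> Obj C"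
  shows "swap_middle X Y Z W \<in> Arr C"
    "Dom C (swap_middle X Y Z W) = (X \<otimes>\<^sub>o Y) \<otimes>\<^sub>o (Z \<otimes>\<^sub>o W)"
    "Cod C (swap_middle X Y Z W) = (X \<otimes>\<^sub>o Z) \<otimes>\<^sub>o (Y \<otimes>\<^sub>o W)"
  using assms by (simp_all add: swap_middle_def)

text \<open>Naturality of the associator moves the four maps past the constraints, and naturality of
  the braiding moves them past the crossing. It is used with four equal maps, to carry a morphism
  through the braided product of a tensor square.\<close>

lemma swap_middle_natural:
  assumes "x \<in> Arr C" "y \<in> Arr C" "z \<in> Arr C" "w \<in> Arr C"
  shows "swap_middle (Cod C x) (Cod C y) (Cod C z) (Cod C w) \<cdot> ((x \<otimes> y) \<otimes> (z \<otimes> w)) =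
    ((x \<otimes> z) \<otimes> (y \<otimes> w)) \<cdot> swap_middle (Dom C x) (Dom C y) (Dom C z) (Dom C w)"
  using assms Braid_natural[of y _ _ z]
  by (simp add: swap_middle_def)

section \<open>Monomorphisms, epimorphisms and images\<close>

lemma Plus_idem_Zero:
  assumes "f \<in> hom C X Y" "f \<oplus> f = f"
  shows "f = \<zero> X Y"
proof -
  obtain g where g: "g \<in> hom C X Y" "f \<oplus> g = \<zero> X Y"
    using Plus_inverse[OF assms(1)] by blast
  have "f = f \<oplus> (f \<oplus> g)" using Plus_Zero[OF assms(1)] g(2) by simp
  also have "\<dots> = (f \<oplus> f) \<oplus> g" using Plus_assoc[OF assms(1) assms(1) g(1)] by simp
  also have "\<dots> = \<zero> X Y" using assms(2) g(2) by simp
  finally show ?thesis .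
qed

lemma Comp_Zero [simp]:
  assumes "f \<in> Arr C" "X \<in> Obj C" "Dom C f = Y"
  shows "f \<cdot> \<zero> X Y = \<zero> X (Cod C f)"
proof (rule Plus_idem_Zero)
  have "Y \<in> Obj C" using assms by auto
  then show "f \<cdot> \<zero> X Y \<in> hom C X (Cod C f)" using assms by simp
  have "f \<cdot> (\<zero> X Y \<oplus> \<zero> X Y) = f \<cdot> \<zero> X Y \<oplus> f \<cdot> \<zero> X Y"
    by (rule Comp_Plus_right) (use assms \<open>Y \<in> Obj C\<close> in auto)
  then show "f \<cdot> \<zero> X Y \<oplus> f \<cdot> \<zero> X Y = f \<cdot> \<zero> X Y"
    using Plus_Zero[OF Zero_hom, of X Y] assms \<open>Y \<in> Obj C\<close> by simp
qed

lemma Zero_Comp [simp]: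
  assumes "f \<in> Arr C" "Z \<in> Obj C" "Cod C f = Y"
  shows "\<zero> Y Z \<cdot> f = \<zero> (Dom C f) Z"
proof (rule Plus_idem_Zero)
  have "Y \<in> Obj C" using assms by auto
  then show "\<zero> Y Z \<cdot> f \<in> hom C (Dom C f) Z" using assms by simp
  have "(\<zero> Y Z \<oplus> \<zero> Y Z) \<cdot> f = \<zero> Y Z \<cdot> f \<oplus> \<zero> Y Z \<cdot> f"
    by (rule Comp_Plus_left) (use assms \<open>Y \<in> Obj C\<close> in auto)
  then show "\<zero> Y Z \<cdot> f \<oplus> \<zero> Y Z \<cdot> f = \<zero> Y Z \<cdot> f"
    using Plus_Zero[OF Zero_hom, of Y Z] assms \<open>Y \<in> Obj C\<close> by simp
qed

lemma Plus_Zero_right [simp]: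
  "f \<in> Arr C \<Longrightarrow> Dom C f = X \<Longrightarrow> Cod C f = Y \<Longrightarrow> f \<oplus> \<zero> X Y = f"
  using Plus_Zero[of f X Y] by simp

lemma Plus_Zero_left [simp]:
  assumes "f \<in> Arr C" "Dom C f = X" "Cod C f = Y"
  shows "\<zero> X Y \<oplus> f = f"
proof -
  have "X \<in> Obj C" "Y \<in> Obj C" using assms by auto
  then show ?thesis using Plus_comm[of "\<zero> X Y" X Y f] assms by simp
qed

lemma TenA_additive:
  assumes "f \<in> Arr C" "f' \<in> Arr C" "Dom C f' = Dom C f" "Cod C f' = Cod C f" "X \<in> Obj C"
  shows "\<one> X \<otimes> (f \<oplus> f') = (\<one> X \<otimes> f) \<oplus> (\<one> X \<otimes> f')" "(f \<oplus> f') \<otimes> \<one> X = (f \<otimes> \<one> X) \<oplus> (f' \<otimes> \<one> X)"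
  using abelian assms by (auto simp: abelian_monoidal_def additive_def)

text \<open>An additive functor preserves zero morphisms because their images are idempotent for
  \<open>\<oplus>\<close>.\<close>

lemma TenA_Idn_Zero:
  assumes "X \<in> Obj C" "Y \<in> Obj C" "Z \<in> Obj C"
  shows "\<one> Z \<otimes> \<zero> X Y = \<zero> (Z \<otimes>\<^sub>o X) (Z \<otimes>\<^sub>o Y)" "\<zero> X Y \<otimes> \<one> Z = \<zero> (X \<otimes>\<^sub>o Z) (Y \<otimes>\<^sub>o Z)"
  using TenA_additive[of "\<zero> X Y" "\<zero> X Y" Z] assms
  by (auto intro!: Plus_idem_Zero)

lemma TenA_Zero [simp]:
  assumes "f \<in> Arr C" "X \<in> Obj C" "Y \<in> Obj C"
  shows "f \<otimes> \<zero> X Y = \<zero> (Dom C f \<otimes>\<^sub>o X) (Cod C f \<otimes>\<^sub>o Y)"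
    "\<zero> X Y \<otimes> f = \<zero> (X \<otimes>\<^sub>o Dom C f) (Y \<otimes>\<^sub>o Cod C f)"
proof -
  have "f \<otimes> \<zero> X Y = (\<one> (Cod C f) \<otimes> \<zero> X Y) \<cdot> (f \<otimes> \<one> X)"
    using assms by simp
  then show "f \<otimes> \<zero> X Y = \<zero> (Dom C f \<otimes>\<^sub>o X) (Cod C f \<otimes>\<^sub>o Y)"
    using assms by (simp add: TenA_Idn_Zero del: interchange)
  have "\<zero> X Y \<otimes> f = (\<zero> X Y \<otimes> \<one> (Cod C f)) \<cdot> (\<one> X \<otimes> f)"
    using assms by simp
  then show "\<zero> X Y \<otimes> f = \<zero> (X \<otimes>\<^sub>o Dom C f) (Y \<otimes>\<^sub>o Cod C f)"
    using assms by (simp add: TenA_Idn_Zero del: interchange)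
qed

lemma Comp_Plus [simp]:
  assumes "f \<in> Arr C" "g \<in> Arr C" "Dom C g = Dom C f" "Cod C g = Cod C f" "h \<in> Arr C"
  shows "Dom C h = Cod C f \<Longrightarrow> h \<cdot> (f \<oplus> g) = h \<cdot> f \<oplus> h \<cdot> g"
    "Cod C h = Dom C f \<Longrightarrow> (f \<oplus> g) \<cdot> h = f \<cdot> h \<oplus> g \<cdot> h"
  using assms Comp_Plus_right[of f "Dom C f" "Cod C f" g h] Comp_Plus_left[of h _ "Dom C f" f _ g]
  by auto

text \<open>The structure has addition with inverses but no negation operation, so a difference is
  described by the equation \<open>f = d \<oplus> g\<close>.\<close>

lemma diff_exists:
  assumes "f \<in> hom C X Y" "g \<in> hom C X Y"
  obtains d where "d \<in> hom C X Y" "f = d \<oplus> g"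
proof -
  obtain g' where g': "g' \<in> hom C X Y" "g \<oplus> g' = \<zero> X Y"
    using Plus_inverse[OF assms(2)] by blast
  have "(f \<oplus> g') \<oplus> g = f"
    using Plus_assoc[OF assms(1) g'(1) assms(2)] Plus_comm[OF g'(1) assms(2)] g'(2) assms by simp
  then show ?thesis
    using that[of "f \<oplus> g'"] assms g' by simp
qed

section \<open>Monomorphisms and epimorphisms, kernels and cokernels\<close>

lemma monicD:
  assumes "monic C f" "f \<cdot> g = f \<cdot> h" "g \<in> Arr C" "h \<in> Arr C"
    "Dom C h = Dom C g" "Cod C g = Dom C f" "Cod C h = Dom C f"
  shows "g = h"
  using assms unfolding monic_def by auto

lemma epicD:
  assumes "epic C f" "g \<cdot> f = h \<cdot> f" "g \<in> Arr C" "h \<in> Arr C"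
    "Cod C h = Cod C g" "Dom C g = Cod C f" "Dom C h = Cod C f"
  shows "g = h"
  using assms unfolding epic_def by auto

lemma monic_Arr: "monic C f \<Longrightarrow> f \<in> Arr C"
  and epic_Arr: "epic C f \<Longrightarrow> f \<in> Arr C"
  by (simp_all add: monic_def epic_def)

text \<open>If \<open>f\<close> equalizes \<open>g\<close> and \<open>h\<close>, it kills their
  difference \<open>d\<close>; the proof computes \<open>f \<cdot> d\<close> by adding and
  cancelling an inverse of \<open>h\<close>.\<close>

lemma monic_ZeroI:
  assumes f: "f \<in> Arr C"
    and "\<And>g. g \<in> Arr C \<Longrightarrow> Cod C g = Dom C f \<Longrightarrow> f \<cdot> g = \<zero> (Dom C g) (Cod C f) \<Longrightarrow>
      g = \<zero> (Dom C g) (Dom C f)"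
  shows "monic C f"
  unfolding monic_def
proof (intro conjI f allI ballI impI)
  fix X g h assume gh: "g \<in> hom C X (Dom C f)" "h \<in> hom C X (Dom C f)" "f \<cdot> g = f \<cdot> h"
  obtain d where d: "d \<in> hom C X (Dom C f)" "g = d \<oplus> h"
    using diff_exists[OF gh(1,2)] .
  obtain h' where h': "h' \<in> hom C X (Dom C f)" "h \<oplus> h' = \<zero> X (Dom C f)"
    using Plus_inverse[OF gh(2)] by blast
  have X: "X \<in> Obj C" using gh by auto
  have "f \<cdot> d = f \<cdot> (d \<oplus> (h \<oplus> h'))" using d h' by simp
  also have "d \<oplus> (h \<oplus> h') = g \<oplus> h'" using Plus_assoc[OF d(1) gh(2) h'(1)] d(2) by simp
  also have "f \<cdot> (g \<oplus> h') = f \<cdot> h \<oplus> f \<cdot> h'"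
    using gh h' f by simp
  also have "\<dots> = f \<cdot> (h \<oplus> h')"
    by (rule Comp_Plus_right[symmetric]) (use gh h' f in auto)
  also have "\<dots> = \<zero> X (Cod C f)" using h'(2) f X by simp
  finally have "d = \<zero> X (Dom C f)" using assms(2)[of d] d(1) by simp
  then show "g = h" using d(2) gh by simp
qed

lemma epic_ZeroI:
  assumes f: "f \<in> Arr C"
    and "\<And>g. g \<in> Arr C \<Longrightarrow> Dom C g = Cod C f \<Longrightarrow> g \<cdot> f = \<zero> (Dom C f) (Cod C g) \<Longrightarrow>
      g = \<zero> (Cod C f) (Cod C g)"
  shows "epic C f"
  unfolding epic_def
proof (intro conjI f allI ballI impI)
  fix X g h assume gh: "g \<in> hom C (Cod C f) X" "h \<in> hom C (Cod C f) X" "g \<cdot> f = h \<cdot> f"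
  obtain d where d: "d \<in> hom C (Cod C f) X" "g = d \<oplus> h"
    using diff_exists[OF gh(1,2)] .
  obtain h' where h': "h' \<in> hom C (Cod C f) X" "h \<oplus> h' = \<zero> (Cod C f) X"
    using Plus_inverse[OF gh(2)] by blast
  have X: "X \<in> Obj C" using gh by auto
  have "d \<cdot> f = (d \<oplus> (h \<oplus> h')) \<cdot> f" using d h' by simp
  also have "d \<oplus> (h \<oplus> h') = g \<oplus> h'" using Plus_assoc[OF d(1) gh(2) h'(1)] d(2) by simp
  also have "(g \<oplus> h') \<cdot> f = h \<cdot> f \<oplus> h' \<cdot> f"
    using gh h' f by simp
  also have "\<dots> = (h \<oplus> h') \<cdot> f"
    by (rule Comp_Plus_left[symmetric]) (use gh h' f in auto)
  also have "\<dots> = \<zero> (Dom C f) X" using h'(2) f X by simp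
  finally have "d = \<zero> (Cod C f) X" using assms(2)[of d] d(1) by simp
  then show "g = h" using d(2) gh by simp
qed

lemma equalizer_monic: "is_equalizer C f g e \<Longrightarrow> monic C e"
  unfolding is_equalizer_def monic_def
proof (intro conjI allI ballI impI)
  fix X h k
  assume e: "f \<in> Arr C \<and> g \<in> hom C (Dom C f) (Cod C f) \<and> e \<in> hom C (Dom C e) (Dom C f) \<and>
      f \<cdot> e = g \<cdot> e \<and> (\<forall>X. \<forall>h\<in>hom C X (Dom C f). f \<cdot> h = g \<cdot> h \<longrightarrow>
        (\<exists>!k. k \<in> hom C X (Dom C e) \<and> e \<cdot> k = h))"
    and h: "h \<in> hom C X (Dom C e)" and k: "k \<in> hom C X (Dom C e)" and hk: "e \<cdot> h = e \<cdot> k"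
  have "f \<cdot> (e \<cdot> h) = g \<cdot> (e \<cdot> h)"
    by (rule Comp_eq_Comp) (use e h in auto)
  then have "\<exists>!k'. k' \<in> hom C X (Dom C e) \<and> e \<cdot> k' = e \<cdot> h"
    using e h by simp
  with h k hk show "h = k" by metis
qed auto

lemma coequalizer_epic: "is_coequalizer C f g q \<Longrightarrow> epic C q"
  unfolding is_coequalizer_def epic_def
proof (intro conjI allI ballI impI)
  fix X h k
  assume q: "f \<in> Arr C \<and> g \<in> hom C (Dom C f) (Cod C f) \<and> q \<in> hom C (Cod C f) (Cod C q) \<and>
      q \<cdot> f = q \<cdot> g \<and> (\<forall>X. \<forall>h\<in>hom C (Cod C f) X. h \<cdot> f = h \<cdot> g \<longrightarrow>
        (\<exists>!k. k \<in> hom C (Cod C q) X \<and> k \<cdot> q = h))"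
    and h: "h \<in> hom C (Cod C q) X" and k: "k \<in> hom C (Cod C q) X" and hk: "h \<cdot> q = k \<cdot> q"
  have "(h \<cdot> q) \<cdot> f = (h \<cdot> q) \<cdot> g"
    using q h by simp
  then have "\<exists>!k'. k' \<in> hom C (Cod C q) X \<and> k' \<cdot> q = h \<cdot> q"
    using q h by simp
  with h k hk show "h = k" by metis
qed auto

lemma kernelD:
  assumes "is_kernel C f k"
  shows "f \<in> Arr C" "k \<in> Arr C" "Cod C k = Dom C f" "f \<cdot> k = \<zero> (Dom C k) (Cod C f)" "monic C k"
    and "\<And>h X. h \<in> Arr C \<Longrightarrow> Dom C h = X \<Longrightarrow> Cod C h = Dom C f \<Longrightarrow>
      f \<cdot> h = \<zero> X (Cod C f) \<Longrightarrow> \<exists>d \<in> hom C X (Dom C k). k \<cdot> d = h"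
proof -
  show "monic C k" using assms equalizer_monic unfolding is_kernel_def by blast
  show *: "f \<in> Arr C" "k \<in> Arr C" "Cod C k = Dom C f" "f \<cdot> k = \<zero> (Dom C k) (Cod C f)"
    using assms by (auto simp: is_kernel_def is_equalizer_def)
  show "\<exists>d \<in> hom C X (Dom C k). k \<cdot> d = h"
    if "h \<in> Arr C" "Dom C h = X" "Cod C h = Dom C f" "f \<cdot> h = \<zero> X (Cod C f)" for h X
  proof -
    have "\<exists>!d. d \<in> hom C X (Dom C k) \<and> k \<cdot> d = h"
      using assms that unfolding is_kernel_def is_equalizer_def by simp
    then show ?thesis by blast
  qed
qed

lemma cokernelD:
  assumes "is_cokernel C f q"
  shows "f \<in> Arr C" "q \<in> Arr C" "Dom C q = Cod C f" "q \<cdot> f = \<zero> (Dom C f) (Cod C q)" "epic C q"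
    and "\<And>h X. h \<in> Arr C \<Longrightarrow> Cod C h = X \<Longrightarrow> Dom C h = Cod C f \<Longrightarrow>
      h \<cdot> f = \<zero> (Dom C f) X \<Longrightarrow> \<exists>d \<in> hom C (Cod C q) X. d \<cdot> q = h"
proof -
  show "epic C q" using assms coequalizer_epic unfolding is_cokernel_def by blast
  show *: "f \<in> Arr C" "q \<in> Arr C" "Dom C q = Cod C f" "q \<cdot> f = \<zero> (Dom C f) (Cod C q)"
    using assms by (auto simp: is_cokernel_def is_coequalizer_def)
  show "\<exists>d \<in> hom C (Cod C q) X. d \<cdot> q = h"
    if "h \<in> Arr C" "Cod C h = X" "Dom C h = Cod C f" "h \<cdot> f = \<zero> (Dom C f) X" for h X
  proof -
    have "\<exists>!d. d \<in> hom C (Cod C q) X \<and> d \<cdot> q = h"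
      using assms that unfolding is_cokernel_def is_coequalizer_def by simp
    then show ?thesis by blast
  qed
qed

section \<open>Stability under composition and tensor product\<close>

lemma monic_Comp:
  assumes f: "monic C f" and g: "monic C g" and "Cod C f = Dom C g"
  shows "monic C (g \<cdot> f)"
  unfolding monic_def
proof (intro conjI allI ballI impI)
  show "g \<cdot> f \<in> Arr C" using assms monic_Arr by simp
  fix X h k assume *: "h \<in> hom C X (Dom C (g \<cdot> f))" "k \<in> hom C X (Dom C (g \<cdot> f))"
    "g \<cdot> f \<cdot> h = g \<cdot> f \<cdot> k"
  note [simp] = monic_Arr[OF f] monic_Arr[OF g] assms(3)
  have "f \<cdot> h = f \<cdot> k" by (rule monicD[OF g]) (use * in auto)
  then show "h = k" by (rule monicD[OF f]) (use * in auto)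
qed

lemma epic_Comp:
  assumes f: "epic C f" and g: "epic C g" and "Cod C f = Dom C g"
  shows "epic C (g \<cdot> f)"
  unfolding epic_def
proof (intro conjI allI ballI impI)
  show "g \<cdot> f \<in> Arr C" using assms epic_Arr by simp
  fix X h k assume *: "h \<in> hom C (Cod C (g \<cdot> f)) X" "k \<in> hom C (Cod C (g \<cdot> f)) X"
    "h \<cdot> (g \<cdot> f) = k \<cdot> (g \<cdot> f)"
  note [simp] = epic_Arr[OF f] epic_Arr[OF g] assms(3)
  have "h \<cdot> g = k \<cdot> g" by (rule epicD[OF f]) (use * in auto)
  then show "h = k" by (rule epicD[OF g]) (use * in auto)
qed

lemma monic_Idn: "X \<in> Obj C \<Longrightarrow> monic C (\<one> X)"
  and epic_Idn: "X \<in> Obj C \<Longrightarrow> epic C (\<one> X)"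
  by (auto simp: monic_def epic_def)

text \<open>In an abelian category \<open>f\<close> and \<open>g\<close> are kernels, and tensoring
  with one object is left exact; so tensoring either of them with an identity gives a kernel, hence
  a monomorphism, and \<open>f \<otimes> g\<close> is a composite of two such maps.\<close>

lemma monic_TenA:
  assumes f: "monic C f" and g: "monic C g"
  shows "monic C (f \<otimes> g)"
proof -
  note [simp] = monic_Arr[OF f] monic_Arr[OF g]
  obtain h where "is_kernel C h f" using monic_normal[OF f] by blast
  then have "is_kernel C (h \<otimes> \<one> (Cod C g)) (f \<otimes> \<one> (Cod C g))"
    using coabelian by (simp add: coabelian_monoidal_def left_exact_def)
  then have 1: "monic C (f \<otimes> \<one> (Cod C g))" by (rule kernelD)
  obtain h' where "is_kernel C h' g" using monic_normal[OF g] by blast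
  then have "is_kernel C (\<one> (Dom C f) \<otimes> h') (\<one> (Dom C f) \<otimes> g)"
    using coabelian by (simp add: coabelian_monoidal_def left_exact_def)
  then have "monic C (\<one> (Dom C f) \<otimes> g)" by (rule kernelD)
  from monic_Comp[OF this 1] show ?thesis by simp
qed

text \<open>The dual argument: epimorphisms are cokernels, and right exactness keeps them
  so.\<close>

lemma epic_TenA:
  assumes f: "epic C f" and g: "epic C g"
  shows "epic C (f \<otimes> g)"
proof -
  note [simp] = epic_Arr[OF f] epic_Arr[OF g]
  obtain h where "is_cokernel C h f" using epic_normal[OF f] by blast
  then have "is_cokernel C (h \<otimes> \<one> (Cod C g)) (f \<otimes> \<one> (Cod C g))"
    using abelian by (simp add: abelian_monoidal_def right_exact_def)
  then have 1: "epic C (f \<otimes> \<one> (Cod C g))" by (rule cokernelD)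
  obtain h' where "is_cokernel C h' g" using epic_normal[OF g] by blast
  then have "is_cokernel C (\<one> (Dom C f) \<otimes> h') (\<one> (Dom C f) \<otimes> g)"
    using abelian by (simp add: abelian_monoidal_def right_exact_def)
  then have "epic C (\<one> (Dom C f) \<otimes> g)" by (rule cokernelD)
  from epic_Comp[OF this 1] show ?thesis by simp
qed

text \<open>As \<open>e\<close> is a cokernel of some \<open>h\<close>, the map
  \<open>m \<cdot> f \<cdot> h\<close> is zero; monicity of \<open>m\<close> then makes
  \<open>f \<cdot> h\<close> zero, and \<open>f\<close> descends along \<open>e\<close>.\<close>

lemma diagonal_fill_in:
  assumes e: "epic C e" and m: "monic C m"
    and "f \<in> Arr C" "g \<in> Arr C" "Dom C f = Dom C e" "Cod C f = Dom C m"
    "Dom C g = Cod C e" "Cod C g = Cod C m" "m \<cdot> f = g \<cdot> e"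
  obtains d where "d \<in> hom C (Cod C e) (Dom C m)" "d \<cdot> e = f" "m \<cdot> d = g"
proof -
  note [simp] = assms(3-8) monic_Arr[OF m] epic_Arr[OF e]
  obtain h where h: "is_cokernel C h e" using epic_normal[OF e] by blast
  note [simp] = cokernelD(1-4)[OF h]
  have "m \<cdot> (f \<cdot> h) = g \<cdot> (e \<cdot> h)"
    by (rule Comp_eq_Comp[OF assms(9)]) auto
  then have "m \<cdot> (f \<cdot> h) = m \<cdot> \<zero> (Dom C h) (Dom C m)" by simp
  then have "f \<cdot> h = \<zero> (Dom C h) (Dom C m)"
    by (rule monicD[OF m]) auto
  then have "\<exists>d \<in> hom C (Cod C e) (Dom C m). d \<cdot> e = f"
    by (intro cokernelD(6)[OF h]) simp_all
  then obtain d where d: "d \<in> hom C (Cod C e) (Dom C m)" "d \<cdot> e = f"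
    by blast
  have "m \<cdot> d = g"
    by (rule epicD[OF e]) (use d assms(9) in auto)
  then show ?thesis using that d by blast
qed

text \<open>\<open>m\<close> is the kernel of the cokernel of \<open>f\<close>. The work is to see
  that the induced \<open>e\<close> is epic: if \<open>a\<close> kills \<open>e\<close>, then
  \<open>f\<close> already factors through \<open>m\<close> restricted to the kernel of
  \<open>a\<close>, and minimality of \<open>m\<close> shows that this kernel is everything.\<close>

lemma image_factorization:
  assumes f: "f \<in> Arr C"
  obtains e m where "epic C e" "monic C m" "Cod C e = Dom C m" "Dom C e = Dom C f"
    "Cod C m = Cod C f" "f = m \<cdot> e"
proof -
  obtain q where q: "is_cokernel C f q" using cokernels[OF f] by blast
  note [simp] = cokernelD(1-4)[OF q]
  obtain m where m: "is_kernel C q m" using kernels[of q] by auto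
  note [simp] = kernelD(2,3,4)[OF m]
  have "\<exists>e \<in> hom C (Dom C f) (Dom C m). m \<cdot> e = f"
    by (rule kernelD(6)[OF m]) (simp_all)
  then obtain e where e: "e \<in> hom C (Dom C f) (Dom C m)" "m \<cdot> e = f"
    by blast
  have "epic C e"
  proof (rule epic_ZeroI)
    show "e \<in> Arr C" using e by simp
    fix a assume a: "a \<in> Arr C" "Dom C a = Cod C e" "a \<cdot> e = \<zero> (Dom C e) (Cod C a)"
    obtain k where k: "is_kernel C a k" using kernels[OF a(1)] by blast
    note [simp] = kernelD(2,3,4)[OF k] a(1,2)
    have [simp]: "e \<in> Arr C" "Dom C e = Dom C f" "Cod C e = Dom C m" using e by auto
    have "\<exists>e' \<in> hom C (Dom C f) (Dom C k). k \<cdot> e' = e"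
      by (rule kernelD(6)[OF k]) (simp_all add: a(3)[simplified])
    then obtain e' where e': "e' \<in> hom C (Dom C f) (Dom C k)" "k \<cdot> e' = e"
      by blast
    \<comment> \<open>Being monic, \<open>m \<cdot> k\<close> is the kernel of some
      \<open>h\<close>. Since \<open>f\<close> factors through it, \<open>h\<close> kills
      \<open>f\<close>, hence factors through \<open>q\<close> and kills \<open>m\<close>; so
      \<open>m\<close> factors through \<open>m \<cdot> k\<close>, and \<open>k\<close> has a right
      inverse.\<close>
    have "monic C (m \<cdot> k)" using monic_Comp kernelD(5)[OF k] kernelD(5)[OF m] by simp
    then obtain h where h: "is_kernel C h (m \<cdot> k)" using monic_normal by blast
    note [simp] = kernelD(1)[OF h]
    have [simp]: "Dom C h = Cod C f" using kernelD(3)[OF h] by simp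
    have hk: "h \<cdot> (m \<cdot> k) = \<zero> (Dom C k) (Cod C h)" using kernelD(4)[OF h] by simp
    have "h \<cdot> f = (h \<cdot> (m \<cdot> k)) \<cdot> e'" using e e' by simp
    also have "\<dots> = \<zero> (Dom C f) (Cod C h)" using hk e' by simp
    finally have "\<exists>h' \<in> hom C (Cod C q) (Cod C h). h' \<cdot> q = h"
      by (intro cokernelD(6)[OF q]) simp_all
    then obtain h' where h': "h' \<in> hom C (Cod C q) (Cod C h)" "h' \<cdot> q = h"
      by blast
    have "(h' \<cdot> q) \<cdot> m = h' \<cdot> (q \<cdot> m)"
      by (rule Comp_assoc') (use h'(1) in auto)
    then have "h \<cdot> m = \<zero> (Dom C m) (Cod C h)" unfolding h'(2) using h'(1) by simp
    then have "\<exists>s \<in> hom C (Dom C m) (Dom C (m \<cdot> k)). (m \<cdot> k) \<cdot> s = m"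
      by (intro kernelD(6)[OF h]) simp_all
    then obtain s where s: "s \<in> hom C (Dom C m) (Dom C (m \<cdot> k))" "(m \<cdot> k) \<cdot> s = m"
      by blast
    have "k \<cdot> s = \<one> (Dom C m)"
      by (rule monicD[OF kernelD(5)[OF m]]) (use s in auto)
    then have "a = a \<cdot> (k \<cdot> s)" by simp
    also have "\<dots> = (a \<cdot> k) \<cdot> s" using s by (simp del: kernelD(4)[OF k])
    also have "\<dots> = \<zero> (Cod C e) (Cod C a)" using s by simp
    finally show "a = \<zero> (Cod C e) (Cod C a)" .
  qed
  from that[OF this kernelD(5)[OF m] _ _ _ e(2)[symmetric]] show ?thesis
    using e(1) by simp
qed

section \<open>Countable coproducts\<close>

lemma coproductD:
  assumes "is_coproduct C I X S i"
  shows "S \<in> Obj C" "n \<in> I \<Longrightarrow> i n \<in> Arr C" "n \<in> I \<Longrightarrow> Dom C (i n) = X n"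
    "n \<in> I \<Longrightarrow> Cod C (i n) = S" "n \<in> I \<Longrightarrow> X n \<in> Obj C"
proof -
  show "S \<in> Obj C" using assms by (simp add: is_coproduct_def)
  assume "n \<in> I"
  then have *: "i n \<in> hom C (X n) S" using assms by (simp add: is_coproduct_def)
  then show "i n \<in> Arr C" "Dom C (i n) = X n" "Cod C (i n) = S" by auto
  from * show "X n \<in> Obj C" using hom_Obj by blast
qed

lemma coproduct_copair:
  assumes "is_coproduct C I X S i" "Y \<in> Obj C" "\<And>n. n \<in> I \<Longrightarrow> f n \<in> hom C (X n) Y"
  obtains h where "h \<in> hom C S Y" "\<And>n. n \<in> I \<Longrightarrow> h \<cdot> i n = f n"
proof -
  have "\<exists>!h. h \<in> hom C S Y \<and> (\<forall>n\<in>I. h \<cdot> i n = f n)"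
    using assms unfolding is_coproduct_def by blast
  then show ?thesis using that by blast
qed

lemma coproduct_ext:
  assumes S: "is_coproduct C I X S i"
    and "f \<in> Arr C" "g \<in> Arr C" "Dom C f = S" "Dom C g = S" "Cod C g = Cod C f"
    and "\<And>n. n \<in> I \<Longrightarrow> f \<cdot> i n = g \<cdot> i n"
  shows "f = g"
proof -
  have "\<exists>!h. h \<in> hom C S (Cod C f) \<and> (\<forall>n\<in>I. h \<cdot> i n = f \<cdot> i n)"
    using S assms(2-6) coproductD[OF S] unfolding is_coproduct_def by simp
  moreover have "f \<in> hom C S (Cod C f) \<and> (\<forall>n\<in>I. f \<cdot> i n = f \<cdot> i n)" using assms by simp
  moreover have "g \<in> hom C S (Cod C f) \<and> (\<forall>n\<in>I. g \<cdot> i n = f \<cdot> i n)" using assms(2-7) by simp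
  ultimately show ?thesis by blast
qed

lemma is_coproductI:
  assumes "S \<in> Obj C" "\<And>n. n \<in> I \<Longrightarrow> i n \<in> hom C (X n) S"
    and ex: "\<And>Y f. Y \<in> Obj C \<Longrightarrow> (\<And>n. n \<in> I \<Longrightarrow> f n \<in> hom C (X n) Y) \<Longrightarrow>
      \<exists>h \<in> hom C S Y. \<forall>n \<in> I. h \<cdot> i n = f n"
    and uniq: "\<And>Y f g. f \<in> hom C S Y \<Longrightarrow> g \<in> hom C S Y \<Longrightarrow>
      (\<And>n. n \<in> I \<Longrightarrow> f \<cdot> i n = g \<cdot> i n) \<Longrightarrow> f = g"
  shows "is_coproduct C I X S i"
  unfolding is_coproduct_def
proof (intro conjI ballI allI impI)
  fix Y f assume *: "Y \<in> Obj C \<and> (\<forall>n\<in>I. f n \<in> hom C (X n) Y)"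
  then obtain h where h: "h \<in> hom C S Y" "\<forall>n\<in>I. h \<cdot> i n = f n" using ex[of Y f] by blast
  show "\<exists>!h. h \<in> hom C S Y \<and> (\<forall>n\<in>I. h \<cdot> i n = f n)"
  proof (rule ex1I[of _ h])
    fix k assume "k \<in> hom C S Y \<and> (\<forall>n\<in>I. k \<cdot> i n = f n)"
    then show "k = h" using uniq[of k Y h] h by simp
  qed (use h in blast)
qed (use assms in auto)

text \<open>The hypotheses on small sums concern index sets over \<open>'u\<close>, while gradings
  are indexed by degrees and pairs of degrees; coproducts are transported along bijections between
  the two.\<close>

lemma coproduct_reindex:
  assumes "bij_betw e I J" "is_coproduct C J X S i"
  shows "is_coproduct C I (\<lambda>n. X (e n)) S (\<lambda>n. i (e n))"
proof (rule is_coproductI)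
  note J = coproductD[OF assms(2)]
  have e: "e n \<in> J" if "n \<in> I" for n using assms(1) that by (auto simp: bij_betw_def)
  show "S \<in> Obj C" "\<And>n. n \<in> I \<Longrightarrow> i (e n) \<in> hom C (X (e n)) S" using J e by auto
  show "\<exists>h \<in> hom C S Y. \<forall>n \<in> I. h \<cdot> i (e n) = f n"
    if Y: "Y \<in> Obj C" and f: "\<And>n. n \<in> I \<Longrightarrow> f n \<in> hom C (X (e n)) Y" for Y f
  proof -
    define e' where "e' = inv_into I e"
    have e': "e' n \<in> I" "e (e' n) = n" if "n \<in> J" for n
      using assms(1) that by (auto simp: e'_def bij_betw_def f_inv_into_f inv_into_into)
    have e'e: "e' (e n) = n" if "n \<in> I" for n
      using assms(1) that by (auto simp: e'_def bij_betw_def)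
    have "f (e' n) \<in> hom C (X n) Y" if "n \<in> J" for n
      using f[of "e' n"] e'[OF that] by simp
    from coproduct_copair[OF assms(2) Y this]
    obtain h where h: "h \<in> hom C S Y" "\<And>n. n \<in> J \<Longrightarrow> h \<cdot> i n = f (e' n)" by blast
    have "\<forall>n\<in>I. h \<cdot> i (e n) = f n" using h(2) e e'e by simp
    with h(1) show ?thesis by blast
  qed
  show "f = g" if "f \<in> hom C S Y" "g \<in> hom C S Y" "\<And>n. n \<in> I \<Longrightarrow> f \<cdot> i (e n) = g \<cdot> i (e n)"
    for Y f g
  proof (rule coproduct_ext[OF assms(2)])
    fix n assume "n \<in> J"
    then obtain k where "k \<in> I" "n = e k" using assms(1) by (auto simp: bij_betw_def)
    then show "f \<cdot> i n = g \<cdot> i n" using that by blast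
  qed (use that in auto)
qed

text \<open>An infinite small set contains a copy of \<open>nat\<close>, and smallness is inherited
  by subsets; so every set coded inside the range of \<open>e\<close> is small.\<close>

lemma small_embedding:
  obtains e :: "nat \<Rightarrow> 'u" where "inj e" "\<And>A. A \<subseteq> range e \<Longrightarrow> small A"
proof -
  have "\<exists>A. infinite A \<and> small A"
    and sub: "\<forall>A B f. small A \<and> inj_on f B \<and> f ` B \<subseteq> A \<longrightarrow> small B"
    using smallness unfolding smallness_def by (rule conjunct1, rule conjunct2)
  then obtain A where A: "infinite A" "small A" by blast
  obtain e :: "nat \<Rightarrow> 'u" where e: "inj e" "range e \<subseteq> A"
    using infinite_countable_subset[OF A(1)] by blast
  have "small B" if "B \<subseteq> range e" for B
    by (rule sub[rule_format, of A id]) (use that e A in auto)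
  with e(1) show ?thesis by (rule that)
qed

text \<open>The colimit of a diagram on a discrete category is a coproduct. The injection into
  \<open>nat\<close> is a parameter because the lemma is applied both to degrees and, through
  \<open>prod_encode\<close>, to pairs of degrees.\<close>

lemma countable_coproduct_exists:
  assumes e: "inj_on (e :: 'i \<Rightarrow> nat) I" and X: "\<And>n. n \<in> I \<Longrightarrow> X n \<in> Obj C"
  obtains S i where "is_coproduct C I X S i"
proof -
  obtain u :: "nat \<Rightarrow> 'u" where u: "inj u" and sm: "\<And>A. A \<subseteq> range u \<Longrightarrow> small A"
    using small_embedding by blast
  define w where "w = u \<circ> e"
  have w: "inj_on w I" using e u by (simp add: w_def comp_inj_on inj_on_subset)
  define A where "A = w ` I"
  have "small A" by (rule sm) (auto simp: A_def w_def)
  define w' where "w' = inv_into I w"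
  have w': "w' (w n) = n" if "n \<in> I" for n using that w by (simp add: w'_def)
  have w'A: "w' a \<in> I" if "a \<in> A" for a using that w by (auto simp: A_def w')
  \<comment> \<open>The discrete category on \<open>A\<close>: every element is its own identity,
    and composable arrows are equal, so the composition may return either factor.\<close>
  define J :: "('u, 'u) category" where
    "J = \<lparr>Obj = A, Arr = A, Dom = id, Cod = id, Idn = id, Comp = (\<lambda>g f. f)\<rparr>"
  have J: "category J"
    by standard (auto simp: J_def Defs.hom_def)
  have fn: "is_functor J C (\<lambda>a. X (w' a)) (\<lambda>a. \<one> (X (w' a)))"
    using X w'A by (simp add: is_functor_def J_def)
  have sJ: "small_category small J"
    using J \<open>small A\<close> by (simp add: small_category_def J_def)
  obtain S t where S: "is_colimit J C (\<lambda>a. X (w' a)) (\<lambda>a. \<one> (X (w' a))) S t"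
    using cocomplete fn sJ unfolding cocomplete_def by blast
  have "is_coproduct C A (\<lambda>a. X (w' a)) S t"
    unfolding is_coproduct_def
  proof (intro conjI ballI allI impI)
    show "S \<in> Obj C" "\<And>n. n \<in> A \<Longrightarrow> t n \<in> hom C (X (w' n)) S"
      using S by (auto simp: is_colimit_def is_cocone_def J_def)
    fix Y f assume *: "Y \<in> Obj C \<and> (\<forall>n\<in>A. f n \<in> hom C (X (w' n)) Y)"
    have "is_cocone J C (\<lambda>a. X (w' a)) (\<lambda>a. \<one> (X (w' a))) Y f"
      using * by (simp add: is_cocone_def J_def)
    then have "\<exists>!h. h \<in> hom C S Y \<and> (\<forall>j \<in> Obj J. h \<cdot> t j = f j)"
      using S unfolding is_colimit_def by blast
    then show "\<exists>!h. h \<in> hom C S Y \<and> (\<forall>n\<in>A. h \<cdot> t n = f n)" by (simp add: J_def)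
  qed
  moreover have "bij_betw w I A" using w by (simp add: A_def bij_betw_def)
  ultimately have "is_coproduct C I (\<lambda>n. X (w' (w n))) S (\<lambda>n. t (w n))"
    using coproduct_reindex by blast
  then have "is_coproduct C I X S (\<lambda>n. t (w n))"
    by (simp add: is_coproduct_def w' cong: ball_cong)
  then show ?thesis by (rule that)
qed

text \<open>Since \<open>tensor_sums\<close> speaks about index sets over \<open>'u\<close>, the
  coproduct is reindexed by \<open>range u\<close>, tensored, and reindexed back.\<close>

lemma TenA_coproduct:
  assumes S: "is_coproduct C (UNIV :: nat set) X S i" and Y: "Y \<in> Obj C"
  shows "is_coproduct C UNIV (\<lambda>n. Y \<otimes>\<^sub>o X n) (Y \<otimes>\<^sub>o S) (\<lambda>n. \<one> Y \<otimes> i n)"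
    "is_coproduct C UNIV (\<lambda>n. X n \<otimes>\<^sub>o Y) (S \<otimes>\<^sub>o Y) (\<lambda>n. i n \<otimes> \<one> Y)"
proof -
  obtain u :: "nat \<Rightarrow> 'u" where u: "inj u" and sm: "\<And>A. A \<subseteq> range u \<Longrightarrow> small A"
    using small_embedding by blast
  have inv: "inv u (u n) = n" for n using u by simp
  have b: "bij_betw u UNIV (range u)" using u by (simp add: bij_betw_def)
  have b': "bij_betw (inv u) (range u) UNIV" using u bij_betw_inv_into b by blast
  from coproduct_reindex[OF b' S]
  have c: "is_coproduct C (range u) (\<lambda>n. X (inv u n)) S (\<lambda>n. i (inv u n))" .
  have "small (range u)" using sm by blast
  with c Y have
    "is_coproduct C (range u) (\<lambda>n. Y \<otimes>\<^sub>o X (inv u n)) (Y \<otimes>\<^sub>o S) (\<lambda>n. \<one> Y \<otimes> i (inv u n))"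
    "is_coproduct C (range u) (\<lambda>n. X (inv u n) \<otimes>\<^sub>o Y) (S \<otimes>\<^sub>o Y) (\<lambda>n. i (inv u n) \<otimes> \<one> Y)"
    using tensor_sums unfolding tensor_commutes_with_direct_sums_def by blast+
  from this[THEN coproduct_reindex[OF b]]
  show "is_coproduct C UNIV (\<lambda>n. Y \<otimes>\<^sub>o X n) (Y \<otimes>\<^sub>o S) (\<lambda>n. \<one> Y \<otimes> i n)"
    "is_coproduct C UNIV (\<lambda>n. X n \<otimes>\<^sub>o Y) (S \<otimes>\<^sub>o Y) (\<lambda>n. i n \<otimes> \<one> Y)"
    by (simp_all add: inv)
qed

text \<open>One variable at a time: over the summands of \<open>S\<close> with \<open>S'\<close>
  kept whole, and then, for each summand \<open>X a\<close>, over the summands of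
  \<open>S'\<close>.\<close>

lemma TenA_coproduct_ext:
  assumes S: "is_coproduct C (UNIV :: nat set) X S i"
    and S': "is_coproduct C (UNIV :: nat set) X' S' i'"
    and fg: "f \<in> Arr C" "g \<in> Arr C" "Dom C f = S \<otimes>\<^sub>o S'" "Dom C g = S \<otimes>\<^sub>o S'" "Cod C g = Cod C f"
    and eq: "\<And>a b. f \<cdot> (i a \<otimes> i' b) = g \<cdot> (i a \<otimes> i' b)"
  shows "f = g"
proof (rule coproduct_ext[OF TenA_coproduct(2)[OF S coproductD(1)[OF S']] fg])
  note [simp] = fg coproductD[OF S, simplified] coproductD[OF S', simplified]
  fix a
  show "f \<cdot> (i a \<otimes> \<one> S') = g \<cdot> (i a \<otimes> \<one> S')"
    by (rule coproduct_ext[OF TenA_coproduct(1)[OF S', of "X a"]]) (use eq in auto)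
qed

text \<open>For each fixed \<open>a\<close>, copairing in the second factor gives a map on
  \<open>X a \<otimes>\<^sub>o S'\<close>; these maps are then copaired in the first factor.\<close>

lemma TenA_coproduct_copair:
  assumes S: "is_coproduct C (UNIV :: nat set) X S i"
    and S': "is_coproduct C (UNIV :: nat set) X' S' i'"
    and Y: "Y \<in> Obj C" and f: "\<And>a b. f a b \<in> hom C (X a \<otimes>\<^sub>o X' b) Y"
  obtains h where "h \<in> hom C (S \<otimes>\<^sub>o S') Y" "\<And>a b. h \<cdot> (i a \<otimes> i' b) = f a b"
proof -
  note [simp] = coproductD[OF S, simplified] coproductD[OF S', simplified]
  have "\<exists>h \<in> hom C (X a \<otimes>\<^sub>o S') Y. \<forall>b. h \<cdot> (\<one> (X a) \<otimes> i' b) = f a b" for a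
  proof -
    obtain h where "h \<in> hom C (X a \<otimes>\<^sub>o S') Y" "\<And>b. h \<cdot> (\<one> (X a) \<otimes> i' b) = f a b"
      by (rule coproduct_copair[OF TenA_coproduct(1)[OF S'] Y, of "X a" "f a"]) (use f in auto)
    then show ?thesis by blast
  qed
  then obtain g where g: "g a \<in> hom C (X a \<otimes>\<^sub>o S') Y" "g a \<cdot> (\<one> (X a) \<otimes> i' b) = f a b" for a b
    by metis
  obtain h where h: "h \<in> hom C (S \<otimes>\<^sub>o S') Y" "\<And>a. h \<cdot> (i a \<otimes> \<one> S') = g a"
    by (rule coproduct_copair[OF TenA_coproduct(2)[OF S] Y, of S' g]) (use g(1) in auto)
  have "h \<cdot> (i a \<otimes> i' b) = f a b" for a b
  proof -
    have "f a b = (h \<cdot> (i a \<otimes> \<one> S')) \<cdot> (\<one> (X a) \<otimes> i' b)" using g h by simp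
    also have "\<dots> = h \<cdot> (i a \<otimes> i' b)" using h(1) by simp
    finally show ?thesis ..
  qed
  then show ?thesis using that h by blast
qed

section \<open>The projections of a countable coproduct are jointly monic\<close>

lemma Plus_cancel_Zero:
  assumes "d \<in> hom C X Y" "g \<in> hom C X Y" "d \<oplus> g = g"
  shows "d = \<zero> X Y"
proof -
  obtain g' where g': "g' \<in> hom C X Y" "g \<oplus> g' = \<zero> X Y"
    using Plus_inverse[OF assms(2)] by blast
  have "d = d \<oplus> (g \<oplus> g')" using assms(1) g' by simp
  also have "\<dots> = (d \<oplus> g) \<oplus> g'" using Plus_assoc[OF assms(1,2) g'(1)] by simp
  finally show ?thesis using assms(3) g'(2) by simp
qed

text \<open>\<open>f\<close> is the kernel of some \<open>g\<close>, and \<open>g\<close> factors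
  through the cokernel \<open>c\<close>; so whatever is killed by \<open>c\<close> is killed by
  \<open>g\<close> and factors through \<open>f\<close>.\<close>

lemma monic_kernel_of_cokernel:
  assumes f: "monic C f" and c: "is_cokernel C f c"
  shows "is_kernel C c f"
proof -
  note [simp] = cokernelD(1-3)[OF c]
  obtain g where g: "is_kernel C g f" using monic_normal[OF f] by blast
  note [simp] = kernelD(1-3)[OF g]
  have dg: "Dom C g = Cod C f" using kernelD(3)[OF g] by simp
  have "\<exists>g' \<in> hom C (Cod C c) (Cod C g). g' \<cdot> c = g"
    by (rule cokernelD(6)[OF c]) (use dg kernelD(4)[OF g] in simp_all)
  then obtain g' where g': "g' \<in> hom C (Cod C c) (Cod C g)" "g' \<cdot> c = g" by blast
  have "\<exists>!k. k \<in> hom C X (Dom C f) \<and> f \<cdot> k = h"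
    if h: "h \<in> hom C X (Dom C c)" "c \<cdot> h = \<zero> (Dom C c) (Cod C c) \<cdot> h" for X h
  proof -
    have X: "X \<in> Obj C" using h by auto
    have "(g' \<cdot> c) \<cdot> h = g' \<cdot> (c \<cdot> h)" using g' h(1) by (intro Comp_assoc') auto
    also have "\<dots> = \<zero> X (Cod C g)" unfolding h(2) using h(1) g'(1) X by simp
    finally have "g \<cdot> h = \<zero> X (Cod C g)" unfolding g'(2) .
    then have "\<exists>k \<in> hom C X (Dom C f). f \<cdot> k = h"
      using h(1) by (intro kernelD(6)[OF g]) auto
    then obtain k where k: "k \<in> hom C X (Dom C f)" "f \<cdot> k = h" by blast
    show ?thesis
    proof (rule ex1I[of _ k])
      fix k' assume "k' \<in> hom C X (Dom C f) \<and> f \<cdot> k' = h"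
      then show "k' = k" using monicD[OF f, of k' k] k by simp
    qed (use k in blast)
  qed
  then have "\<forall>X. \<forall>h \<in> hom C X (Dom C c). c \<cdot> h = \<zero> (Dom C c) (Cod C c) \<cdot> h \<longrightarrow>
      (\<exists>!k. k \<in> hom C X (Dom C f) \<and> f \<cdot> k = h)" by blast
  then show ?thesis
    using cokernelD(4)[OF c] monic_Arr[OF f] unfolding is_kernel_def is_equalizer_def by simp
qed

text \<open>The partial sums \<open>S\<^sub>n\<close> of the coproduct \<open>S\<close> are split off by idempotents \<open>e\<^sub>n\<close> annihilating
  \<open>h\<close>, hence remain subobjects of \<open>Coker h\<close>; by AB5 so does their colimit \<open>S\<close>.\<close>

lemma prj_Zero_ext:
  assumes S: "is_coproduct C (UNIV :: nat set) X S i"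
    and p: "\<And>n. p n \<in> hom C S (X n)"
    and pi: "\<And>n k. p n \<cdot> i k = (if n = k then \<one> (X n) else \<zero> (X k) (X n))"
    and h: "h \<in> hom C K S" and ph: "\<And>n. p n \<cdot> h = \<zero> K (X n)"
  shows "h = \<zero> K S"
proof -
  note [simp] = coproductD[OF S, simplified]
  have [simp]: "p n \<in> Arr C" "Dom C (p n) = S" "Cod C (p n) = X n" for n using p by auto
  have [simp]: "h \<in> Arr C" "Dom C h = K" "Cod C h = S" "K \<in> Obj C" using h by auto
  \<comment> \<open>\<open>e n\<close> is the sum of \<open>i k \<cdot> p k\<close> over
    \<open>k < n\<close>; with this strict bound \<open>i k\<close> is fixed by
    \<open>e (Suc k)\<close> and by all later idempotents.\<close>
  define e where "e = rec_nat (\<zero> S S) (\<lambda>n x. x \<oplus> i n \<cdot> p n)"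
  have e_simps: "e 0 = \<zero> S S" "e (Suc n) = e n \<oplus> i n \<cdot> p n" for n by (simp_all add: e_def)
  have [simp]: "e n \<in> Arr C \<and> Dom C (e n) = S \<and> Cod C (e n) = S" for n
    by (induction n) (simp_all add: e_simps)
  have ei: "e n \<cdot> i k = (if k < n then i k else \<zero> (X k) S)" for n k
    by (induction n) (auto simp: e_simps pi less_Suc_eq)
  have eh: "e n \<cdot> h = \<zero> K S" for n
    by (induction n) (simp_all add: e_simps ph)
  have ee: "e n \<cdot> e m = e m" if "m \<le> n" for m n
    by (rule coproduct_ext[OF S]) (use that in \<open>auto simp: ei\<close>)
  \<comment> \<open>The idempotent is split through its image: \<open>A n\<close> plays the role of
    the finite partial sum, with inclusion \<open>s n\<close> and retraction
    \<open>r n\<close>.\<close>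
  have "\<exists>A s r. r \<in> hom C S A \<and> s \<in> hom C A S \<and> epic C r \<and> monic C s \<and> e n = s \<cdot> r" for n
  proof -
    obtain r s where rs: "epic C r" "monic C s" "Cod C r = Dom C s" "Dom C r = Dom C (e n)"
      "Cod C s = Cod C (e n)" "e n = s \<cdot> r"
      using image_factorization[of "e n"] by auto
    have "Dom C r = S" "Cod C s = S" using rs(4,5) by simp_all
    then have "r \<in> hom C S (Dom C s)" "s \<in> hom C (Dom C s) S"
      using rs(3) monic_Arr[OF rs(2)] epic_Arr[OF rs(1)] by simp_all
    with rs(1,2,6) show ?thesis by blast
  qed
  then obtain A s r where *: "\<And>n. r n \<in> hom C S (A n)" "\<And>n. s n \<in> hom C (A n) S"
    and r: "\<And>n. epic C (r n)" and s: "\<And>n. monic C (s n)" and esr: "\<And>n. e n = s n \<cdot> r n"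
    by metis
  have [simp]: "r n \<in> Arr C" "Dom C (r n) = S" "Cod C (r n) = A n"
    "s n \<in> Arr C" "Dom C (s n) = A n" "Cod C (s n) = S" for n
    using * by auto
  have [simp]: "A n \<in> Obj C" for n using Cod_Obj[of "r n"] by simp
  \<comment> \<open>Later idempotents fix \<open>e m\<close>, and cancelling the epic
    \<open>r m\<close> shows that they fix \<open>s m\<close>; cancelling the monic
    \<open>s n\<close> afterwards makes \<open>r n\<close> a left inverse of
    \<open>s n\<close>.\<close>
  have es: "e n \<cdot> s m = s m" if "m \<le> n" for m n
  proof (rule epicD[OF r])
    show "e n \<cdot> s m \<cdot> r m = s m \<cdot> r m" using ee[OF that] unfolding esr[of m] by simp
  qed auto
  have rs: "r n \<cdot> s n = \<one> (A n)" for n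
    by (rule monicD[OF s]) (use es[of n n] in \<open>auto simp: esr\<close>)
  have srs: "s n \<cdot> (r n \<cdot> s m) = s m" if "m \<le> n" for m n
    using es[OF that] by (simp add: esr)
  have sri: "s n \<cdot> (r n \<cdot> i k) = (if k < n then i k else \<zero> (X k) S)" for n k
    using ei[of n k] by (simp add: esr)
  have ri: "r n \<cdot> i k = \<zero> (X k) (A n)" if "\<not> k < n" for n k
    by (rule monicD[OF s[of n]]) (use that sri[of n k] in auto)

  obtain q where q: "is_cokernel C h q" using cokernels[of h] by auto
  define Q where "Q = Cod C q"
  have [simp]: "q \<in> Arr C" "Dom C q = S" "Cod C q = Q" and qh: "q \<cdot> h = \<zero> K Q"
    using cokernelD(2-4)[OF q] by (simp_all add: Q_def)
  have [simp]: "Q \<in> Obj C" using Cod_Obj[of q] by simp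
  \<comment> \<open>As \<open>e n\<close> kills \<open>h\<close>, it factors through the cokernel as
    \<open>\<tau> n \<cdot> q\<close>. Hence \<open>s n = \<tau> n \<cdot> q \<cdot> s n\<close>,
    and \<open>q \<cdot> s n\<close> is monic because \<open>s n\<close> is.\<close>
  have "\<exists>\<tau> \<in> hom C Q S. \<tau> \<cdot> q = e n" for n
    unfolding Q_def by (rule cokernelD(6)[OF q]) (use eh in auto)
  then obtain \<tau> where \<tau>: "\<And>n. \<tau> n \<in> hom C Q S" "\<And>n. \<tau> n \<cdot> q = e n" by metis
  define f where "f n = q \<cdot> s n" for n
  have [simp]: "f n \<in> Arr C" "Dom C (f n) = A n" "Cod C (f n) = Q" for n by (simp_all add: f_def)
  have f: "monic C (f n)" for n
  proof (rule monic_ZeroI)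
    fix g assume g: "g \<in> Arr C" "Cod C g = Dom C (f n)" "f n \<cdot> g = \<zero> (Dom C g) (Cod C (f n))"
    have "s n \<cdot> g = (e n \<cdot> s n) \<cdot> g" using es[of n n] by simp
    also have "\<dots> = \<tau> n \<cdot> (f n \<cdot> g)" using g(1,2) \<tau>(1)[of n] by (simp add: \<tau>(2)[symmetric] f_def)
    also have "\<dots> = s n \<cdot> \<zero> (Dom C g) (A n)" using g \<tau>(1)[of n] by simp
    finally have "s n \<cdot> g = s n \<cdot> \<zero> (Dom C g) (A n)" .
    then have "g = \<zero> (Dom C g) (A n)" by (rule monicD[OF s[of n]]) (use g(1,2) in simp_all)
    then show "g = \<zero> (Dom C g) (Dom C (f n))" by simp
  qed simp
  \<comment> \<open>With its cokernel \<open>c n\<close>, each \<open>f n\<close> gives a short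
    exact sequence with the constant middle term \<open>Q\<close>; these sequences form the filtered
    diagram to which AB5 is applied.\<close>
  have "\<exists>c. is_cokernel C (f n) c" for n using cokernels[of "f n"] by auto
  then obtain c where c: "\<And>n. is_cokernel C (f n) (c n)" by metis
  define Z where "Z n = Cod C (c n)" for n
  have [simp]: "c n \<in> Arr C" "Dom C (c n) = Q" "Cod C (c n) = Z n"
    and cf: "c n \<cdot> f n = \<zero> (A n) (Z n)" for n
    using cokernelD(2-4)[OF c[of n]] by (simp_all add: Z_def)
  have [simp]: "Z n \<in> Obj C" for n using Cod_Obj[of "c n"] by simp
  have ft: "f n \<cdot> (r n \<cdot> s m) = f m" if "m \<le> n" for m n
    using srs[OF that] by (simp add: f_def)
  have "\<exists>z \<in> hom C (Z m) (Z n). z \<cdot> c m = c n" if "m \<le> n" for m n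
  proof -
    have "c n \<cdot> f m = (c n \<cdot> f n) \<cdot> (r n \<cdot> s m)" using ft[OF that] by simp
    also have "\<dots> = \<zero> (A m) (Z n)" by (simp add: cf)
    finally show ?thesis unfolding Z_def[of m] by (intro cokernelD(6)[OF c[of m]]) auto
  qed
  then obtain z where z: "\<And>m n. m \<le> n \<Longrightarrow> z m n \<in> hom C (Z m) (Z n)"
    and zc: "\<And>m n. m \<le> n \<Longrightarrow> z m n \<cdot> c m = c n" by metis
  have zt [simp]: "z m n \<in> Arr C" "Dom C (z m n) = Z m" "Cod C (z m n) = Z n" if "m \<le> n" for m n
    using z[OF that] by auto
  \<comment> \<open>The maps \<open>z m n\<close> come from a bare existence statement; comparing
    arrows out of \<open>Z m\<close> after the epic \<open>c m\<close> is what yields their functor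
    laws.\<close>
  have z_eq: "x = x'" if "x \<cdot> c m = x' \<cdot> c m" "x \<in> Arr C" "x' \<in> Arr C" "Dom C x = Z m"
    "Dom C x' = Z m" "Cod C x' = Cod C x" for x x' m
    by (rule epicD[OF cokernelD(5)[OF c[of m]]]) (use that in auto)

  obtain u :: "nat \<Rightarrow> 'u" where u: "inj u" and sm: "\<And>A. A \<subseteq> range u \<Longrightarrow> small A"
    using small_embedding by blast
  define d where "d = inv u"
  have [simp]: "d (u n) = n" for n using u by (simp add: d_def)
  define dm where "dm a = fst (prod_decode (d a))" for a
  define cd where "cd a = snd (prod_decode (d a))" for a
  define w where "w m n = u (prod_encode (m, n))" for m n
  have [simp]: "dm (w m n) = m" "cd (w m n) = n" for m n by (simp_all add: dm_def cd_def w_def)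
  have w_eq: "a = w m n" if "dm a = m" "cd a = n" "a \<in> range u" for a m n
    using that by (auto simp: dm_def cd_def w_def)
  \<comment> \<open>The ordered set of natural numbers as a category with objects and arrows in
    \<open>'u\<close>: \<open>u n\<close> is the object n, and the code \<open>w m n\<close> of a
    pair with \<open>m \<le> n\<close> is the arrow from m to n. All codes lie in the range of
    \<open>u\<close>, which gives smallness.\<close>
  define J :: "('u, 'u) category" where
    "J = \<lparr>Obj = range u, Arr = {a \<in> range u. dm a \<le> cd a}, Dom = (\<lambda>a. u (dm a)),
      Cod = (\<lambda>a. u (cd a)), Idn = (\<lambda>x. w (d x) (d x)), Comp = (\<lambda>b a. w (dm a) (cd b))\<rparr>"
  have wu [simp]: "w m n \<in> range u" for m n by (simp add: w_def)
  have [simp]: "u m = u n \<longleftrightarrow> m = n" for m n using u by (simp add: inj_eq)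
  have J: "category J"
    by standard (auto simp: J_def Defs.hom_def intro: w_eq[symmetric])
  have sJ: "small_category small J"
    unfolding small_category_def using J by (auto simp: J_def intro!: sm)
  have filt: "filtered J"
    unfolding filtered_def
  proof (intro conjI ballI allI impI)
    show "Obj J \<noteq> {}" by (simp add: J_def)
    show "\<exists>k a b. a \<in> hom J x k \<and> b \<in> hom J y k" if "x \<in> Obj J" "y \<in> Obj J" for x y
    proof -
      from that obtain m n where [simp]: "x = u m" "y = u n" by (auto simp: J_def)
      show ?thesis
        by (rule exI[of _ "u (max m n)"], rule exI[of _ "w m (max m n)"], rule exI[of _ "w n (max m n)"])
          (simp add: J_def Defs.hom_def)
    qed
    show "\<exists>k. \<exists>v \<in> hom J y k. v \<cdot>\<^bsub>J\<^esub> a = v \<cdot>\<^bsub>J\<^esub> b" if "a \<in> hom J x y \<and> b \<in> hom J x y" for x y a b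
      using that
      by (intro exI[of _ y] bexI[of _ "w (cd a) (cd a)"]) (auto simp: J_def Defs.hom_def)
  qed
  have fA: "is_functor J C (\<lambda>x. A (d x)) (\<lambda>a. r (cd a) \<cdot> s (dm a))"
    unfolding is_functor_def
    by (auto simp: J_def rs srs)
  have fQ: "is_functor J C (\<lambda>x. Q) (\<lambda>a. \<one> Q)"
    unfolding is_functor_def by (simp add: J_def)
  have fZ: "is_functor J C (\<lambda>x. Z (d x)) (\<lambda>a. z (dm a) (cd a))"
    unfolding is_functor_def
  proof (intro conjI ballI impI)
    show "z (dm (\<one>\<^bsub>J\<^esub> j)) (cd (\<one>\<^bsub>J\<^esub> j)) = \<one> (Z (d j))" if "j \<in> Obj J" for j
      by (rule z_eq[of _ "d j"]) (auto simp: J_def zc)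
    show "z (dm (v \<cdot>\<^bsub>J\<^esub> a)) (cd (v \<cdot>\<^bsub>J\<^esub> a)) = z (dm v) (cd v) \<cdot> z (dm a) (cd a)"
      if "a \<in> Arr J" "v \<in> Arr J" "Dom J v = Cod J a" for a v
      by (rule z_eq[of _ "dm a"]) (use that in \<open>auto simp: J_def zc\<close>)
  qed (auto simp: J_def)
  have nf: "is_nat_trans J C (\<lambda>x. A (d x)) (\<lambda>a. r (cd a) \<cdot> s (dm a)) (\<lambda>x. Q) (\<lambda>a. \<one> Q) (\<lambda>x. f (d x))"
    unfolding is_nat_trans_def by (auto simp: J_def ft)
  have ng: "is_nat_trans J C (\<lambda>x. Q) (\<lambda>a. \<one> Q) (\<lambda>x. Z (d x)) (\<lambda>a. z (dm a) (cd a)) (\<lambda>x. c (d x))"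
    unfolding is_nat_trans_def by (auto simp: J_def zc)
  have se: "short_exact C (f n) (c n)" for n
    unfolding short_exact_def using monic_kernel_of_cokernel[OF f c] c by blast
  have cA: "is_colimit J C (\<lambda>x. A (d x)) (\<lambda>a. r (cd a) \<cdot> s (dm a)) S (\<lambda>x. s (d x))"
    unfolding is_colimit_def
  proof (intro conjI allI impI)
    show "is_cocone J C (\<lambda>x. A (d x)) (\<lambda>a. r (cd a) \<cdot> s (dm a)) S (\<lambda>x. s (d x))"
      by (auto simp: is_cocone_def J_def srs)
    fix Y \<sigma>' assume Y: "is_cocone J C (\<lambda>x. A (d x)) (\<lambda>a. r (cd a) \<cdot> s (dm a)) Y \<sigma>'"
    define \<sigma> where "\<sigma> n = \<sigma>' (u n)" for n
    have [simp]: "Y \<in> Obj C" "\<sigma> n \<in> Arr C" "Dom C (\<sigma> n) = A n" "Cod C (\<sigma> n) = Y" for n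
      using Y by (auto simp: is_cocone_def \<sigma>_def J_def)
    have \<sigma>: "\<sigma> n \<cdot> (r n \<cdot> s m) = \<sigma> m" if "m \<le> n" for m n
    proof -
      have "w m n \<in> Arr J" using that by (simp add: J_def)
      with Y have "\<sigma>' (Cod J (w m n)) \<cdot> (r (cd (w m n)) \<cdot> s (dm (w m n))) = \<sigma>' (Dom J (w m n))"
        unfolding is_cocone_def by blast
      then show ?thesis by (simp add: \<sigma>_def J_def)
    qed
    \<comment> \<open>On the summand of degree \<open>k\<close> the map out of \<open>S\<close> is
      read off at stage \<open>Suc k\<close>, the first partial sum that contains this
      summand.\<close>
    obtain g where g: "g \<in> hom C S Y" and gi: "\<And>k. g \<cdot> i k = \<sigma> (Suc k) \<cdot> (r (Suc k) \<cdot> i k)"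
      by (rule coproduct_copair[OF S, of Y "\<lambda>k. \<sigma> (Suc k) \<cdot> (r (Suc k) \<cdot> i k)"]) auto
    have [simp]: "g \<in> Arr C" "Dom C g = S" "Cod C g = Y" using g by auto
    have gs: "g \<cdot> s n = \<sigma> n" for n
    proof (rule epicD[OF r[of n]])
      show "g \<cdot> s n \<cdot> r n = \<sigma> n \<cdot> r n"
      proof (rule coproduct_ext[OF S])
        fix k
        show "g \<cdot> s n \<cdot> r n \<cdot> i k = \<sigma> n \<cdot> r n \<cdot> i k"
        proof (cases "k < n")
          case True
          have "\<sigma> n \<cdot> (r n \<cdot> i k) = \<sigma> n \<cdot> (r n \<cdot> (s (Suc k) \<cdot> (r (Suc k) \<cdot> i k)))"
            by (simp add: sri)
          also have "\<dots> = (\<sigma> n \<cdot> (r n \<cdot> s (Suc k))) \<cdot> (r (Suc k) \<cdot> i k)" by simp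
          also have "\<dots> = g \<cdot> i k" using True by (simp add: \<sigma> gi)
          finally show ?thesis using True by (simp add: sri)
        qed (simp add: sri ri)
      qed auto
    qed auto
    show "\<exists>!g. g \<in> hom C S Y \<and> (\<forall>j\<in>Obj J. g \<cdot> s (d j) = \<sigma>' j)"
    proof (rule ex1I[of _ g])
      show "g \<in> hom C S Y \<and> (\<forall>j\<in>Obj J. g \<cdot> s (d j) = \<sigma>' j)"
        using g gs by (auto simp: J_def \<sigma>_def)
      fix g' assume g': "g' \<in> hom C S Y \<and> (\<forall>j\<in>Obj J. g' \<cdot> s (d j) = \<sigma>' j)"
      have g's: "g' \<cdot> s n = g \<cdot> s n" for n using g' gs[of n] by (simp add: J_def \<sigma>_def)
      have [simp]: "g' \<in> Arr C" "Dom C g' = S" "Cod C g' = Y" using g' by auto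
      show "g' = g"
      proof (rule coproduct_ext[OF S])
        fix k
        have "g' \<cdot> i k = (g' \<cdot> s (Suc k)) \<cdot> (r (Suc k) \<cdot> i k)" by (simp add: sri)
        also have "\<dots> = (g \<cdot> s (Suc k)) \<cdot> (r (Suc k) \<cdot> i k)" by (simp only: g's)
        also have "\<dots> = g \<cdot> i k" by (simp add: sri)
        finally show "g' \<cdot> i k = g \<cdot> i k" .
      qed auto
    qed
  qed
  \<comment> \<open>A cocone on the constant diagram has equal legs, because every stage receives an
    arrow from stage 0.\<close>
  have cQ: "is_colimit J C (\<lambda>x. Q) (\<lambda>a. \<one> Q) Q (\<lambda>x. \<one> Q)"
    unfolding is_colimit_def
  proof (intro conjI allI impI)
    show "is_cocone J C (\<lambda>x. Q) (\<lambda>a. \<one> Q) Q (\<lambda>x. \<one> Q)" by (auto simp: is_cocone_def J_def)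
    fix Y \<sigma> assume Y: "is_cocone J C (\<lambda>x. Q) (\<lambda>a. \<one> Q) Y \<sigma>"
    have ty: "\<sigma> (u n) \<in> hom C Q Y" for n using Y by (auto simp: is_cocone_def J_def)
    have eq: "\<sigma> (u n) = \<sigma> (u 0)" for n
    proof -
      have "w 0 n \<in> Arr J" by (simp add: J_def)
      with Y have "\<sigma> (Cod J (w 0 n)) \<cdot> \<one> Q = \<sigma> (Dom J (w 0 n))"
        unfolding is_cocone_def by blast
      then show ?thesis using ty[of n] by (simp add: J_def)
    qed
    show "\<exists>!g. g \<in> hom C Q Y \<and> (\<forall>j\<in>Obj J. g \<cdot> \<one> Q = \<sigma> j)"
    proof (rule ex1I[of _ "\<sigma> (u 0)"])
      show "\<sigma> (u 0) \<in> hom C Q Y \<and> (\<forall>j\<in>Obj J. \<sigma> (u 0) \<cdot> \<one> Q = \<sigma> j)"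
        using ty[of 0] by (auto simp: J_def eq[symmetric])
    qed (auto simp: J_def)
  qed
  obtain D v where D: "is_colimit J C (\<lambda>x. Z (d x)) (\<lambda>a. z (dm a) (cd a)) D v"
    using cocomplete sJ fZ unfolding cocomplete_def by blast
  then have Dc: "is_cocone J C (\<lambda>x. Z (d x)) (\<lambda>a. z (dm a) (cd a)) D v"
    by (simp add: is_colimit_def)
  have [simp]: "v (u n) \<in> Arr C" "Dom C (v (u n)) = Z n" "Cod C (v (u n)) = D" for n
    using Dc by (auto simp: is_cocone_def J_def)
  \<comment> \<open>The composites through all stages agree, so stage 0 already represents the
    induced map from \<open>Q\<close> to \<open>D\<close>.\<close>
  have vc: "v (u n) \<cdot> c n = v (u 0) \<cdot> c 0" for n
  proof -
    have "w 0 n \<in> Arr J" by (simp add: J_def)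
    with Dc have "v (Cod J (w 0 n)) \<cdot> z (dm (w 0 n)) (cd (w 0 n)) = v (Dom J (w 0 n))"
      unfolding is_cocone_def by blast
    then have "v (u n) \<cdot> z 0 n = v (u 0)" by (simp add: J_def)
    then have "v (u 0) \<cdot> c 0 = (v (u n) \<cdot> z 0 n) \<cdot> c 0" by simp
    also have "\<dots> = v (u n) \<cdot> c n" by (simp add: zc)
    finally show ?thesis ..
  qed
  have q1: "\<forall>j\<in>Obj J. q \<cdot> s (d j) = \<one> Q \<cdot> f (d j)" by (auto simp: J_def f_def)
  have g1: "\<forall>j\<in>Obj J. (v (u 0) \<cdot> c 0) \<cdot> \<one> Q = v j \<cdot> c (d j)"
    by (auto simp: J_def vc[symmetric])
  have ses: "\<forall>j\<in>Obj J. short_exact C (f (d j)) (c (d j))" using se by blast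
  have qh0: "q \<in> hom C S Q" "v (u 0) \<cdot> c 0 \<in> hom C Q D" by auto
  note AB5' = AB5[unfolded AB5_def, THEN conjunct2, rule_format]
  \<comment> \<open>In the colimit the sequences become
    \<open>S \<rightarrow> Q \<rightarrow> D\<close>, whose first map is \<open>q\<close>. Exactness
    makes this cokernel of \<open>h\<close> monic, which forces \<open>h\<close> to be zero.\<close>
  have "short_exact C q (v (u 0) \<cdot> c 0)"
    by (rule AB5'[OF conjI[OF sJ conjI[OF filt conjI[OF fA conjI[OF fQ conjI[OF fZ conjI[OF nf
      conjI[OF ng conjI[OF ses conjI[OF cA conjI[OF cQ conjI[OF D conjI[OF qh0(1) conjI[OF q1
      conjI[OF qh0(2) g1]]]]]]]]]]]]]]])
  then have "monic C q" unfolding short_exact_def using kernelD(5) by blast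
  then show ?thesis by (rule monicD) (use qh in auto)
qed

lemma prj_ext:
  assumes S: "is_coproduct C (UNIV :: nat set) X S i"
    and p: "\<And>n. p n \<in> hom C S (X n)"
    and pi: "\<And>n k. p n \<cdot> i k = (if n = k then \<one> (X n) else \<zero> (X k) (X n))"
    and h: "h \<in> hom C K S" "h' \<in> hom C K S" and ph: "\<And>n. p n \<cdot> h = p n \<cdot> h'"
  shows "h = h'"
proof -
  obtain d where d: "d \<in> hom C K S" "h = d \<oplus> h'" using diff_exists[OF h] .
  have "p n \<cdot> d = \<zero> K (X n)" for n
  proof (rule Plus_cancel_Zero)
    show "p n \<cdot> d \<oplus> p n \<cdot> h' = p n \<cdot> h'" using ph[of n] d h p[of n] by simp
  qed (use p[of n] d h in auto)
  then have "d = \<zero> K S" by (rule prj_Zero_ext[OF S p pi d(1)])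
  then show ?thesis using d h by simp
qed

section \<open>Graded objects\<close>

lemma graded_objectD:
  assumes "graded_object X"
  shows "inc X n \<in> Arr C" "Dom C (inc X n) = cmp X n" "Cod C (inc X n) = tot X"
    "prj X n \<in> Arr C" "Dom C (prj X n) = tot X" "Cod C (prj X n) = cmp X n"
    "cmp X n \<in> Obj C" "tot X \<in> Obj C"
    "prj X n \<cdot> inc X k = (if n = k then \<one> (cmp X n) else \<zero> (cmp X k) (cmp X n))"
  using assms unfolding graded_object_def is_coproduct_def by auto

lemma graded_coproduct: "graded_object X \<Longrightarrow> is_coproduct C UNIV (cmp X) (tot X) (inc X)"
  by (simp add: graded_object_def)

lemma prj_inc_Comp:
  assumes X: "graded_object X" and "x \<in> Arr C" "Cod C x = cmp X k"
  shows "prj X n \<cdot> (inc X k \<cdot> x) = (if n = k then x else \<zero> (Dom C x) (cmp X n))"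
proof -
  note [simp] = graded_objectD[OF X]
  have "prj X n \<cdot> (inc X k \<cdot> x) = (prj X n \<cdot> inc X k) \<cdot> x"
    using assms(2,3) by (intro Comp_assoc'[symmetric]) simp_all
  then show ?thesis using assms(2,3) by simp
qed

lemma graded_ext:
  assumes "graded_object X" "f \<in> Arr C" "g \<in> Arr C" "Dom C f = tot X" "Dom C g = tot X"
    "Cod C g = Cod C f" "\<And>n. f \<cdot> inc X n = g \<cdot> inc X n"
  shows "f = g"
  by (rule coproduct_ext[OF graded_coproduct[OF assms(1)] assms(2-6)]) (rule assms(7))

lemma graded_prj_ext:
  assumes X: "graded_object X" and "f \<in> Arr C" "g \<in> Arr C" "Cod C f = tot X" "Cod C g = tot X"
    "Dom C g = Dom C f" "\<And>n. prj X n \<cdot> f = prj X n \<cdot> g"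
  shows "f = g"
  by (rule prj_ext[OF graded_coproduct[OF X], of "prj X"])
    (use assms in \<open>simp_all add: graded_objectD\<close>)

lemma graded_TenA_ext:
  assumes "graded_object X" "graded_object Y" "f \<in> Arr C" "g \<in> Arr C"
    "Dom C f = tot X \<otimes>\<^sub>o tot Y" "Dom C g = tot X \<otimes>\<^sub>o tot Y" "Cod C g = Cod C f"
    "\<And>a b. f \<cdot> (inc X a \<otimes> inc Y b) = g \<cdot> (inc X a \<otimes> inc Y b)"
  shows "f = g"
  by (rule TenA_coproduct_ext[OF graded_coproduct graded_coproduct]) (fact assms)+

text \<open>Joint monicity is applied twice, to the coproduct in the first tensor factor and then to
  the one in the second; in each case the tensored projections are again dual to the tensored
  injections.\<close>

lemma graded_TenA_prj_ext:
  assumes X: "graded_object X" and Y: "graded_object Y"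
    and fg: "f \<in> Arr C" "g \<in> Arr C" "Cod C f = tot X \<otimes>\<^sub>o tot Y" "Cod C g = tot X \<otimes>\<^sub>o tot Y"
    "Dom C g = Dom C f"
    and eq: "\<And>a b. (prj X a \<otimes> prj Y b) \<cdot> f = (prj X a \<otimes> prj Y b) \<cdot> g"
  shows "f = g"
proof (rule prj_ext[OF TenA_coproduct(2)[OF graded_coproduct[OF X], of "tot Y"]])
  note [simp] = graded_objectD[OF X] graded_objectD[OF Y] fg
  show "prj X a \<otimes> \<one> (tot Y) \<in> hom C (tot X \<otimes>\<^sub>o tot Y) (cmp X a \<otimes>\<^sub>o tot Y)"
    "f \<in> hom C (Dom C f) (tot X \<otimes>\<^sub>o tot Y)" "g \<in> hom C (Dom C f) (tot X \<otimes>\<^sub>o tot Y)"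
    "tot Y \<in> Obj C"
    "(prj X a \<otimes> \<one> (tot Y)) \<cdot> (inc X k \<otimes> \<one> (tot Y)) = (if a = k then \<one> (cmp X a \<otimes>\<^sub>o tot Y)
      else \<zero> (cmp X k \<otimes>\<^sub>o tot Y) (cmp X a \<otimes>\<^sub>o tot Y))" for a k
    by simp_all
  show "(prj X a \<otimes> \<one> (tot Y)) \<cdot> f = (prj X a \<otimes> \<one> (tot Y)) \<cdot> g" for a
  proof (rule prj_ext[OF TenA_coproduct(1)[OF graded_coproduct[OF Y], of "cmp X a"]])
    show "\<one> (cmp X a) \<otimes> prj Y b \<in> hom C (cmp X a \<otimes>\<^sub>o tot Y) (cmp X a \<otimes>\<^sub>o cmp Y b)"
      "(prj X a \<otimes> \<one> (tot Y)) \<cdot> f \<in> hom C (Dom C f) (cmp X a \<otimes>\<^sub>o tot Y)"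
      "(prj X a \<otimes> \<one> (tot Y)) \<cdot> g \<in> hom C (Dom C f) (cmp X a \<otimes>\<^sub>o tot Y)"
      "cmp X a \<in> Obj C"
      "(\<one> (cmp X a) \<otimes> prj Y b) \<cdot> (\<one> (cmp X a) \<otimes> inc Y k) = (if b = k
        then \<one> (cmp X a \<otimes>\<^sub>o cmp Y b) else \<zero> (cmp X a \<otimes>\<^sub>o cmp Y k) (cmp X a \<otimes>\<^sub>o cmp Y b))" for b k
      by simp_all
    show "(\<one> (cmp X a) \<otimes> prj Y b) \<cdot> ((prj X a \<otimes> \<one> (tot Y)) \<cdot> f) =
        (\<one> (cmp X a) \<otimes> prj Y b) \<cdot> ((prj X a \<otimes> \<one> (tot Y)) \<cdot> g)" for b
      using eq by simp
  qed
qed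

text \<open>Both sides have the same components, which suffices by joint monicity of the
  projections. This is how a map into a graded object is placed in a single degree.\<close>

lemma eq_inc_prj:
  assumes Y: "graded_object Y" and f: "f \<in> hom C A (tot Y)"
    and 0: "\<And>k. k \<noteq> n \<Longrightarrow> prj Y k \<cdot> f = \<zero> A (cmp Y k)"
  shows "f = inc Y n \<cdot> (prj Y n \<cdot> f)"
proof (rule graded_prj_ext[OF Y])
  note [simp] = graded_objectD[OF Y]
  have [simp]: "f \<in> Arr C" "Dom C f = A" "Cod C f = tot Y" using f by auto
  show "prj Y k \<cdot> f = prj Y k \<cdot> (inc Y n \<cdot> (prj Y n \<cdot> f))" for k
    using 0[of k] by (cases "k = n") (simp_all add: prj_inc_Comp[OF Y])
qed (use f graded_objectD[OF Y] in auto)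

text \<open>Gradedness becomes the vanishing of the off-diagonal components; the diagonal ones are
  then the summands of \<open>f\<close>.\<close>

lemma is_direct_sum_ofI:
  assumes X: "graded_object X" and Y: "graded_object Y" and f: "f \<in> hom C (tot X) (tot Y)"
    and "\<And>n k. k \<noteq> n \<Longrightarrow> prj Y k \<cdot> (f \<cdot> inc X n) = \<zero> (cmp X n) (cmp Y k)"
  shows "is_direct_sum_of X Y f (\<lambda>n. prj Y n \<cdot> (f \<cdot> inc X n))"
proof -
  note [simp] = graded_objectD[OF X] graded_objectD[OF Y]
  have [simp]: "f \<in> Arr C" "Dom C f = tot X" "Cod C f = tot Y" using f by auto
  have "f \<cdot> inc X n = inc Y n \<cdot> (prj Y n \<cdot> (f \<cdot> inc X n))" for n
    by (rule eq_inc_prj[OF Y]) (simp_all add: assms(4))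
  then show ?thesis by (simp add: is_direct_sum_of_def)
qed

lemma is_direct_sum_ofD:
  assumes X: "graded_object X" and Y: "graded_object Y" and f: "is_direct_sum_of X Y f fn"
  shows "fn n \<in> Arr C" "Dom C (fn n) = cmp X n" "Cod C (fn n) = cmp Y n"
    "f \<in> Arr C" "Dom C f = tot X" "Cod C f = tot Y"
    "f \<cdot> inc X n = inc Y n \<cdot> fn n" "prj Y n \<cdot> f = fn n \<cdot> prj X n"
proof -
  note [simp] = graded_objectD[OF X] graded_objectD[OF Y]
  show 1 [simp]: "fn n \<in> Arr C" "Dom C (fn n) = cmp X n" "Cod C (fn n) = cmp Y n"
    "f \<in> Arr C" "Dom C f = tot X" "Cod C f = tot Y"
    "f \<cdot> inc X n = inc Y n \<cdot> fn n" for n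
    using f by (auto simp: is_direct_sum_of_def)
  show "prj Y n \<cdot> f = fn n \<cdot> prj X n"
    by (rule graded_ext[OF X]) (simp_all add: prj_inc_Comp[OF Y])
qed

lemma graded_morphismD:
  assumes X: "graded_object X" and Y: "graded_object Y" and f: "graded_morphism X Y f" and "k \<noteq> n"
  shows "prj Y k \<cdot> (f \<cdot> inc X n) = \<zero> (cmp X n) (cmp Y k)"
proof -
  obtain fn where fn: "is_direct_sum_of X Y f fn" using f by (auto simp: graded_morphism_def)
  note [simp] = is_direct_sum_ofD[OF X Y fn]
  show ?thesis using \<open>k \<noteq> n\<close> by (simp add: prj_inc_Comp[OF Y])
qed

text \<open>The definition of a graded bialgebra asks for some grading of the tensor square, and
  this provides it: the injections come from copairing over the pairs with sum \<open>n\<close>, the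
  projections from copairing in two variables with value zero off these pairs.\<close>

lemma graded_tensor_exists:
  assumes X: "graded_object X" and Y: "graded_object Y"
  obtains Z where "graded_tensor X Y Z"
proof -
  note [simp] = graded_objectD[OF X] graded_objectD[OF Y]
  define P where "P n = {(a, b). a + b = (n :: nat)}" for n
  define XY where "XY = (\<lambda>(a, b). cmp X a \<otimes>\<^sub>o cmp Y b)"
  have "\<exists>Z j. is_coproduct C (P n) XY Z j" for n
  proof -
    have inj: "inj_on prod_encode (P n)" using inj_on_subset[OF inj_prod_encode] by blast
    have "XY ab \<in> Obj C" for ab by (cases ab) (simp add: XY_def)
    then obtain Z j where "is_coproduct C (P n) XY Z j"
      by (rule countable_coproduct_exists[OF inj])
    then show ?thesis by blast
  qed
  then obtain Z j where Z: "\<And>n. is_coproduct C (P n) XY (Z n) (j n)" by metis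
  \<comment> \<open>The injections are written at the index \<open>a + b\<close>, so that their
    types hold without a side condition \<open>a + b = n\<close>.\<close>
  have [simp]: "j (a + b) (a, b) \<in> Arr C" "Dom C (j (a + b) (a, b)) = cmp X a \<otimes>\<^sub>o cmp Y b"
    "Cod C (j (a + b) (a, b)) = Z (a + b)" for a b
    using coproductD(2-4)[OF Z[of "a + b"], of "(a, b)"] by (simp_all add: P_def XY_def)
  have [simp]: "Z n \<in> Obj C" for n using coproductD(1)[OF Z] .
  have Z_ext: "f = g" if "f \<in> Arr C" "g \<in> Arr C" "Dom C f = Z n" "Dom C g = Z n" "Cod C g = Cod C f"
    "\<And>a b. a + b = n \<Longrightarrow> f \<cdot> j (a + b) (a, b) = g \<cdot> j (a + b) (a, b)" for f g n
    by (rule coproduct_ext[OF Z[of n] that(1-5)]) (use that(6) in \<open>auto simp: P_def\<close>)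
  have "\<exists>h \<in> hom C (Z n) (tot X \<otimes>\<^sub>o tot Y). \<forall>a b. a + b = n \<longrightarrow>
      h \<cdot> j (a + b) (a, b) = inc X a \<otimes> inc Y b" for n
  proof -
    obtain h where h: "h \<in> hom C (Z n) (tot X \<otimes>\<^sub>o tot Y)"
      "\<And>ab. ab \<in> P n \<Longrightarrow> h \<cdot> j n ab = inc X (fst ab) \<otimes> inc Y (snd ab)"
      by (rule coproduct_copair[OF Z[of n], of "tot X \<otimes>\<^sub>o tot Y" "\<lambda>ab. inc X (fst ab) \<otimes> inc Y (snd ab)"])
        (auto simp: P_def XY_def)
    have "\<forall>a b. a + b = n \<longrightarrow> h \<cdot> j (a + b) (a, b) = inc X a \<otimes> inc Y b"
      using h(2) by (auto simp: P_def)
    with h(1) show ?thesis by blast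
  qed
  then obtain i where i: "\<And>n. i n \<in> hom C (Z n) (tot X \<otimes>\<^sub>o tot Y)"
    and "\<And>n a b. a + b = n \<Longrightarrow> i n \<cdot> j (a + b) (a, b) = inc X a \<otimes> inc Y b" by metis
  then have ij: "i (a + b) \<cdot> j (a + b) (a, b) = inc X a \<otimes> inc Y b" for a b by blast
  have [simp]: "i n \<in> Arr C" "Dom C (i n) = Z n" "Cod C (i n) = tot X \<otimes>\<^sub>o tot Y" for n
    using i by auto
  have "\<exists>p \<in> hom C (tot X \<otimes>\<^sub>o tot Y) (Z n). \<forall>a b. p \<cdot> (inc X a \<otimes> inc Y b) =
      (if a + b = n then j (a + b) (a, b) else \<zero> (cmp X a \<otimes>\<^sub>o cmp Y b) (Z n))" for n
  proof -
    obtain p where "p \<in> hom C (tot X \<otimes>\<^sub>o tot Y) (Z n)" "\<And>a b. p \<cdot> (inc X a \<otimes> inc Y b) =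
      (if a + b = n then j (a + b) (a, b) else \<zero> (cmp X a \<otimes>\<^sub>o cmp Y b) (Z n))"
      by (rule TenA_coproduct_copair[OF graded_coproduct[OF X] graded_coproduct[OF Y], of "Z n"
          "\<lambda>a b. if a + b = n then j (a + b) (a, b) else \<zero> (cmp X a \<otimes>\<^sub>o cmp Y b) (Z n)"]) auto
    then show ?thesis by blast
  qed
  then obtain p where p: "\<And>n. p n \<in> hom C (tot X \<otimes>\<^sub>o tot Y) (Z n)"
    and pij: "\<And>n a b. p n \<cdot> (inc X a \<otimes> inc Y b) =
      (if a + b = n then j (a + b) (a, b) else \<zero> (cmp X a \<otimes>\<^sub>o cmp Y b) (Z n))" by metis
  have [simp]: "p n \<in> Arr C" "Dom C (p n) = tot X \<otimes>\<^sub>o tot Y" "Cod C (p n) = Z n" for n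
    using p by auto
  have pi: "p n \<cdot> i k = (if n = k then \<one> (Z n) else \<zero> (Z k) (Z n))" for n k
    by (rule Z_ext[of _ _ k]) (auto simp: ij pij)
  have "is_coproduct C UNIV Z (tot X \<otimes>\<^sub>o tot Y) i"
  proof (rule is_coproductI)
    fix B f assume B: "B \<in> Obj C" "\<And>n. n \<in> UNIV \<Longrightarrow> f n \<in> hom C (Z n) B"
    then have [simp]: "f n \<in> Arr C" "Dom C (f n) = Z n" "Cod C (f n) = B" for n by auto
    obtain h where h: "h \<in> hom C (tot X \<otimes>\<^sub>o tot Y) B"
      and hi: "\<And>a b. h \<cdot> (inc X a \<otimes> inc Y b) = f (a + b) \<cdot> j (a + b) (a, b)"
      by (rule TenA_coproduct_copair[OF graded_coproduct[OF X] graded_coproduct[OF Y] B(1), of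
          "\<lambda>a b. f (a + b) \<cdot> j (a + b) (a, b)"]) auto
    have "h \<cdot> i n = f n" for n
      by (rule Z_ext[of _ _ n]) (use h in \<open>auto simp: ij hi\<close>)
    with h show "\<exists>h\<in>hom C (tot X \<otimes>\<^sub>o tot Y) B. \<forall>n\<in>UNIV. h \<cdot> i n = f n" by blast
  next
    fix B f g assume fg: "f \<in> hom C (tot X \<otimes>\<^sub>o tot Y) B" "g \<in> hom C (tot X \<otimes>\<^sub>o tot Y) B"
      "\<And>n. n \<in> UNIV \<Longrightarrow> f \<cdot> i n = g \<cdot> i n"
    show "f = g"
    proof (rule graded_TenA_ext[OF X Y])
      fix a b
      have "f \<cdot> (i (a + b) \<cdot> j (a + b) (a, b)) = g \<cdot> (i (a + b) \<cdot> j (a + b) (a, b))"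
        by (rule Comp_eq_Comp) (use fg in auto)
      then show "f \<cdot> (inc X a \<otimes> inc Y b) = g \<cdot> (inc X a \<otimes> inc Y b)" by (simp add: ij)
    qed (use fg in auto)
  qed auto
  then have "graded_object \<lparr>tot = tot X \<otimes>\<^sub>o tot Y, cmp = Z, inc = i, prj = p\<rparr>"
    by (simp add: graded_object_def pi)
  moreover have "is_coproduct C {(a, b). a + b = n} (\<lambda>(a, b). cmp X a \<otimes>\<^sub>o cmp Y b) (Z n) (j n)" for n
    using Z[of n] by (simp add: P_def XY_def)
  moreover have "i n \<cdot> j n (a, b) = inc X a \<otimes> inc Y b" if "a + b = n" for n a b
    using ij[of a b] that by simp
  ultimately have "graded_tensor X Y \<lparr>tot = tot X \<otimes>\<^sub>o tot Y, cmp = Z, inc = i, prj = p\<rparr>"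
    unfolding graded_tensor_def by auto
  then show ?thesis by (rule that)
qed

lemma graded_tensorD:
  assumes "graded_tensor X Y Z"
  obtains j where "graded_object Z" "tot Z = tot X \<otimes>\<^sub>o tot Y"
    "\<And>n. is_coproduct C {(a, b). a + b = n} (\<lambda>(a, b). cmp X a \<otimes>\<^sub>o cmp Y b) (cmp Z n) (j n)"
    "\<And>a b. inc Z (a + b) \<cdot> j (a + b) (a, b) = inc X a \<otimes> inc Y b"
  using assms unfolding graded_tensor_def by blast

text \<open>The maps \<open>inc X a \<otimes> inc Y b\<close> with \<open>a + b = n\<close> jointly
  cover the component of degree \<open>n\<close>. Testing on them removes \<open>Z\<close> from the
  criterion, which no longer depends on the chosen grading.\<close>

lemma graded_morphism_from_tensor_iff:
  assumes X: "graded_object X" and Y: "graded_object Y" and W: "graded_object W"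
    and Z: "graded_tensor X Y Z" and f: "f \<in> hom C (tot X \<otimes>\<^sub>o tot Y) (tot W)"
  shows "graded_morphism Z W f \<longleftrightarrow> (\<forall>k a b. k \<noteq> a + b \<longrightarrow>
    prj W k \<cdot> (f \<cdot> (inc X a \<otimes> inc Y b)) = \<zero> (cmp X a \<otimes>\<^sub>o cmp Y b) (cmp W k))"
proof -
  obtain j where Z': "graded_object Z" and totZ [simp]: "tot Z = tot X \<otimes>\<^sub>o tot Y"
    and cop: "\<And>n. is_coproduct C {(a, b). a + b = n} (\<lambda>(a, b). cmp X a \<otimes>\<^sub>o cmp Y b) (cmp Z n) (j n)"
    and ij: "\<And>a b. inc Z (a + b) \<cdot> j (a + b) (a, b) = inc X a \<otimes> inc Y b"
    using graded_tensorD[OF Z] by metis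
  note [simp] = graded_objectD[OF X] graded_objectD[OF Y] graded_objectD[OF W] graded_objectD[OF Z']
  have [simp]: "j (a + b) (a, b) \<in> Arr C" "Dom C (j (a + b) (a, b)) = cmp X a \<otimes>\<^sub>o cmp Y b"
    "Cod C (j (a + b) (a, b)) = cmp Z (a + b)" for a b
    using coproductD(2-4)[OF cop[of "a + b"], of "(a, b)"] by simp_all
  have [simp]: "f \<in> Arr C" "Dom C f = tot X \<otimes>\<^sub>o tot Y" "Cod C f = tot W" using f by auto
  show ?thesis
  proof (intro iffI allI impI)
    fix k a b :: nat assume "graded_morphism Z W f" and "k \<noteq> a + b"
    then have 0: "prj W k \<cdot> (f \<cdot> inc Z (a + b)) = \<zero> (cmp Z (a + b)) (cmp W k)"
      by (rule graded_morphismD[OF Z' W])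
    have "prj W k \<cdot> (f \<cdot> (inc X a \<otimes> inc Y b)) = (prj W k \<cdot> (f \<cdot> inc Z (a + b))) \<cdot> j (a + b) (a, b)"
      by (simp add: ij)
    then show "prj W k \<cdot> (f \<cdot> (inc X a \<otimes> inc Y b)) = \<zero> (cmp X a \<otimes>\<^sub>o cmp Y b) (cmp W k)"
      unfolding 0 by simp
  next
    assume 0: "\<forall>k a b. k \<noteq> a + b \<longrightarrow>
      prj W k \<cdot> (f \<cdot> (inc X a \<otimes> inc Y b)) = \<zero> (cmp X a \<otimes>\<^sub>o cmp Y b) (cmp W k)"
    have "prj W k \<cdot> (f \<cdot> inc Z n) = \<zero> (cmp Z n) (cmp W k)" if "k \<noteq> n" for n k
    proof (rule coproduct_ext[OF cop[of n]])
      fix ab assume "ab \<in> {(a, b). a + b = n}"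
      then obtain a b where [simp]: "ab = (a, b)" "n = a + b" by auto
      show "prj W k \<cdot> (f \<cdot> inc Z n) \<cdot> j n ab = \<zero> (cmp Z n) (cmp W k) \<cdot> j n ab"
        using 0 that by (simp add: ij)
    qed auto
    then have "is_direct_sum_of Z W f (\<lambda>n. prj W n \<cdot> (f \<cdot> inc Z n))"
      by (intro is_direct_sum_ofI[OF Z' W]) auto
    then show "graded_morphism Z W f" unfolding graded_morphism_def by blast
  qed
qed

text \<open>For maps into the tensor product the test uses \<open>prj X a \<otimes> prj Y b\<close>.
  These are not the projections of \<open>Z\<close>, so they are first shown to factor through the
  component of degree \<open>a + b\<close>; their joint monicity then gives the converse.\<close>

lemma graded_morphism_to_tensor_iff:
  assumes X: "graded_object X" and Y: "graded_object Y" and W: "graded_object W"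
    and Z: "graded_tensor X Y Z" and f: "f \<in> hom C (tot W) (tot X \<otimes>\<^sub>o tot Y)"
  shows "graded_morphism W Z f \<longleftrightarrow> (\<forall>k a b. k \<noteq> a + b \<longrightarrow>
    (prj X a \<otimes> prj Y b) \<cdot> (f \<cdot> inc W k) = \<zero> (cmp W k) (cmp X a \<otimes>\<^sub>o cmp Y b))"
proof -
  obtain j where Z': "graded_object Z" and totZ [simp]: "tot Z = tot X \<otimes>\<^sub>o tot Y"
    and cop: "\<And>n. is_coproduct C {(a, b). a + b = n} (\<lambda>(a, b). cmp X a \<otimes>\<^sub>o cmp Y b) (cmp Z n) (j n)"
    and ij: "\<And>a b. inc Z (a + b) \<cdot> j (a + b) (a, b) = inc X a \<otimes> inc Y b"
    using graded_tensorD[OF Z] by metis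
  note [simp] = graded_objectD[OF X] graded_objectD[OF Y] graded_objectD[OF W] graded_objectD[OF Z']
  have [simp]: "j (a + b) (a, b) \<in> Arr C" "Dom C (j (a + b) (a, b)) = cmp X a \<otimes>\<^sub>o cmp Y b"
    "Cod C (j (a + b) (a, b)) = cmp Z (a + b)" for a b
    using coproductD(2-4)[OF cop[of "a + b"], of "(a, b)"] by simp_all
  have [simp]: "f \<in> Arr C" "Dom C f = tot W" "Cod C f = tot X \<otimes>\<^sub>o tot Y" using f by auto
  have pp: "(prj X a \<otimes> prj Y b) \<cdot> inc Z k = \<zero> (cmp Z k) (cmp X a \<otimes>\<^sub>o cmp Y b)" if "a + b \<noteq> k" for a b k
  proof (rule coproduct_ext[OF cop[of k]])
    fix ab assume "ab \<in> {(a, b). a + b = k}"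
    then obtain a' b' where [simp]: "ab = (a', b')" "k = a' + b'" by auto
    show "(prj X a \<otimes> prj Y b) \<cdot> inc Z k \<cdot> j k ab = \<zero> (cmp Z k) (cmp X a \<otimes>\<^sub>o cmp Y b) \<cdot> j k ab"
      using that by (auto simp: ij)
  qed auto
  have pip: "(prj X a \<otimes> prj Y b) \<cdot> (inc Z (a + b) \<cdot> prj Z (a + b)) = prj X a \<otimes> prj Y b" for a b
  proof (rule graded_ext[OF Z'])
    fix k
    show "(prj X a \<otimes> prj Y b) \<cdot> (inc Z (a + b) \<cdot> prj Z (a + b)) \<cdot> inc Z k = (prj X a \<otimes> prj Y b) \<cdot> inc Z k"
      using pp[of a b k] by (cases "a + b = k") simp_all
  qed auto
  show ?thesis
  proof (intro iffI allI impI)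
    fix k a b :: nat assume "graded_morphism W Z f" and k: "k \<noteq> a + b"
    then obtain fn where fn: "is_direct_sum_of W Z f fn" by (auto simp: graded_morphism_def)
    note fn' = is_direct_sum_ofD[OF W Z' fn]
    have "(prj X a \<otimes> prj Y b) \<cdot> (f \<cdot> inc W k) = ((prj X a \<otimes> prj Y b) \<cdot> inc Z k) \<cdot> fn k"
      by (simp add: fn')
    then show "(prj X a \<otimes> prj Y b) \<cdot> (f \<cdot> inc W k) = \<zero> (cmp W k) (cmp X a \<otimes>\<^sub>o cmp Y b)"
      using k pp[of a b k] by (simp add: fn')
  next
    assume 0: "\<forall>k a b. k \<noteq> a + b \<longrightarrow>
      (prj X a \<otimes> prj Y b) \<cdot> (f \<cdot> inc W k) = \<zero> (cmp W k) (cmp X a \<otimes>\<^sub>o cmp Y b)"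
    have "f \<cdot> inc W n = inc Z n \<cdot> (prj Z n \<cdot> (f \<cdot> inc W n))" for n
    proof (rule graded_TenA_prj_ext[OF X Y])
      fix a b
      show "(prj X a \<otimes> prj Y b) \<cdot> (f \<cdot> inc W n) =
        (prj X a \<otimes> prj Y b) \<cdot> (inc Z n \<cdot> (prj Z n \<cdot> (f \<cdot> inc W n)))"
      proof (cases "a + b = n")
        case True
        have "(prj X a \<otimes> prj Y b) \<cdot> (inc Z n \<cdot> (prj Z n \<cdot> (f \<cdot> inc W n))) =
          ((prj X a \<otimes> prj Y b) \<cdot> (inc Z n \<cdot> prj Z n)) \<cdot> (f \<cdot> inc W n)" by simp
        also have "\<dots> = (prj X a \<otimes> prj Y b) \<cdot> (f \<cdot> inc W n)"
          using pip[of a b] True by (simp only:)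
        finally show ?thesis ..
      next
        case False
        have "(prj X a \<otimes> prj Y b) \<cdot> (inc Z n \<cdot> (prj Z n \<cdot> (f \<cdot> inc W n))) =
          ((prj X a \<otimes> prj Y b) \<cdot> inc Z n) \<cdot> (prj Z n \<cdot> (f \<cdot> inc W n))" by simp
        then show ?thesis using pp[OF False] 0 False by simp
      qed
    qed auto
    then have "is_direct_sum_of W Z f (\<lambda>n. prj Z n \<cdot> (f \<cdot> inc W n))"
      by (simp add: is_direct_sum_of_def)
    then show "graded_morphism W Z f" unfolding graded_morphism_def by blast
  qed
qed

section \<open>Universal properties of the tensor and cotensor bialgebras\<close>

lemma algebraD:
  assumes "algebra A m u"
  shows "A \<in> Obj C" "m \<in> Arr C" "Dom C m = A \<otimes>\<^sub>o A" "Cod C m = A"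
    "u \<in> Arr C" "Dom C u = \<I>" "Cod C u = A"
  using assms by (auto simp: algebra_def)

lemma coalgebraD:
  assumes "coalgebra A d e"
  shows "A \<in> Obj C" "d \<in> Arr C" "Dom C d = A" "Cod C d = A \<otimes>\<^sub>o A"
    "e \<in> Arr C" "Dom C e = A" "Cod C e = \<I>"
  using assms by (auto simp: coalgebra_def)

text \<open>Associativity for generalized elements \<open>x\<close>, \<open>y\<close>,
  \<open>z\<close> of \<open>A\<close>, obtained by composing the axiom with their tensor product;
  it takes the place of a computation with elements.\<close>

lemma algebra_assoc:
  assumes A: "algebra A m u" and "x \<in> Arr C" "y \<in> Arr C" "z \<in> Arr C"
    "Cod C x = A" "Cod C y = A" "Cod C z = A"
  shows "m \<cdot> ((m \<cdot> (x \<otimes> y)) \<otimes> z) =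
    m \<cdot> ((x \<otimes> (m \<cdot> (y \<otimes> z))) \<cdot> \<a> (Dom C x) (Dom C y) (Dom C z))"
proof -
  note [simp] = algebraD[OF A] assms(2-)
  have *: "m \<cdot> (m \<otimes> \<one> A) = m \<cdot> (\<one> A \<otimes> m) \<cdot> \<a> A A A" using A by (simp add: algebra_def)
  have "m \<cdot> ((m \<cdot> (x \<otimes> y)) \<otimes> z) = (m \<cdot> (m \<otimes> \<one> A)) \<cdot> (x \<otimes> y \<otimes> z)" by simp
  also have "\<dots> = m \<cdot> ((x \<otimes> (m \<cdot> (y \<otimes> z))) \<cdot> \<a> (Dom C x) (Dom C y) (Dom C z))"
    unfolding * by simp
  finally show ?thesis .
qed

lemma braided_bialgebraD:
  assumes "braided_bialgebra H"
  shows "algebra (carr H) (mult H) (unt H)" "coalgebra (carr H) (comult H) (counit H)"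
    "comult H \<cdot> mult H = (mult H \<otimes> mult H) \<cdot> swap_middle (carr H) (carr H) (carr H) (carr H) \<cdot>
       (comult H \<otimes> comult H)"
    "counit H \<cdot> mult H = \<l> \<I> \<cdot> (counit H \<otimes> counit H)"
    "comult H \<cdot> unt H = (unt H \<otimes> unt H) \<cdot> inverse_of C (\<l> \<I>)"
    "counit H \<cdot> unt H = \<one> \<I>"
  using assms by (auto simp: braided_bialgebra_def)

lemma braided_bialgebra_type:
  assumes "braided_bialgebra H"
  shows "carr H \<in> Obj C" "mult H \<in> Arr C" "Dom C (mult H) = carr H \<otimes>\<^sub>o carr H"
    "Cod C (mult H) = carr H" "unt H \<in> Arr C" "Dom C (unt H) = \<I>" "Cod C (unt H) = carr H"
    "comult H \<in> Arr C" "Dom C (comult H) = carr H" "Cod C (comult H) = carr H \<otimes>\<^sub>o carr H"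
    "counit H \<in> Arr C" "Dom C (counit H) = carr H" "Cod C (counit H) = \<I>"
  using algebraD[OF braided_bialgebraD(1)[OF assms]] coalgebraD[OF braided_bialgebraD(2)[OF assms]]
  by auto

lemma hopf_bimodule_type:
  assumes "hopf_bimodule H M"
  shows "mcarr M \<in> Obj C" "lact M \<in> Arr C" "Dom C (lact M) = carr H \<otimes>\<^sub>o mcarr M"
    "Cod C (lact M) = mcarr M" "ract M \<in> Arr C" "Dom C (ract M) = mcarr M \<otimes>\<^sub>o carr H"
    "Cod C (ract M) = mcarr M" "lcoact M \<in> Arr C" "Dom C (lcoact M) = mcarr M"
    "Cod C (lcoact M) = carr H \<otimes>\<^sub>o mcarr M" "rcoact M \<in> Arr C" "Dom C (rcoact M) = mcarr M"
    "Cod C (rcoact M) = mcarr M \<otimes>\<^sub>o carr H"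
  using assms by (auto simp: hopf_bimodule_def bimodule_def bicomodule_def)

lemma graded_braided_bialgebraD:
  assumes "graded_braided_bialgebra A"
  shows "braided_bialgebra A" "graded_object (grading A)" "tot (grading A) = carr A"
  using assms by (auto simp: graded_braided_bialgebra_def)

text \<open>Gradedness in the form used for calculations, free of the auxiliary grading on the
  tensor square.\<close>

lemma graded_braided_bialgebra_prj:
  assumes A: "graded_braided_bialgebra A" and k: "k \<noteq> a + b"
  shows "prj (grading A) k \<cdot> (mult A \<cdot> (inc (grading A) a \<otimes> inc (grading A) b)) =
      \<zero> (cmp (grading A) a \<otimes>\<^sub>o cmp (grading A) b) (cmp (grading A) k)"
    "(prj (grading A) a \<otimes> prj (grading A) b) \<cdot> (comult A \<cdot> inc (grading A) k) =
      \<zero> (cmp (grading A) k) (cmp (grading A) a \<otimes>\<^sub>o cmp (grading A) b)"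
proof -
  note X = graded_braided_bialgebraD(2)[OF A]
  note [simp] = graded_braided_bialgebraD(3)[OF A]
    braided_bialgebra_type[OF graded_braided_bialgebraD(1)[OF A]]
  obtain Z where Z: "graded_tensor (grading A) (grading A) Z"
    "graded_morphism Z (grading A) (mult A)" "graded_morphism (grading A) Z (comult A)"
    using A unfolding graded_braided_bialgebra_def by blast
  show "prj (grading A) k \<cdot> (mult A \<cdot> (inc (grading A) a \<otimes> inc (grading A) b)) =
      \<zero> (cmp (grading A) a \<otimes>\<^sub>o cmp (grading A) b) (cmp (grading A) k)"
    using graded_morphism_from_tensor_iff[OF X X X Z(1), of "mult A"] Z(2) k by simp
  show "(prj (grading A) a \<otimes> prj (grading A) b) \<cdot> (comult A \<cdot> inc (grading A) k) =
      \<zero> (cmp (grading A) k) (cmp (grading A) a \<otimes>\<^sub>o cmp (grading A) b)"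
    using graded_morphism_to_tensor_iff[OF X X X Z(1), of "comult A"] Z(3) k by simp
qed

lemma graded_braided_bialgebraI:
  assumes A: "braided_bialgebra A" and X: "graded_object (grading A)" "tot (grading A) = carr A"
    and m: "\<And>k a b. k \<noteq> a + b \<Longrightarrow>
      prj (grading A) k \<cdot> (mult A \<cdot> (inc (grading A) a \<otimes> inc (grading A) b)) =
      \<zero> (cmp (grading A) a \<otimes>\<^sub>o cmp (grading A) b) (cmp (grading A) k)"
    and d: "\<And>k a b. k \<noteq> a + b \<Longrightarrow>
      (prj (grading A) a \<otimes> prj (grading A) b) \<cdot> (comult A \<cdot> inc (grading A) k) =
      \<zero> (cmp (grading A) k) (cmp (grading A) a \<otimes>\<^sub>o cmp (grading A) b)"
  shows "graded_braided_bialgebra A"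
proof -
  obtain Z where Z: "graded_tensor (grading A) (grading A) Z"
    using graded_tensor_exists[OF X(1) X(1)] .
  have "graded_morphism Z (grading A) (mult A)"
    using graded_morphism_from_tensor_iff[OF X(1) X(1) X(1) Z, of "mult A"] m
      braided_bialgebra_type[OF A] X(2) by simp
  moreover have "graded_morphism (grading A) Z (comult A)"
    using graded_morphism_to_tensor_iff[OF X(1) X(1) X(1) Z, of "comult A"] d
      braided_bialgebra_type[OF A] X(2) by simp
  ultimately show ?thesis
    using A X Z unfolding graded_braided_bialgebra_def by blast
qed

lemma tensor_bialgebraD:
  assumes T: "tensor_bialgebra H M T"
  shows "graded_braided_bialgebra T" "unt T = inc (grading T) 0 \<cdot> unt H"
    "comult T \<cdot> inc (grading T) 0 = (inc (grading T) 0 \<otimes> inc (grading T) 0) \<cdot> comult H"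
    "comult T \<cdot> inc (grading T) (Suc 0) = ((inc (grading T) 0 \<otimes> inc (grading T) (Suc 0)) \<cdot> lcoact M) \<oplus>
      ((inc (grading T) (Suc 0) \<otimes> inc (grading T) 0) \<cdot> rcoact M)"
    "counit T \<cdot> inc (grading T) 0 = counit H"
    "counit T \<cdot> inc (grading T) (Suc 0) = \<zero> (mcarr M) \<I>"
    "cmp (grading T) 0 = carr H" "cmp (grading T) (Suc 0) = mcarr M"
  using T by (auto simp: tensor_bialgebra_def tensor_powers_def Let_def)

lemma cotensor_bialgebraD:
  assumes T: "cotensor_bialgebra H M T"
  shows "graded_braided_bialgebra T" "counit T = counit H \<cdot> prj (grading T) 0"
    "prj (grading T) 0 \<cdot> mult T = mult H \<cdot> (prj (grading T) 0 \<otimes> prj (grading T) 0)"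
    "prj (grading T) (Suc 0) \<cdot> mult T = (lact M \<cdot> (prj (grading T) 0 \<otimes> prj (grading T) (Suc 0))) \<oplus>
      (ract M \<cdot> (prj (grading T) (Suc 0) \<otimes> prj (grading T) 0))"
    "prj (grading T) 0 \<cdot> unt T = unt H"
    "prj (grading T) (Suc 0) \<cdot> unt T = \<zero> \<I> (mcarr M)"
    "cmp (grading T) 0 = carr H" "cmp (grading T) (Suc 0) = mcarr M"
    "(prj (grading T) 0 \<otimes> prj (grading T) 0) \<cdot> comult T = comult H \<cdot> prj (grading T) 0"
    "(prj (grading T) 0 \<otimes> prj (grading T) (Suc 0)) \<cdot> comult T = lcoact M \<cdot> prj (grading T) (Suc 0)"
    "(prj (grading T) (Suc 0) \<otimes> prj (grading T) 0) \<cdot> comult T = rcoact M \<cdot> prj (grading T) (Suc 0)"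
proof -
  obtain L R \<iota> \<zeta> where p: "cotensor_powers H M (cmp (grading T)) L R \<iota> \<zeta>"
    and \<zeta>: "\<And>a b. (prj (grading T) a \<otimes> prj (grading T) b) \<cdot> comult T = \<zeta> a b \<cdot> prj (grading T) (a + b)"
    using T unfolding cotensor_bialgebra_def Let_def by blast
  have "\<zeta> 0 0 = comult H" "\<zeta> 0 (Suc 0) = lcoact M" "\<zeta> (Suc 0) 0 = rcoact M"
    using p by (auto simp: cotensor_powers_def)
  then show "(prj (grading T) 0 \<otimes> prj (grading T) 0) \<cdot> comult T = comult H \<cdot> prj (grading T) 0"
    "(prj (grading T) 0 \<otimes> prj (grading T) (Suc 0)) \<cdot> comult T = lcoact M \<cdot> prj (grading T) (Suc 0)"
    "(prj (grading T) (Suc 0) \<otimes> prj (grading T) 0) \<cdot> comult T = rcoact M \<cdot> prj (grading T) (Suc 0)"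
    using \<zeta>[of 0 0] \<zeta>[of 0 "Suc 0"] \<zeta>[of "Suc 0" 0] by simp_all
  show "cmp (grading T) 0 = carr H" "cmp (grading T) (Suc 0) = mcarr M"
    using p by (auto simp: cotensor_powers_def)
qed (use T in \<open>auto simp: cotensor_bialgebra_def Let_def\<close>)

text \<open>For \<open>n \<ge> 1\<close> the canonical morphism \<open>\<chi> n 1\<close> is the
  coequalizer \<open>\<pi> n\<close>, and a coequalizer is epic; in this sense the tensor bialgebra
  is generated in degrees 0 and 1.\<close>

lemma tensor_bialgebra_generated:
  assumes T: "tensor_bialgebra H M T" and n: "n \<ge> 1"
  obtains \<pi> where "epic C \<pi>" "\<pi> \<in> Arr C" "Dom C \<pi> = cmp (grading T) n \<otimes>\<^sub>o mcarr M"
    "Cod C \<pi> = cmp (grading T) (Suc n)"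
    "mult T \<cdot> (inc (grading T) n \<otimes> inc (grading T) (Suc 0)) = inc (grading T) (Suc n) \<cdot> \<pi>"
proof -
  obtain L R \<pi> \<chi> where p: "tensor_powers H M (cmp (grading T)) L R \<pi> \<chi>"
    and \<chi>: "\<And>p q. mult T \<cdot> (inc (grading T) p \<otimes> inc (grading T) q) = inc (grading T) (p + q) \<cdot> \<chi> p q"
    using T unfolding tensor_bialgebra_def Let_def by blast
  have \<pi>: "is_tensor_over H (cmp (grading T) n) (R n) (mcarr M) (lact M) (cmp (grading T) (Suc n)) (\<pi> n)"
    and "\<chi> n 1 = \<pi> n"
    using p n by (auto simp: tensor_powers_def)
  then have "mult T \<cdot> (inc (grading T) n \<otimes> inc (grading T) (Suc 0)) = inc (grading T) (Suc n) \<cdot> \<pi> n"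
    using \<chi>[of n 1] by simp
  with \<pi> show ?thesis
    using that[of "\<pi> n"] coequalizer_epic by (auto simp: is_tensor_over_def)
qed

text \<open>Dually \<open>\<zeta> n 1\<close> is the equalizer \<open>\<iota> n\<close>, hence
  monic.\<close>

lemma cotensor_bialgebra_cogenerated:
  assumes T: "cotensor_bialgebra H M T" and n: "n \<ge> 1"
  obtains \<iota> where "monic C \<iota>" "\<iota> \<in> Arr C" "Cod C \<iota> = cmp (grading T) n \<otimes>\<^sub>o mcarr M"
    "Dom C \<iota> = cmp (grading T) (Suc n)"
    "(prj (grading T) n \<otimes> prj (grading T) (Suc 0)) \<cdot> comult T = \<iota> \<cdot> prj (grading T) (Suc n)"
proof -
  obtain L R \<iota> \<zeta> where p: "cotensor_powers H M (cmp (grading T)) L R \<iota> \<zeta>"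
    and \<zeta>: "\<And>a b. (prj (grading T) a \<otimes> prj (grading T) b) \<cdot> comult T = \<zeta> a b \<cdot> prj (grading T) (a + b)"
    using T unfolding cotensor_bialgebra_def Let_def by blast
  have \<iota>: "is_cotensor_over H (cmp (grading T) n) (R n) (mcarr M) (lcoact M) (cmp (grading T) (Suc n)) (\<iota> n)"
    and "\<zeta> n 1 = \<iota> n"
    using p n by (auto simp: cotensor_powers_def)
  then have "(prj (grading T) n \<otimes> prj (grading T) (Suc 0)) \<cdot> comult T = \<iota> n \<cdot> prj (grading T) (Suc n)"
    using \<zeta>[of n 1] by simp
  with \<iota> show ?thesis
    using that[of "\<iota> n"] equalizer_monic by (auto simp: is_cotensor_over_def)
qed

text \<open>Induction on the degree, cancelling \<open>\<pi>\<close> in the product of degrees n and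
  1. As \<open>m\<close> is an arbitrary morphism, the target may be a tensor square with its
  braided product, or the unit object with its unit constraint.\<close>

lemma tensor_bialgebra_hom_ext:
  assumes T: "tensor_bialgebra H M T"
    and m: "m \<in> hom C (B \<otimes>\<^sub>o B) B" and f: "f \<in> hom C (carr T) B" and g: "g \<in> hom C (carr T) B"
    and fm: "f \<cdot> mult T = m \<cdot> (f \<otimes> f)" and gm: "g \<cdot> mult T = m \<cdot> (g \<otimes> g)"
    and 0: "f \<cdot> inc (grading T) 0 = g \<cdot> inc (grading T) 0"
    and 1: "f \<cdot> inc (grading T) (Suc 0) = g \<cdot> inc (grading T) (Suc 0)"
  shows "f = g"
proof -
  note gT = tensor_bialgebraD(1)[OF T]
  note X = graded_braided_bialgebraD(2)[OF gT]
  note [simp] = graded_objectD[OF X] graded_braided_bialgebraD(3)[OF gT]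
    braided_bialgebra_type[OF graded_braided_bialgebraD(1)[OF gT]] tensor_bialgebraD(7,8)[OF T]
  have [simp]: "f \<in> Arr C" "Dom C f = carr T" "Cod C f = B" "g \<in> Arr C" "Dom C g = carr T" "Cod C g = B"
    "m \<in> Arr C" "Dom C m = B \<otimes>\<^sub>o B" "Cod C m = B" using f g m by auto
  have M [simp]: "mcarr M \<in> Obj C" using graded_objectD(7)[OF X, of "Suc 0"] by simp
  have "f \<cdot> inc (grading T) (Suc n) = g \<cdot> inc (grading T) (Suc n)" for n
  proof (induction n)
    case (Suc n)
    obtain \<pi> where \<pi>: "epic C \<pi>" and [simp]: "\<pi> \<in> Arr C" "Dom C \<pi> = cmp (grading T) (Suc n) \<otimes>\<^sub>o mcarr M"
      "Cod C \<pi> = cmp (grading T) (Suc (Suc n))" and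
      \<pi>m: "mult T \<cdot> (inc (grading T) (Suc n) \<otimes> inc (grading T) (Suc 0)) = inc (grading T) (Suc (Suc n)) \<cdot> \<pi>"
      by (rule tensor_bialgebra_generated[OF T, of "Suc n"]) auto
    have *: "h \<cdot> inc (grading T) (Suc (Suc n)) \<cdot> \<pi> =
        m \<cdot> ((h \<cdot> inc (grading T) (Suc n)) \<otimes> (h \<cdot> inc (grading T) (Suc 0)))"
      if [simp]: "h \<in> Arr C" "Dom C h = carr T" "Cod C h = B" and h: "h \<cdot> mult T = m \<cdot> (h \<otimes> h)" for h
    proof -
      have "h \<cdot> inc (grading T) (Suc (Suc n)) \<cdot> \<pi> =
          h \<cdot> (mult T \<cdot> (inc (grading T) (Suc n) \<otimes> inc (grading T) (Suc 0)))"
        by (simp add: \<pi>m)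
      also have "\<dots> = m \<cdot> ((h \<otimes> h) \<cdot> (inc (grading T) (Suc n) \<otimes> inc (grading T) (Suc 0)))"
        by (rule Comp_eq_Comp[OF h]) simp_all
      finally show ?thesis by simp
    qed
    have "f \<cdot> inc (grading T) (Suc (Suc n)) \<cdot> \<pi> =
        m \<cdot> ((f \<cdot> inc (grading T) (Suc n)) \<otimes> (f \<cdot> inc (grading T) (Suc 0)))"
      by (rule *[OF _ _ _ fm]) simp_all
    also have "\<dots> = m \<cdot> ((g \<cdot> inc (grading T) (Suc n)) \<otimes> (g \<cdot> inc (grading T) (Suc 0)))"
      by (simp only: Suc 1)
    also have "\<dots> = g \<cdot> inc (grading T) (Suc (Suc n)) \<cdot> \<pi>"
      by (rule *[OF _ _ _ gm, symmetric]) simp_all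
    finally show ?case by (rule epicD[OF \<pi>]) simp_all
  qed (rule 1)
  with 0 have "f \<cdot> inc (grading T) n = g \<cdot> inc (grading T) n" for n
    by (cases n) auto
  then show ?thesis by (rule graded_ext[OF X, rotated 5]) simp_all
qed

text \<open>The induction cancels the monic \<open>\<iota>\<close>; the final passage from equal
  components to equal maps is joint monicity of the projections.\<close>

lemma cotensor_bialgebra_hom_ext:
  assumes T: "cotensor_bialgebra H M T"
    and d: "d \<in> hom C D (D \<otimes>\<^sub>o D)" and f: "f \<in> hom C D (carr T)" and g: "g \<in> hom C D (carr T)"
    and fd: "comult T \<cdot> f = (f \<otimes> f) \<cdot> d" and gd: "comult T \<cdot> g = (g \<otimes> g) \<cdot> d"
    and 0: "prj (grading T) 0 \<cdot> f = prj (grading T) 0 \<cdot> g"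
    and 1: "prj (grading T) (Suc 0) \<cdot> f = prj (grading T) (Suc 0) \<cdot> g"
  shows "f = g"
proof -
  note gT = cotensor_bialgebraD(1)[OF T]
  note X = graded_braided_bialgebraD(2)[OF gT]
  note [simp] = graded_objectD[OF X] graded_braided_bialgebraD(3)[OF gT]
    braided_bialgebra_type[OF graded_braided_bialgebraD(1)[OF gT]] cotensor_bialgebraD(7,8)[OF T]
  have [simp]: "f \<in> Arr C" "Dom C f = D" "Cod C f = carr T" "g \<in> Arr C" "Dom C g = D" "Cod C g = carr T"
    "d \<in> Arr C" "Dom C d = D" "Cod C d = D \<otimes>\<^sub>o D" using f g d by auto
  have M [simp]: "mcarr M \<in> Obj C" using graded_objectD(7)[OF X, of "Suc 0"] by simp
  have "prj (grading T) (Suc n) \<cdot> f = prj (grading T) (Suc n) \<cdot> g" for n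
  proof (induction n)
    case (Suc n)
    obtain \<iota> where \<iota>: "monic C \<iota>" and [simp]: "\<iota> \<in> Arr C" "Cod C \<iota> = cmp (grading T) (Suc n) \<otimes>\<^sub>o mcarr M"
      "Dom C \<iota> = cmp (grading T) (Suc (Suc n))" and
      \<iota>d: "(prj (grading T) (Suc n) \<otimes> prj (grading T) (Suc 0)) \<cdot> comult T = \<iota> \<cdot> prj (grading T) (Suc (Suc n))"
      by (rule cotensor_bialgebra_cogenerated[OF T, of "Suc n"]) auto
    have *: "\<iota> \<cdot> (prj (grading T) (Suc (Suc n)) \<cdot> h) =
        ((prj (grading T) (Suc n) \<cdot> h) \<otimes> (prj (grading T) (Suc 0) \<cdot> h)) \<cdot> d"
      if [simp]: "h \<in> Arr C" "Dom C h = D" "Cod C h = carr T" and h: "comult T \<cdot> h = (h \<otimes> h) \<cdot> d" for h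
    proof -
      have "\<iota> \<cdot> (prj (grading T) (Suc (Suc n)) \<cdot> h) =
          (prj (grading T) (Suc n) \<otimes> prj (grading T) (Suc 0)) \<cdot> (comult T \<cdot> h)"
        by (rule Comp_eq_Comp[OF \<iota>d[symmetric]]) simp_all
      then show ?thesis by (simp add: h)
    qed
    have "\<iota> \<cdot> (prj (grading T) (Suc (Suc n)) \<cdot> f) =
        ((prj (grading T) (Suc n) \<cdot> f) \<otimes> (prj (grading T) (Suc 0) \<cdot> f)) \<cdot> d"
      by (rule *[OF _ _ _ fd]) simp_all
    also have "\<dots> = ((prj (grading T) (Suc n) \<cdot> g) \<otimes> (prj (grading T) (Suc 0) \<cdot> g)) \<cdot> d"
      by (simp only: Suc 1)
    also have "\<dots> = \<iota> \<cdot> (prj (grading T) (Suc (Suc n)) \<cdot> g)"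
      by (rule *[OF _ _ _ gd, symmetric]) simp_all
    finally show ?case by (rule monicD[OF \<iota>]) simp_all
  qed (rule 1)
  with 0 have "prj (grading T) n \<cdot> f = prj (grading T) n \<cdot> g" for n
    by (cases n) auto
  then show ?thesis by (rule graded_prj_ext[OF X, rotated 5]) simp_all
qed

section \<open>Existence of multiplicative extensions\<close>

lemma coequalizer_factor:
  assumes "is_coequalizer C f g q" "h \<in> hom C (Cod C f) X" "h \<cdot> f = h \<cdot> g"
  obtains k where "k \<in> hom C (Cod C q) X" "k \<cdot> q = h"
proof -
  have "\<exists>!k. k \<in> hom C (Cod C q) X \<and> k \<cdot> q = h"
    using assms unfolding is_coequalizer_def by blast
  then show ?thesis using that by blast
qed

text \<open>The components are forced by
  \<open>F (Suc n) \<cdot> \<pi> n = m \<cdot> (F n \<otimes> f1)\<close>. A solution exists because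
  the right-hand side is balanced over \<open>H\<close>: this combines right linearity of
  \<open>F n\<close>, left linearity of \<open>f1\<close> and associativity of
  \<open>m\<close>.\<close>

lemma tensor_bialgebra_hom_exists:
  assumes T: "tensor_bialgebra H M T" and H: "braided_bialgebra H" and M: "hopf_bimodule H M"
    and B: "algebra B m u" and f0: "f0 \<in> hom C (carr H) B" and f1: "f1 \<in> hom C (mcarr M) B"
    and f0m: "f0 \<cdot> mult H = m \<cdot> (f0 \<otimes> f0)" and f0u: "f0 \<cdot> unt H = u"
    and f1l: "f1 \<cdot> lact M = m \<cdot> (f0 \<otimes> f1)" and f1r: "f1 \<cdot> ract M = m \<cdot> (f1 \<otimes> f0)"
  obtains F where "F \<in> hom C (carr T) B" "F \<cdot> mult T = m \<cdot> (F \<otimes> F)" "F \<cdot> unt T = u"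
    "F \<cdot> inc (grading T) 0 = f0" "F \<cdot> inc (grading T) (Suc 0) = f1"
proof -
  note gT = tensor_bialgebraD(1)[OF T]
  note X = graded_braided_bialgebraD(2)[OF gT]
  define P i where "P = cmp (grading T)" and "i = inc (grading T)"
  have [simp]: "i n \<in> Arr C" "Dom C (i n) = P n" "Cod C (i n) = carr T" "P n \<in> Obj C" for n
    using graded_objectD[OF X] graded_braided_bialgebraD(3)[OF gT] by (simp_all add: P_def i_def)
  note [simp] = braided_bialgebra_type[OF graded_braided_bialgebraD(1)[OF gT]]
    braided_bialgebra_type[OF H] hopf_bimodule_type[OF M] algebraD[OF B]
  have [simp]: "P 0 = carr H" "P (Suc 0) = mcarr M"
    using tensor_bialgebraD(7,8)[OF T] by (simp_all add: P_def)
  have [simp]: "f0 \<in> Arr C" "Dom C f0 = carr H" "Cod C f0 = B" "f1 \<in> Arr C" "Dom C f1 = mcarr M"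
    "Cod C f1 = B" using f0 f1 by auto
  obtain L R \<pi> \<chi> where p: "tensor_powers H M P L R \<pi> \<chi>"
    and \<chi>: "\<And>p q. mult T \<cdot> (i p \<otimes> i q) = i (p + q) \<cdot> \<chi> p q"
    using T unfolding tensor_bialgebra_def Let_def P_def i_def by blast
  have L01 [simp]: "L 0 = mult H" "R 0 = mult H" "L (Suc 0) = lact M" "R (Suc 0) = ract M"
    and \<chi>0: "\<And>n. \<chi> 0 n = L n" "\<And>n. \<chi> n 0 = R n" "\<And>n. n \<ge> 1 \<Longrightarrow> \<chi> n (Suc 0) = \<pi> n"
    using p by (simp_all add: tensor_powers_def)
  have step: "is_tensor_over H (P n) (R n) (mcarr M) (lact M) (P (Suc n)) (\<pi> n)"
    "L (Suc n) \<in> hom C (carr H \<otimes>\<^sub>o P (Suc n)) (P (Suc n))"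
    "L (Suc n) \<cdot> (\<one> (carr H) \<otimes> \<pi> n) = \<pi> n \<cdot> (L n \<otimes> \<one> (mcarr M)) \<cdot> \<a>\<inverse> (carr H) (P n) (mcarr M)"
    "R (Suc n) \<in> hom C (P (Suc n) \<otimes>\<^sub>o carr H) (P (Suc n))"
    "R (Suc n) \<cdot> (\<pi> n \<otimes> \<one> (carr H)) = \<pi> n \<cdot> (\<one> (P n) \<otimes> ract M) \<cdot> \<a> (P n) (mcarr M) (carr H)"
    if "n \<ge> 1" for n
    using p that unfolding tensor_powers_def by blast+
  have \<chi>Suc: "\<chi> p (Suc q) \<in> hom C (P p \<otimes>\<^sub>o P (Suc q)) (P (p + Suc q))"
    "\<chi> p (Suc q) \<cdot> (\<one> (P p) \<otimes> \<pi> q) =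
      \<pi> (p + q) \<cdot> (\<chi> p q \<otimes> \<one> (mcarr M)) \<cdot> \<a>\<inverse> (P p) (P q) (mcarr M)" if "p \<ge> 1" "q \<ge> 1" for p q
    using p that unfolding tensor_powers_def by blast+
  have [simp]: "L n \<in> Arr C" "Dom C (L n) = carr H \<otimes>\<^sub>o P n" "Cod C (L n) = P n"
    "R n \<in> Arr C" "Dom C (R n) = P n \<otimes>\<^sub>o carr H" "Cod C (R n) = P n" for n
  proof -
    have "(L n \<in> hom C (carr H \<otimes>\<^sub>o P n) (P n)) \<and> (R n \<in> hom C (P n \<otimes>\<^sub>o carr H) (P n))"
    proof (cases "n \<le> 1")
      case True
      then have "n = 0 \<or> n = Suc 0" by auto
      then show ?thesis by auto
    next
      case False
      then obtain k where "n = Suc k" "k \<ge> 1" by (cases n) auto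
      then show ?thesis using step(2,4) by blast
    qed
    then show "L n \<in> Arr C" "Dom C (L n) = carr H \<otimes>\<^sub>o P n" "Cod C (L n) = P n"
      "R n \<in> Arr C" "Dom C (R n) = P n \<otimes>\<^sub>o carr H" "Cod C (R n) = P n" by auto
  qed
  have pi_type [simp]: "\<pi> n \<in> Arr C" "Dom C (\<pi> n) = P n \<otimes>\<^sub>o mcarr M" "Cod C (\<pi> n) = P (Suc n)"
    and \<pi>: "epic C (\<pi> n)" if "n \<ge> 1" for n
    using step(1)[OF that] coequalizer_epic by (auto simp: is_tensor_over_def)
  have \<chi>_type [simp]: "\<chi> p q \<in> Arr C" "Dom C (\<chi> p q) = P p \<otimes>\<^sub>o P q" "Cod C (\<chi> p q) = P (p + q)" for p q
  proof -
    have "\<chi> p q \<in> hom C (P p \<otimes>\<^sub>o P q) (P (p + q))"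
    proof (cases "p = 0 \<or> q = 0")
      case False
      then obtain k where "q = Suc k" "p \<ge> 1" by (cases q) auto
      then show ?thesis using \<chi>Suc(1)[of p k] \<chi>0(3)[of p] by (cases k) simp_all
    qed (auto simp: \<chi>0)
    then show "\<chi> p q \<in> Arr C" "Dom C (\<chi> p q) = P p \<otimes>\<^sub>o P q" "Cod C (\<chi> p q) = P (p + q)" by auto
  qed
  note assoc = algebra_assoc[OF B]
  \<comment> \<open>The invariant of the recursion. Right linearity allows the next descent along
    \<open>\<pi> n\<close>; both linearities together are multiplicativity against degree 0.\<close>
  define lin where "lin n x \<longleftrightarrow> x \<in> hom C (P n) B \<and> x \<cdot> R n = m \<cdot> (x \<otimes> f0) \<and> x \<cdot> L n = m \<cdot> (f0 \<otimes> x)"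
    for n x
  have "\<exists>y. lin (Suc n) y \<and> y \<cdot> \<pi> n = m \<cdot> (x \<otimes> f1)" if n: "n \<ge> 1" and lin: "lin n x" for n x
  proof -
    note [simp] = pi_type[OF n]
    have [simp]: "x \<in> Arr C" "Dom C x = P n" "Cod C x = B"
      and xR: "x \<cdot> R n = m \<cdot> (x \<otimes> f0)" and xL: "x \<cdot> L n = m \<cdot> (f0 \<otimes> x)"
      using lin by (auto simp: lin_def)
    have coeq: "is_coequalizer C (R n \<otimes> \<one> (mcarr M))
        ((\<one> (P n) \<otimes> lact M) \<cdot> \<a> (P n) (carr H) (mcarr M)) (\<pi> n)"
      using step(1)[OF n] by (simp add: is_tensor_over_def)
    have eq: "(m \<cdot> (x \<otimes> f1)) \<cdot> (R n \<otimes> \<one> (mcarr M)) =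
        (m \<cdot> (x \<otimes> f1)) \<cdot> ((\<one> (P n) \<otimes> lact M) \<cdot> \<a> (P n) (carr H) (mcarr M))"
      by (simp add: xR f1l assoc)
    have "m \<cdot> (x \<otimes> f1) \<in> hom C (Cod C (R n \<otimes> \<one> (mcarr M))) B" by simp
    from coequalizer_factor[OF coeq this eq]
    obtain y where "y \<in> hom C (Cod C (\<pi> n)) B" "y \<cdot> \<pi> n = m \<cdot> (x \<otimes> f1)" .
    then have y: "y \<in> hom C (P (Suc n)) B" "y \<cdot> \<pi> n = m \<cdot> (x \<otimes> f1)" by simp_all
    have [simp]: "y \<in> Arr C" "Dom C y = P (Suc n)" "Cod C y = B" using y by auto
    have yx: "y \<cdot> (\<pi> n \<cdot> z) = m \<cdot> ((x \<otimes> f1) \<cdot> z)" if "z \<in> Arr C" "Cod C z = P n \<otimes>\<^sub>o mcarr M" for z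
      by (rule Comp_eq_Comp[OF y(2)]) (use that in simp_all)
    \<comment> \<open>The right action on the next power acts on its last factor \<open>M\<close>,
      so right linearity of \<open>y\<close> comes from that of \<open>f1\<close>; the left action
      acts on \<open>P n\<close>, so left linearity comes from that of \<open>x\<close>.\<close>
    have "y \<cdot> R (Suc n) = m \<cdot> (y \<otimes> f0)"
    proof (rule epicD[OF epic_TenA[OF \<pi>[OF n] epic_Idn[of "carr H"]]])
      have "y \<cdot> R (Suc n) \<cdot> (\<pi> n \<otimes> \<one> (carr H)) = y \<cdot> (R (Suc n) \<cdot> (\<pi> n \<otimes> \<one> (carr H)))" by simp
      also have "\<dots> = m \<cdot> ((x \<otimes> (f1 \<cdot> ract M)) \<cdot> \<a> (P n) (mcarr M) (carr H))"
        unfolding step(5)[OF n] by (simp add: yx)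
      also have "\<dots> = m \<cdot> ((y \<cdot> \<pi> n) \<otimes> f0)"
        by (simp add: f1r y(2) assoc)
      finally show "y \<cdot> R (Suc n) \<cdot> (\<pi> n \<otimes> \<one> (carr H)) = m \<cdot> (y \<otimes> f0) \<cdot> (\<pi> n \<otimes> \<one> (carr H))" by simp
    qed simp_all
    moreover have "y \<cdot> L (Suc n) = m \<cdot> (f0 \<otimes> y)"
    proof (rule epicD[OF epic_TenA[OF epic_Idn[of "carr H"] \<pi>[OF n]]])
      have "y \<cdot> L (Suc n) \<cdot> (\<one> (carr H) \<otimes> \<pi> n) = y \<cdot> (L (Suc n) \<cdot> (\<one> (carr H) \<otimes> \<pi> n))" by simp
      also have "\<dots> = m \<cdot> (((x \<cdot> L n) \<otimes> f1) \<cdot> \<a>\<inverse> (carr H) (P n) (mcarr M))"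
        unfolding step(3)[OF n] by (simp add: yx)
      also have "\<dots> = (m \<cdot> ((m \<cdot> (f0 \<otimes> x)) \<otimes> f1)) \<cdot> \<a>\<inverse> (carr H) (P n) (mcarr M)"
        by (simp add: xL)
      also have "\<dots> = m \<cdot> (f0 \<otimes> (y \<cdot> \<pi> n))"
        unfolding y(2) by (subst assoc) simp_all
      finally show "y \<cdot> L (Suc n) \<cdot> (\<one> (carr H) \<otimes> \<pi> n) = m \<cdot> (f0 \<otimes> y) \<cdot> (\<one> (carr H) \<otimes> \<pi> n)" by simp
    qed simp_all
    ultimately have "lin (Suc n) y" by (simp add: lin_def)
    with y(2) show ?thesis by blast
  qed
  \<comment> \<open>The recursion starts in degree 1, so \<open>G n\<close> will have degree
    \<open>Suc n\<close>. As \<open>dependent_nat_choice\<close> leaves the initial value open, the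
    clause for degree 1 pins it to \<open>f1\<close>.\<close>
  then have ext: "\<exists>y. (lin (Suc (Suc n)) y \<and> (Suc n = 0 \<longrightarrow> y = f1)) \<and> y \<cdot> \<pi> (Suc n) = m \<cdot> (x \<otimes> f1)"
    if "lin (Suc n) x \<and> (n = 0 \<longrightarrow> x = f1)" for n x
    using that by simp
  have "lin (Suc 0) f1 \<and> ((0 :: nat) = 0 \<longrightarrow> f1 = f1)" by (simp add: lin_def f1r f1l)
  then obtain G where G: "\<And>n. lin (Suc n) (G n) \<and> (n = 0 \<longrightarrow> G n = f1)"
    and G\<pi>: "\<And>n. G (Suc n) \<cdot> \<pi> (Suc n) = m \<cdot> (G n \<otimes> f1)"
    using dependent_nat_choice[of "\<lambda>n x. lin (Suc n) x \<and> (n = 0 \<longrightarrow> x = f1)"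
        "\<lambda>n x y. y \<cdot> \<pi> (Suc n) = m \<cdot> (x \<otimes> f1)", OF _ ext] by blast
  define F where "F n = (case n of 0 \<Rightarrow> f0 | Suc k \<Rightarrow> G k)" for n
  have linF: "lin n (F n)" for n
    using G f0m by (cases n) (auto simp: F_def lin_def)
  have [simp]: "F 0 = f0" "F (Suc 0) = f1" using G[of 0] by (simp_all add: F_def)
  have F\<pi>: "F (Suc n) \<cdot> \<pi> n = m \<cdot> (F n \<otimes> f1)" if "n \<ge> 1" for n
    using that G\<pi> by (cases n) (auto simp: F_def)
  have [simp]: "F n \<in> Arr C" "Dom C (F n) = P n" "Cod C (F n) = B"
    and FR: "F n \<cdot> R n = m \<cdot> (F n \<otimes> f0)" and FL: "F n \<cdot> L n = m \<cdot> (f0 \<otimes> F n)" for n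
    using linF[of n] by (auto simp: lin_def)
  \<comment> \<open>Induction on the degree of the right factor: after composing with the epic
    \<open>\<one> (P p) \<otimes> \<pi> q\<close>, a product with degree q + 1 is a product with
    degree q followed by one with \<open>M\<close>.\<close>
  have F\<chi>1: "F (p + Suc q) \<cdot> \<chi> p (Suc q) = m \<cdot> (F p \<otimes> F (Suc q))" if p: "p \<ge> 1" for p q
  proof (induction q)
    case 0
    show ?case using F\<pi>[OF p] \<chi>0(3)[OF p] by simp
  next
    case (Suc q)
    note [simp] = p[simplified]
    have IH: "F (Suc (p + q)) \<cdot> \<chi> p (Suc q) = m \<cdot> (F p \<otimes> F (Suc q))" using Suc by simp
    have F\<pi>': "F (Suc (Suc (p + q))) \<cdot> (\<pi> (Suc (p + q)) \<cdot> z) = m \<cdot> ((F (Suc (p + q)) \<otimes> f1) \<cdot> z)"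
      if "z \<in> Arr C" "Cod C z = P (Suc (p + q)) \<otimes>\<^sub>o mcarr M" for z
      by (rule Comp_eq_Comp[OF F\<pi>[of "Suc (p + q)"]]) (use that in simp_all)
    have "F (Suc (Suc (p + q))) \<cdot> \<chi> p (Suc (Suc q)) \<cdot> (\<one> (P p) \<otimes> \<pi> (Suc q)) =
        F (Suc (Suc (p + q))) \<cdot> (\<chi> p (Suc (Suc q)) \<cdot> (\<one> (P p) \<otimes> \<pi> (Suc q)))" by simp
    also have "\<dots> = m \<cdot> (((F (Suc (p + q)) \<cdot> \<chi> p (Suc q)) \<otimes> f1) \<cdot> \<a>\<inverse> (P p) (P (Suc q)) (mcarr M))"
      unfolding \<chi>Suc(2)[OF p, of "Suc q", simplified] by (simp add: F\<pi>')
    also have "\<dots> = (m \<cdot> ((m \<cdot> (F p \<otimes> F (Suc q))) \<otimes> f1)) \<cdot> \<a>\<inverse> (P p) (P (Suc q)) (mcarr M)"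
      by (simp add: IH)
    also have "\<dots> = m \<cdot> (F p \<otimes> (m \<cdot> (F (Suc q) \<otimes> f1)))"
      by (subst assoc) simp_all
    also have "\<dots> = m \<cdot> (F p \<otimes> F (Suc (Suc q))) \<cdot> (\<one> (P p) \<otimes> \<pi> (Suc q))"
      by (simp add: F\<pi>)
    finally have "F (Suc (Suc (p + q))) \<cdot> \<chi> p (Suc (Suc q)) = m \<cdot> (F p \<otimes> F (Suc (Suc q)))"
      by (rule epicD[rotated]) (simp_all add: epic_TenA epic_Idn \<pi>)
    then show ?case by simp
  qed
  have F\<chi>: "F (p + q) \<cdot> \<chi> p q = m \<cdot> (F p \<otimes> F q)" for p q
  proof (cases "p = 0 \<or> q = 0")
    case True
    then show ?thesis by (auto simp: \<chi>0 FL FR)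
  next
    case False
    then obtain k where "q = Suc k" "p \<ge> 1" by (cases q) auto
    then show ?thesis using F\<chi>1 by simp
  qed
  obtain h where h: "h \<in> hom C (carr T) B" and hi: "\<And>n. h \<cdot> i n = F n"
    using coproduct_copair[OF graded_coproduct[OF X], of B F] graded_braided_bialgebraD(3)[OF gT]
    by (auto simp: P_def[symmetric] i_def[symmetric])
  have [simp]: "h \<in> Arr C" "Dom C h = carr T" "Cod C h = B" using h by auto
  have "h \<cdot> mult T = m \<cdot> (h \<otimes> h)"
  proof (rule graded_TenA_ext[OF X X])
    fix a b
    have "h \<cdot> mult T \<cdot> (i a \<otimes> i b) = (h \<cdot> i (a + b)) \<cdot> \<chi> a b" by (simp add: \<chi>)
    also have "\<dots> = m \<cdot> (F a \<otimes> F b)" unfolding hi F\<chi> ..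
    finally have "h \<cdot> mult T \<cdot> (i a \<otimes> i b) = m \<cdot> (h \<otimes> h) \<cdot> (i a \<otimes> i b)" by (simp add: hi)
    then show "h \<cdot> mult T \<cdot> (inc (grading T) a \<otimes> inc (grading T) b) =
        m \<cdot> (h \<otimes> h) \<cdot> (inc (grading T) a \<otimes> inc (grading T) b)" by (simp add: i_def)
  qed (simp_all add: graded_braided_bialgebraD(3)[OF gT])
  moreover have "h \<cdot> unt T = u"
  proof -
    have "h \<cdot> unt T = (h \<cdot> i 0) \<cdot> unt H" unfolding tensor_bialgebraD(2)[OF T] i_def[symmetric] by simp
    then show ?thesis by (simp add: hi f0u)
  qed
  ultimately show ?thesis
    using that[OF h] hi by (simp add: i_def)
qed

section \<open>The canonical homomorphism\<close>

text \<open>The definition prescribes only the components of the product in degrees 0 and 1, and a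
  product of total degree at most 1 has no others because the product is graded. The formulas make
  the inclusion of degree 0 multiplicative and that of degree 1 linear over it, and give both the
  coproducts that the corresponding inclusions have in the tensor bialgebra.\<close>

lemma cotensor_bialgebra_low_degree:
  assumes T: "cotensor_bialgebra H M T" and H: "braided_bialgebra H" and M: "hopf_bimodule H M"
  shows "mult T \<cdot> (inc (grading T) 0 \<otimes> inc (grading T) 0) = inc (grading T) 0 \<cdot> mult H"
    "mult T \<cdot> (inc (grading T) 0 \<otimes> inc (grading T) (Suc 0)) = inc (grading T) (Suc 0) \<cdot> lact M"
    "mult T \<cdot> (inc (grading T) (Suc 0) \<otimes> inc (grading T) 0) = inc (grading T) (Suc 0) \<cdot> ract M"
    "comult T \<cdot> inc (grading T) 0 = (inc (grading T) 0 \<otimes> inc (grading T) 0) \<cdot> comult H"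
    "comult T \<cdot> inc (grading T) (Suc 0) = ((inc (grading T) 0 \<otimes> inc (grading T) (Suc 0)) \<cdot> lcoact M) \<oplus>
      ((inc (grading T) (Suc 0) \<otimes> inc (grading T) 0) \<cdot> rcoact M)"
    "unt T = inc (grading T) 0 \<cdot> unt H"
    "counit T \<cdot> inc (grading T) 0 = counit H"
    "counit T \<cdot> inc (grading T) (Suc 0) = \<zero> (mcarr M) \<I>"
proof -
  note gT = cotensor_bialgebraD(1)[OF T]
  note bT = graded_braided_bialgebraD(1)[OF gT]
  note X = graded_braided_bialgebraD(2)[OF gT]
  note [simp] = graded_objectD[OF X] graded_braided_bialgebraD(3)[OF gT]
    braided_bialgebra_type[OF bT] cotensor_bialgebraD(7,8)[OF T]
    braided_bialgebra_type[OF H] hopf_bimodule_type[OF M]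
  let ?i = "inc (grading T)" and ?p = "prj (grading T)"
  note zero = graded_braided_bialgebra_prj[OF gT]
  have pm: "?p 0 \<cdot> (mult T \<cdot> z) = mult H \<cdot> ((?p 0 \<otimes> ?p 0) \<cdot> z)"
    "?p (Suc 0) \<cdot> (mult T \<cdot> z) = lact M \<cdot> ((?p 0 \<otimes> ?p (Suc 0)) \<cdot> z) \<oplus> ract M \<cdot> ((?p (Suc 0) \<otimes> ?p 0) \<cdot> z)"
    if "z \<in> Arr C" "Cod C z = carr T \<otimes>\<^sub>o carr T" for z
  proof -
    show "?p 0 \<cdot> (mult T \<cdot> z) = mult H \<cdot> ((?p 0 \<otimes> ?p 0) \<cdot> z)"
      by (rule Comp_eq_Comp[OF cotensor_bialgebraD(3)[OF T]]) (use that in simp_all)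
    have "?p (Suc 0) \<cdot> (mult T \<cdot> z) = (?p (Suc 0) \<cdot> mult T) \<cdot> z" using that by simp
    then show "?p (Suc 0) \<cdot> (mult T \<cdot> z) =
        lact M \<cdot> ((?p 0 \<otimes> ?p (Suc 0)) \<cdot> z) \<oplus> ract M \<cdot> ((?p (Suc 0) \<otimes> ?p 0) \<cdot> z)"
      unfolding cotensor_bialgebraD(4)[OF T] using that by simp
  qed
  have "mult T \<cdot> (?i 0 \<otimes> ?i 0) = ?i 0 \<cdot> (?p 0 \<cdot> (mult T \<cdot> (?i 0 \<otimes> ?i 0)))"
    by (rule eq_inc_prj[OF X, where A = "carr H \<otimes>\<^sub>o carr H"]) (use zero(1)[of _ 0 0] in simp_all)
  also have "\<dots> = ?i 0 \<cdot> mult H" by (simp add: pm)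
  finally show "mult T \<cdot> (?i 0 \<otimes> ?i 0) = ?i 0 \<cdot> mult H" .
  have "mult T \<cdot> (?i 0 \<otimes> ?i (Suc 0)) = ?i (Suc 0) \<cdot> (?p (Suc 0) \<cdot> (mult T \<cdot> (?i 0 \<otimes> ?i (Suc 0))))"
    by (rule eq_inc_prj[OF X, where A = "carr H \<otimes>\<^sub>o mcarr M"]) (use zero(1)[of _ 0 "Suc 0"] in simp_all)
  also have "\<dots> = ?i (Suc 0) \<cdot> lact M" by (simp add: pm)
  finally show "mult T \<cdot> (?i 0 \<otimes> ?i (Suc 0)) = ?i (Suc 0) \<cdot> lact M" .
  have "mult T \<cdot> (?i (Suc 0) \<otimes> ?i 0) = ?i (Suc 0) \<cdot> (?p (Suc 0) \<cdot> (mult T \<cdot> (?i (Suc 0) \<otimes> ?i 0)))"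
    by (rule eq_inc_prj[OF X, where A = "mcarr M \<otimes>\<^sub>o carr H"]) (use zero(1)[of _ "Suc 0" 0] in simp_all)
  also have "\<dots> = ?i (Suc 0) \<cdot> ract M" by (simp add: pm)
  finally show "mult T \<cdot> (?i (Suc 0) \<otimes> ?i 0) = ?i (Suc 0) \<cdot> ract M" .

  have pd: "(?p 0 \<otimes> ?p 0) \<cdot> (comult T \<cdot> z) = comult H \<cdot> (?p 0 \<cdot> z)"
    "(?p 0 \<otimes> ?p (Suc 0)) \<cdot> (comult T \<cdot> z) = lcoact M \<cdot> (?p (Suc 0) \<cdot> z)"
    "(?p (Suc 0) \<otimes> ?p 0) \<cdot> (comult T \<cdot> z) = rcoact M \<cdot> (?p (Suc 0) \<cdot> z)"
    if "z \<in> Arr C" "Cod C z = carr T" for z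
    by (rule Comp_eq_Comp[OF cotensor_bialgebraD(9)[OF T]]
        Comp_eq_Comp[OF cotensor_bialgebraD(10)[OF T]]
        Comp_eq_Comp[OF cotensor_bialgebraD(11)[OF T]]; use that in simp)+
  show "comult T \<cdot> ?i 0 = (?i 0 \<otimes> ?i 0) \<cdot> comult H"
  proof (rule graded_TenA_prj_ext[OF X X])
    fix a b
    show "(?p a \<otimes> ?p b) \<cdot> (comult T \<cdot> ?i 0) = (?p a \<otimes> ?p b) \<cdot> ((?i 0 \<otimes> ?i 0) \<cdot> comult H)"
      using zero(2)[of 0 a b] by (cases "a = 0 \<and> b = 0") (auto simp: pd)
  qed simp_all
  show "comult T \<cdot> ?i (Suc 0) = ((?i 0 \<otimes> ?i (Suc 0)) \<cdot> lcoact M) \<oplus> ((?i (Suc 0) \<otimes> ?i 0) \<cdot> rcoact M)"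
  proof (rule graded_TenA_prj_ext[OF X X])
    fix a b
    \<comment> \<open>By gradedness, only the two pairs of total degree 1 can give nonzero
      components.\<close>
    consider "a = 0" "b = Suc 0" | "a = Suc 0" "b = 0" | "Suc 0 \<noteq> a + b" by linarith
    then show "(?p a \<otimes> ?p b) \<cdot> (comult T \<cdot> ?i (Suc 0)) =
        (?p a \<otimes> ?p b) \<cdot> (((?i 0 \<otimes> ?i (Suc 0)) \<cdot> lcoact M) \<oplus> ((?i (Suc 0) \<otimes> ?i 0) \<cdot> rcoact M))"
    proof cases
      case 3
      then show ?thesis using zero(2)[of "Suc 0" a b] by auto
    qed (simp_all add: pd)
  qed simp_all
  \<comment> \<open>The definition prescribes the unit in degrees 0 and 1. Above that, the monic
    \<open>\<iota>\<close> reduces the claim to a lower degree, because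
    \<open>comult T \<cdot> unt T\<close> is \<open>unt T \<otimes> unt T\<close> up to a unit
    constraint.\<close>
  have u: "?p (Suc n) \<cdot> unt T = \<zero> \<I> (cmp (grading T) (Suc n))" for n
  proof (induction n)
    case 0
    show ?case using cotensor_bialgebraD(6)[OF T] by simp
  next
    case (Suc n)
    obtain \<iota> where \<iota>: "monic C \<iota>" and [simp]: "\<iota> \<in> Arr C" "Cod C \<iota> = cmp (grading T) (Suc n) \<otimes>\<^sub>o mcarr M"
      "Dom C \<iota> = cmp (grading T) (Suc (Suc n))" and
      \<iota>d: "(?p (Suc n) \<otimes> ?p (Suc 0)) \<cdot> comult T = \<iota> \<cdot> ?p (Suc (Suc n))"
      by (rule cotensor_bialgebra_cogenerated[OF T, of "Suc n"]) auto
    have "\<iota> \<cdot> (?p (Suc (Suc n)) \<cdot> unt T) = (?p (Suc n) \<otimes> ?p (Suc 0)) \<cdot> (comult T \<cdot> unt T)"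
      by (rule Comp_eq_Comp[OF \<iota>d[symmetric]]) simp_all
    also have "\<dots> = \<iota> \<cdot> \<zero> \<I> (cmp (grading T) (Suc (Suc n)))"
      unfolding braided_bialgebraD(5)[OF bT] by (simp add: Suc)
    finally show ?case by (rule monicD[OF \<iota>]) simp_all
  qed
  have "unt T = ?i 0 \<cdot> (?p 0 \<cdot> unt T)"
  proof (rule eq_inc_prj[OF X])
    show "?p k \<cdot> unt T = \<zero> \<I> (cmp (grading T) k)" if "k \<noteq> 0" for k
      using u[of "k - 1"] that by simp
  qed simp
  then show "unt T = ?i 0 \<cdot> unt H" by (simp add: cotensor_bialgebraD(5)[OF T])
  show "counit T \<cdot> ?i 0 = counit H" "counit T \<cdot> ?i (Suc 0) = \<zero> (mcarr M) \<I>"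
    by (simp_all add: cotensor_bialgebraD(2)[OF T])
qed

text \<open>By the formulas in low degrees, the inclusion of degree 0 is an algebra homomorphism and
  that of degree 1 is bilinear over it, which is what the extension result demands.\<close>

lemma canonical_hom_exists:
  assumes H: "braided_bialgebra H" and M: "hopf_bimodule H M"
    and T: "tensor_bialgebra H M T" and Tc: "cotensor_bialgebra H M Tc"
  obtains F where "algebra_hom T Tc F" "F \<cdot> inc (grading T) 0 = inc (grading Tc) 0"
    "F \<cdot> inc (grading T) (Suc 0) = inc (grading Tc) (Suc 0)"
proof -
  note gTc = cotensor_bialgebraD(1)[OF Tc]
  note [simp] = graded_objectD[OF graded_braided_bialgebraD(2)[OF gTc]]
    graded_braided_bialgebraD(3)[OF gTc] cotensor_bialgebraD(7,8)[OF Tc]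
  note low = cotensor_bialgebra_low_degree[OF Tc H M]
  show ?thesis
  proof (rule tensor_bialgebra_hom_exists[OF T H M, of "carr Tc" "mult Tc" "unt Tc"
        "inc (grading Tc) 0" "inc (grading Tc) (Suc 0)"])
    show "algebra (carr Tc) (mult Tc) (unt Tc)"
      by (rule braided_bialgebraD graded_braided_bialgebraD gTc)+
    fix F assume "F \<in> hom C (carr T) (carr Tc)" "F \<cdot> mult T = mult Tc \<cdot> (F \<otimes> F)" "F \<cdot> unt T = unt Tc"
      "F \<cdot> inc (grading T) 0 = inc (grading Tc) 0" "F \<cdot> inc (grading T) (Suc 0) = inc (grading Tc) (Suc 0)"
    then show ?thesis using that[of F] by (simp add: algebra_hom_def)
  qed (simp_all add: low)
qed

text \<open>Up to the epic \<open>\<pi>\<close>, \<open>F\<close> in degree n + 1 is the product of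
  its value in degree n with the inclusion of degree 1, and a product of degrees n and 1 in
  \<open>Tc\<close> has no component outside degree n + 1.\<close>

lemma canonical_hom_graded:
  assumes T: "tensor_bialgebra H M T" and Tc: "cotensor_bialgebra H M Tc"
    and F: "algebra_hom T Tc F" and F0: "F \<cdot> inc (grading T) 0 = inc (grading Tc) 0"
    and F1: "F \<cdot> inc (grading T) (Suc 0) = inc (grading Tc) (Suc 0)"
  shows "is_direct_sum_of (grading T) (grading Tc) F (\<lambda>n. prj (grading Tc) n \<cdot> (F \<cdot> inc (grading T) n))"
proof -
  note gT = tensor_bialgebraD(1)[OF T] and gTc = cotensor_bialgebraD(1)[OF Tc]
  note X = graded_braided_bialgebraD(2)[OF gT] and Y = graded_braided_bialgebraD(2)[OF gTc]
  note [simp] = graded_objectD[OF X] graded_braided_bialgebraD(3)[OF gT]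
    braided_bialgebra_type[OF graded_braided_bialgebraD(1)[OF gT]] tensor_bialgebraD(7,8)[OF T]
    graded_objectD[OF Y] graded_braided_bialgebraD(3)[OF gTc]
    braided_bialgebra_type[OF graded_braided_bialgebraD(1)[OF gTc]] cotensor_bialgebraD(7,8)[OF Tc]
  have [simp]: "F \<in> Arr C" "Dom C F = carr T" "Cod C F = carr Tc"
    and Fm: "F \<cdot> mult T = mult Tc \<cdot> (F \<otimes> F)" using F by (auto simp: algebra_hom_def)
  have M [simp]: "mcarr M \<in> Obj C" using graded_objectD(7)[OF X, of "Suc 0"] by simp
  have "\<forall>k. k \<noteq> Suc n \<longrightarrow> prj (grading Tc) k \<cdot> (F \<cdot> inc (grading T) (Suc n)) =
      \<zero> (cmp (grading T) (Suc n)) (cmp (grading Tc) k)" for n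
  proof (induction n)
    case 0
    show ?case by (simp add: F1)
  next
    case (Suc n)
    obtain \<pi> where \<pi>: "epic C \<pi>" and [simp]: "\<pi> \<in> Arr C" "Dom C \<pi> = cmp (grading T) (Suc n) \<otimes>\<^sub>o mcarr M"
      "Cod C \<pi> = cmp (grading T) (Suc (Suc n))" and
      \<pi>m: "mult T \<cdot> (inc (grading T) (Suc n) \<otimes> inc (grading T) (Suc 0)) = inc (grading T) (Suc (Suc n)) \<cdot> \<pi>"
      by (rule tensor_bialgebra_generated[OF T, of "Suc n"]) auto
    define Fn where "Fn = prj (grading Tc) (Suc n) \<cdot> (F \<cdot> inc (grading T) (Suc n))"
    have [simp]: "Fn \<in> Arr C" "Dom C Fn = cmp (grading T) (Suc n)" "Cod C Fn = cmp (grading Tc) (Suc n)"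
      by (simp_all add: Fn_def)
    have Fn: "F \<cdot> inc (grading T) (Suc n) = inc (grading Tc) (Suc n) \<cdot> Fn"
      unfolding Fn_def by (rule eq_inc_prj[OF Y, where A = "cmp (grading T) (Suc n)"]) (use Suc in simp_all)
    have *: "F \<cdot> (inc (grading T) (Suc (Suc n)) \<cdot> \<pi>) =
        mult Tc \<cdot> ((inc (grading Tc) (Suc n) \<otimes> inc (grading Tc) (Suc 0)) \<cdot> (Fn \<otimes> \<one> (mcarr M)))"
    proof -
      have "F \<cdot> (inc (grading T) (Suc (Suc n)) \<cdot> \<pi>) =
          F \<cdot> (mult T \<cdot> (inc (grading T) (Suc n) \<otimes> inc (grading T) (Suc 0)))"
        by (simp add: \<pi>m)
      also have "\<dots> = mult Tc \<cdot> ((F \<otimes> F) \<cdot> (inc (grading T) (Suc n) \<otimes> inc (grading T) (Suc 0)))"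
        by (rule Comp_eq_Comp[OF Fm]) simp_all
      finally show ?thesis by (simp add: Fn F1)
    qed
    show ?case
    proof (intro allI impI)
      fix k assume k: "k \<noteq> Suc (Suc n)"
      then have k': "k \<noteq> Suc n + Suc 0" by simp
      have "prj (grading Tc) k \<cdot> (F \<cdot> inc (grading T) (Suc (Suc n))) \<cdot> \<pi> =
          prj (grading Tc) k \<cdot> (F \<cdot> (inc (grading T) (Suc (Suc n)) \<cdot> \<pi>))" by simp
      also have "\<dots> = (prj (grading Tc) k \<cdot> (mult Tc \<cdot>
          (inc (grading Tc) (Suc n) \<otimes> inc (grading Tc) (Suc 0)))) \<cdot> (Fn \<otimes> \<one> (mcarr M))"
        unfolding * by simp
      also have "\<dots> = \<zero> (cmp (grading T) (Suc (Suc n))) (cmp (grading Tc) k) \<cdot> \<pi>"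
        unfolding graded_braided_bialgebra_prj(1)[OF gTc k'] by simp
      finally show "prj (grading Tc) k \<cdot> (F \<cdot> inc (grading T) (Suc (Suc n))) =
          \<zero> (cmp (grading T) (Suc (Suc n))) (cmp (grading Tc) k)"
        by (rule epicD[OF \<pi>]) simp_all
    qed
  qed
  moreover have "prj (grading Tc) k \<cdot> (F \<cdot> inc (grading T) 0) =
      \<zero> (cmp (grading T) 0) (cmp (grading Tc) k)" if "k \<noteq> 0" for k
    using that by (simp add: F0)
  ultimately have "prj (grading Tc) k \<cdot> (F \<cdot> inc (grading T) n) =
      \<zero> (cmp (grading T) n) (cmp (grading Tc) k)" if "k \<noteq> n" for k n
    using that by (cases n) blast+
  then show ?thesis by (intro is_direct_sum_ofI[OF X Y]) simp_all
qed

lemma canonical_hom_coalgebra_hom: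
  assumes H: "braided_bialgebra H" and M: "hopf_bimodule H M"
    and T: "tensor_bialgebra H M T" and Tc: "cotensor_bialgebra H M Tc"
    and F: "algebra_hom T Tc F" and F0: "F \<cdot> inc (grading T) 0 = inc (grading Tc) 0"
    and F1: "F \<cdot> inc (grading T) (Suc 0) = inc (grading Tc) (Suc 0)"
  shows "coalgebra_hom T Tc F"
proof -
  note gT = tensor_bialgebraD(1)[OF T] and gTc = cotensor_bialgebraD(1)[OF Tc]
  note bT = graded_braided_bialgebraD(1)[OF gT] and bTc = graded_braided_bialgebraD(1)[OF gTc]
  note X = graded_braided_bialgebraD(2)[OF gT] and Y = graded_braided_bialgebraD(2)[OF gTc]
  note [simp] = graded_objectD[OF X] graded_braided_bialgebraD(3)[OF gT]
    braided_bialgebra_type[OF bT] tensor_bialgebraD(7,8)[OF T]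
    graded_objectD[OF Y] graded_braided_bialgebraD(3)[OF gTc]
    braided_bialgebra_type[OF bTc] cotensor_bialgebraD(7,8)[OF Tc]
    braided_bialgebra_type[OF H] hopf_bimodule_type[OF M]
  note low = cotensor_bialgebra_low_degree[OF Tc H M]
  have [simp]: "F \<in> Arr C" "Dom C F = carr T" "Cod C F = carr Tc"
    and Fm: "F \<cdot> mult T = mult Tc \<cdot> (F \<otimes> F)" using F by (auto simp: algebra_hom_def)
  have Fmz: "F \<cdot> (mult T \<cdot> z) = mult Tc \<cdot> ((F \<otimes> F) \<cdot> z)" if "z \<in> Arr C" "Cod C z = carr T \<otimes>\<^sub>o carr T" for z
    by (rule Comp_eq_Comp[OF Fm]) (use that in simp_all)
  let ?s = "swap_middle (carr Tc) (carr Tc) (carr Tc) (carr Tc)"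
  \<comment> \<open>The product on the target is the braided one on the tensor square of
    \<open>Tc\<close>. For the left side multiplicativity is the bialgebra axiom of
    \<open>Tc\<close>; for the right side it is that of \<open>T\<close>, moved across by naturality
    of the middle interchange.\<close>
  have "comult Tc \<cdot> F = (F \<otimes> F) \<cdot> comult T"
  proof (rule tensor_bialgebra_hom_ext[OF T, of "(mult Tc \<otimes> mult Tc) \<cdot> ?s"])
    have "comult Tc \<cdot> F \<cdot> mult T = comult Tc \<cdot> (mult Tc \<cdot> (F \<otimes> F))" by (simp add: Fm)
    also have "\<dots> = (mult Tc \<otimes> mult Tc) \<cdot> ?s \<cdot> (comult Tc \<otimes> comult Tc) \<cdot> (F \<otimes> F)"
      unfolding braided_bialgebraD(3)[OF bTc, symmetric] by simp
    finally show "comult Tc \<cdot> F \<cdot> mult T =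
        (mult Tc \<otimes> mult Tc) \<cdot> ?s \<cdot> ((comult Tc \<cdot> F) \<otimes> (comult Tc \<cdot> F))" by simp
    have swap: "?s \<cdot> (((F \<otimes> F) \<otimes> (F \<otimes> F)) \<cdot> z) =
        ((F \<otimes> F) \<otimes> (F \<otimes> F)) \<cdot> (swap_middle (carr T) (carr T) (carr T) (carr T) \<cdot> z)"
      if "z \<in> Arr C" "Cod C z = (carr T \<otimes>\<^sub>o carr T) \<otimes>\<^sub>o (carr T \<otimes>\<^sub>o carr T)" for z
      by (rule Comp_eq_Comp) (use swap_middle_natural[of F F F F] that in simp_all)
    have "(F \<otimes> F) \<cdot> comult T \<cdot> mult T = (F \<otimes> F) \<cdot> (comult T \<cdot> mult T)" by simp
    also have "\<dots> = ((F \<cdot> mult T) \<otimes> (F \<cdot> mult T)) \<cdot>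
        (swap_middle (carr T) (carr T) (carr T) (carr T) \<cdot> (comult T \<otimes> comult T))"
      unfolding braided_bialgebraD(3)[OF bT] by simp
    also have "\<dots> = (mult Tc \<otimes> mult Tc) \<cdot> (((F \<otimes> F) \<otimes> (F \<otimes> F)) \<cdot>
        (swap_middle (carr T) (carr T) (carr T) (carr T) \<cdot> (comult T \<otimes> comult T)))"
      unfolding Fm by simp
    also have "\<dots> = (mult Tc \<otimes> mult Tc) \<cdot> ?s \<cdot> (((F \<otimes> F) \<cdot> comult T) \<otimes> ((F \<otimes> F) \<cdot> comult T))"
      unfolding swap[of "comult T \<otimes> comult T", simplified, symmetric] by simp
    finally show "(F \<otimes> F) \<cdot> comult T \<cdot> mult T =
        (mult Tc \<otimes> mult Tc) \<cdot> ?s \<cdot> (((F \<otimes> F) \<cdot> comult T) \<otimes> ((F \<otimes> F) \<cdot> comult T))" .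
    show "comult Tc \<cdot> F \<cdot> inc (grading T) 0 = (F \<otimes> F) \<cdot> comult T \<cdot> inc (grading T) 0"
      by (simp add: F0 low tensor_bialgebraD(3)[OF T])
    show "comult Tc \<cdot> F \<cdot> inc (grading T) (Suc 0) = (F \<otimes> F) \<cdot> comult T \<cdot> inc (grading T) (Suc 0)"
      by (simp add: F0 F1 low tensor_bialgebraD(4)[OF T])
  qed simp_all
  \<comment> \<open>Here the target is the unit object with the product
    \<open>\<l> \<I>\<close>.\<close>
  moreover have "counit Tc \<cdot> F = counit T"
  proof (rule tensor_bialgebra_hom_ext[OF T, of "\<l> \<I>"])
    have "counit Tc \<cdot> F \<cdot> mult T = (counit Tc \<cdot> mult Tc) \<cdot> (F \<otimes> F)" by (simp add: Fm)
    then show "counit Tc \<cdot> F \<cdot> mult T = \<l> \<I> \<cdot> ((counit Tc \<cdot> F) \<otimes> (counit Tc \<cdot> F))"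
      unfolding braided_bialgebraD(4)[OF bTc] by simp
    show "counit T \<cdot> mult T = \<l> \<I> \<cdot> (counit T \<otimes> counit T)" by (rule braided_bialgebraD(4)[OF bT])
    show "counit Tc \<cdot> F \<cdot> inc (grading T) 0 = counit T \<cdot> inc (grading T) 0"
      "counit Tc \<cdot> F \<cdot> inc (grading T) (Suc 0) = counit T \<cdot> inc (grading T) (Suc 0)"
      by (simp_all add: F0 F1 low tensor_bialgebraD(5,6)[OF T])
  qed simp_all
  ultimately show ?thesis by (simp add: coalgebra_hom_def)
qed

section \<open>Images of graded bialgebra homomorphisms\<close>

lemma graded_image_exists:
  assumes X: "graded_object X" and Y: "graded_object Y" and F: "is_direct_sum_of X Y F Fn"
  obtains G \<phi> \<psi> where "graded_image X Y F G \<phi> \<psi>"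
proof -
  note [simp] = graded_objectD[OF X] graded_objectD[OF Y] is_direct_sum_ofD(1-6)[OF X Y F]
  \<comment> \<open>An identity must be factored trivially, so this case is separated; it can occur
    only if \<open>X\<close> and \<open>Y\<close> have the same object in degree
    \<open>n\<close>.\<close>
  have "\<exists>I e m. e \<in> hom C (cmp X n) I \<and> m \<in> hom C I (cmp Y n) \<and> epic C e \<and> monic C m \<and> Fn n = m \<cdot> e \<and>
      (Fn n = \<one> (cmp X n) \<longrightarrow> e = \<one> (cmp X n) \<and> m = \<one> (cmp X n))" for n
  proof (cases "Fn n = \<one> (cmp X n)")
    case True
    have "cmp X n = cmp Y n"
      using is_direct_sum_ofD(3)[OF X Y F, of n] unfolding True by simp
    then have "\<one> (cmp X n) \<in> hom C (cmp X n) (cmp X n) \<and> \<one> (cmp X n) \<in> hom C (cmp X n) (cmp Y n) \<and>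
      epic C (\<one> (cmp X n)) \<and> monic C (\<one> (cmp X n)) \<and> Fn n = \<one> (cmp X n) \<cdot> \<one> (cmp X n)"
      using True graded_objectD(7)[OF X, of n] by (simp add: epic_Idn monic_Idn)
    then show ?thesis by blast
  next
    case False
    obtain e m where em: "epic C e" "monic C m" "Cod C e = Dom C m" "Dom C e = Dom C (Fn n)"
      "Cod C m = Cod C (Fn n)" "Fn n = m \<cdot> e"
      using image_factorization[of "Fn n"] by auto
    have "Dom C e = cmp X n" "Cod C m = cmp Y n" using em(4,5) by simp_all
    then have "e \<in> hom C (cmp X n) (Dom C m)" "m \<in> hom C (Dom C m) (cmp Y n)"
      using em(3) epic_Arr[OF em(1)] monic_Arr[OF em(2)] by simp_all
    with em(1,2,6) False show ?thesis by blast
  qed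
  then obtain I e m where e: "\<And>n. e n \<in> hom C (cmp X n) (I n)" and m: "\<And>n. m n \<in> hom C (I n) (cmp Y n)"
    and em: "\<And>n. epic C (e n) \<and> monic C (m n) \<and> Fn n = m n \<cdot> e n \<and>
      (Fn n = \<one> (cmp X n) \<longrightarrow> e n = \<one> (cmp X n) \<and> m n = \<one> (cmp X n))" by metis
  have [simp]: "e n \<in> Arr C" "Dom C (e n) = cmp X n" "Cod C (e n) = I n"
    "m n \<in> Arr C" "Dom C (m n) = I n" "Cod C (m n) = cmp Y n" for n using e m by auto
  have [simp]: "I n \<in> Obj C" for n using Cod_Obj[of "e n"] by simp
  obtain S i where S: "is_coproduct C (UNIV :: nat set) I S i"
    by (rule countable_coproduct_exists[of id UNIV I]) auto
  note [simp] = coproductD[OF S, simplified]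
  have "\<exists>p \<in> hom C S (I n). \<forall>k. p \<cdot> i k = (if n = k then \<one> (I n) else \<zero> (I k) (I n))" for n
  proof -
    obtain p where "p \<in> hom C S (I n)" "\<And>k. p \<cdot> i k = (if n = k then \<one> (I n) else \<zero> (I k) (I n))"
      by (rule coproduct_copair[OF S, of "I n" "\<lambda>k. if n = k then \<one> (I n) else \<zero> (I k) (I n)"]) auto
    then show ?thesis by blast
  qed
  then obtain p where "\<And>n. p n \<in> hom C S (I n)"
    "\<And>n k. p n \<cdot> i k = (if n = k then \<one> (I n) else \<zero> (I k) (I n))" by metis
  then have G: "graded_object \<lparr>tot = S, cmp = I, inc = i, prj = p\<rparr>" (is "graded_object ?G")
    using S by (simp add: graded_object_def)
  obtain \<phi> where "\<phi> \<in> hom C (tot X) S" "\<And>n. \<phi> \<cdot> inc X n = i n \<cdot> e n"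
    by (rule coproduct_copair[OF graded_coproduct[OF X], of S "\<lambda>n. i n \<cdot> e n"]) auto
  then have \<phi>: "is_direct_sum_of X ?G \<phi> e" by (simp add: is_direct_sum_of_def)
  obtain \<psi> where "\<psi> \<in> hom C S (tot Y)" "\<And>n. \<psi> \<cdot> i n = inc Y n \<cdot> m n"
    by (rule coproduct_copair[OF S, of "tot Y" "\<lambda>n. inc Y n \<cdot> m n"]) auto
  then have \<psi>: "is_direct_sum_of ?G Y \<psi> m" by (simp add: is_direct_sum_of_def)
  have "graded_image X Y F ?G \<phi> \<psi>"
    unfolding graded_image_def using G F \<phi> \<psi> em by blast
  then show ?thesis by (rule that)
qed

text \<open>That \<open>\<phi>\<close> is epic is tested on injections and reduces to the degreewise
  epimorphisms; that \<open>\<psi>\<close> is monic is tested by projections, and so rests on their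
  joint monicity.\<close>

lemma graded_imageD:
  assumes X: "graded_object X" and Y: "graded_object Y" and G: "graded_image X Y F G \<phi> \<psi>"
  obtains \<phi>n \<psi>n where "graded_object G" "is_direct_sum_of X G \<phi> \<phi>n" "is_direct_sum_of G Y \<psi> \<psi>n"
    "\<And>n. epic C (\<phi>n n)" "\<And>n. monic C (\<psi>n n)" "F = \<psi> \<cdot> \<phi>" "epic C \<phi>" "monic C \<psi>"
    "\<And>n. F \<cdot> inc X n = inc Y n \<Longrightarrow> \<phi>n n = \<one> (cmp X n) \<and> \<psi>n n = \<one> (cmp X n)"
proof -
  obtain Fn \<phi>n \<psi>n where gG: "graded_object G" and F: "is_direct_sum_of X Y F Fn"
    and \<phi>: "is_direct_sum_of X G \<phi> \<phi>n" and \<psi>: "is_direct_sum_of G Y \<psi> \<psi>n"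
    and epic: "\<And>n. epic C (\<phi>n n)" and monic: "\<And>n. monic C (\<psi>n n)"
    and Fn: "\<And>n. Fn n = \<psi>n n \<cdot> \<phi>n n"
    and triv: "\<And>n. Fn n = \<one> (cmp X n) \<Longrightarrow> \<phi>n n = \<one> (cmp X n) \<and> \<psi>n n = \<one> (cmp X n)"
    using G unfolding graded_image_def by metis
  note [simp] = graded_objectD[OF X] graded_objectD[OF Y] graded_objectD[OF gG]
  note [simp] = is_direct_sum_ofD(1-6)[OF X Y F] is_direct_sum_ofD(1-6)[OF X gG \<phi>]
    is_direct_sum_ofD(1-6)[OF gG Y \<psi>]
  note F_inc = is_direct_sum_ofD(7)[OF X Y F] and \<phi>_inc = is_direct_sum_ofD(7)[OF X gG \<phi>]
    and \<psi>_inc = is_direct_sum_ofD(7)[OF gG Y \<psi>] and \<psi>_prj = is_direct_sum_ofD(8)[OF gG Y \<psi>]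
  have "F = \<psi> \<cdot> \<phi>"
  proof (rule graded_ext[OF X])
    fix n
    have "\<psi> \<cdot> \<phi> \<cdot> inc X n = (\<psi> \<cdot> inc G n) \<cdot> \<phi>n n" by (simp add: \<phi>_inc)
    also have "\<dots> = F \<cdot> inc X n" by (simp add: \<psi>_inc F_inc Fn)
    finally show "F \<cdot> inc X n = \<psi> \<cdot> \<phi> \<cdot> inc X n" ..
  qed simp_all
  moreover have "epic C \<phi>"
    unfolding epic_def
  proof (intro conjI allI ballI impI)
    fix Z g h assume gh: "g \<in> hom C (Cod C \<phi>) Z" "h \<in> hom C (Cod C \<phi>) Z" "g \<cdot> \<phi> = h \<cdot> \<phi>"
    have [simp]: "g \<in> Arr C" "Dom C g = tot G" "Cod C g = Z" "h \<in> Arr C" "Dom C h = tot G" "Cod C h = Z"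
      using gh by auto
    show "g = h"
    proof (rule graded_ext[OF gG])
      fix n
      have "g \<cdot> (\<phi> \<cdot> inc X n) = h \<cdot> (\<phi> \<cdot> inc X n)" by (rule Comp_eq_Comp[OF gh(3)]) simp_all
      then have "g \<cdot> inc G n \<cdot> \<phi>n n = h \<cdot> inc G n \<cdot> \<phi>n n" by (simp add: \<phi>_inc)
      then show "g \<cdot> inc G n = h \<cdot> inc G n" by (rule epicD[OF epic]) simp_all
    qed simp_all
  qed simp
  moreover have "monic C \<psi>"
    unfolding monic_def
  proof (intro conjI allI ballI impI)
    fix Z g h assume gh: "g \<in> hom C Z (Dom C \<psi>)" "h \<in> hom C Z (Dom C \<psi>)" "\<psi> \<cdot> g = \<psi> \<cdot> h"
    have [simp]: "g \<in> Arr C" "Dom C g = Z" "Cod C g = tot G" "h \<in> Arr C" "Dom C h = Z" "Cod C h = tot G"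
      using gh by auto
    show "g = h"
    proof (rule graded_prj_ext[OF gG])
      fix n
      have *: "\<psi>n n \<cdot> (prj G n \<cdot> x) = prj Y n \<cdot> (\<psi> \<cdot> x)" if "x \<in> Arr C" "Cod C x = tot G" for x
        by (rule Comp_eq_Comp[OF \<psi>_prj[symmetric]]) (use that in simp_all)
      have "\<psi>n n \<cdot> (prj G n \<cdot> g) = \<psi>n n \<cdot> (prj G n \<cdot> h)" by (simp add: * gh(3))
      then show "prj G n \<cdot> g = prj G n \<cdot> h" by (rule monicD[OF monic]) simp_all
    qed simp_all
  qed simp
  \<comment> \<open>\<open>Fn n\<close> is recovered from \<open>F\<close> by projecting. If
    \<open>F\<close> respects the injections of degree \<open>n\<close>, it is an identity, and the
    convention on trivial factorizations applies.\<close>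
  moreover have "\<phi>n n = \<one> (cmp X n) \<and> \<psi>n n = \<one> (cmp X n)" if n: "F \<cdot> inc X n = inc Y n" for n
  proof (rule triv)
    have "Fn n = prj Y n \<cdot> (inc Y n \<cdot> Fn n)" by (simp add: prj_inc_Comp[OF Y])
    also have "\<dots> = \<one> (cmp Y n)" unfolding F_inc[symmetric] n by simp
    finally have *: "Fn n = \<one> (cmp Y n)" .
    have "Dom C (Fn n) = cmp X n" by simp
    then have "cmp X n = cmp Y n" unfolding * by simp
    with * show "Fn n = \<one> (cmp X n)" by simp
  qed
  ultimately show ?thesis using that gG \<phi> \<psi> epic monic by blast
qed

text \<open>The product fills a square with \<open>\<phi> \<otimes> \<phi>\<close> and
  \<open>\<psi>\<close>, the coproduct one with \<open>\<phi>\<close> and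
  \<open>\<psi> \<otimes> \<psi>\<close>. The algebra axioms hold after \<open>\<psi>\<close>
  because they hold in \<open>B\<close>, the coalgebra axioms hold on \<open>\<phi>\<close> because
  they hold in \<open>A\<close>, and the remaining compatibilities are inherited from
  \<open>A\<close>.\<close>

lemma image_bialgebra_exists_unique:
  assumes A: "graded_braided_bialgebra A" and B: "graded_braided_bialgebra B"
    and F: "graded_bialgebra_hom A B F" and G: "graded_image (grading A) (grading B) F G \<phi> \<psi>"
  shows "\<exists>!I. image_bialgebra A B G \<phi> \<psi> I"
proof -
  note bA = graded_braided_bialgebraD(1)[OF A] and bB = graded_braided_bialgebraD(1)[OF B]
  note X = graded_braided_bialgebraD(2)[OF A] and Y = graded_braided_bialgebraD(2)[OF B]
  obtain \<phi>n \<psi>n where gG: "graded_object G" and \<phi>s: "is_direct_sum_of (grading A) G \<phi> \<phi>n"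
    and \<psi>s: "is_direct_sum_of G (grading B) \<psi> \<psi>n" and \<phi>n: "\<And>n. epic C (\<phi>n n)"
    and F_eq: "F = \<psi> \<cdot> \<phi>" and \<phi>: "epic C \<phi>" and \<psi>: "monic C \<psi>"
    using graded_imageD[OF X Y G] by metis
  note [simp] = graded_objectD[OF X] graded_objectD[OF Y] graded_objectD[OF gG]
    graded_braided_bialgebraD(3)[OF A] graded_braided_bialgebraD(3)[OF B]
    braided_bialgebra_type[OF bA] braided_bialgebra_type[OF bB]
  define S where "S = tot G"
  have [simp]: "\<phi> \<in> Arr C" "Dom C \<phi> = carr A" "Cod C \<phi> = S" "\<psi> \<in> Arr C" "Dom C \<psi> = S" "Cod C \<psi> = carr B"
    "S \<in> Obj C" "tot G = S"
    using is_direct_sum_ofD(4-6)[OF X gG \<phi>s] is_direct_sum_ofD(4-6)[OF gG Y \<psi>s]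
    by (simp_all add: S_def)
  note [simp] = is_direct_sum_ofD(1-3)[OF X gG \<phi>s] is_direct_sum_ofD(1-3)[OF gG Y \<psi>s]
  note \<phi>_inc = is_direct_sum_ofD(7)[OF X gG \<phi>s] and \<phi>_prj = is_direct_sum_ofD(8)[OF X gG \<phi>s]
  have F': "\<psi> \<cdot> (\<phi> \<cdot> mult A) = mult B \<cdot> ((\<psi> \<cdot> \<phi>) \<otimes> (\<psi> \<cdot> \<phi>))" "\<psi> \<cdot> (\<phi> \<cdot> unt A) = unt B"
    "comult B \<cdot> (\<psi> \<cdot> \<phi>) = ((\<psi> \<cdot> \<phi>) \<otimes> (\<psi> \<cdot> \<phi>)) \<cdot> comult A" "counit B \<cdot> (\<psi> \<cdot> \<phi>) = counit A"
    using F unfolding graded_bialgebra_hom_def algebra_hom_def coalgebra_hom_def F_eq by simp_all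
  note \<phi>\<phi> = epic_TenA[OF \<phi> \<phi>] and \<psi>\<psi> = monic_TenA[OF \<psi> \<psi>]
  have "\<psi> \<cdot> (\<phi> \<cdot> mult A) = mult B \<cdot> (\<psi> \<otimes> \<psi>) \<cdot> (\<phi> \<otimes> \<phi>)" by (simp add: F')
  then obtain m where "m \<in> hom C (Cod C (\<phi> \<otimes> \<phi>)) (Dom C \<psi>)" and m\<phi>: "m \<cdot> (\<phi> \<otimes> \<phi>) = \<phi> \<cdot> mult A"
    and \<psi>m: "\<psi> \<cdot> m = mult B \<cdot> (\<psi> \<otimes> \<psi>)"
    by (rule diagonal_fill_in[OF \<phi>\<phi> \<psi>, rotated 6]) simp_all
  then have [simp]: "m \<in> Arr C" "Dom C m = S \<otimes>\<^sub>o S" "Cod C m = S" by simp_all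
  have "(\<psi> \<otimes> \<psi>) \<cdot> ((\<phi> \<otimes> \<phi>) \<cdot> comult A) = comult B \<cdot> \<psi> \<cdot> \<phi>" by (simp add: F')
  then obtain d where "d \<in> hom C (Cod C \<phi>) (Dom C (\<psi> \<otimes> \<psi>))" and d\<phi>: "d \<cdot> \<phi> = (\<phi> \<otimes> \<phi>) \<cdot> comult A"
    and \<psi>d: "(\<psi> \<otimes> \<psi>) \<cdot> d = comult B \<cdot> \<psi>"
    by (rule diagonal_fill_in[OF \<phi> \<psi>\<psi>, rotated 6]) simp_all
  then have [simp]: "d \<in> Arr C" "Dom C d = S" "Cod C d = S \<otimes>\<^sub>o S" by simp_all
  \<comment> \<open>The unit is pushed forward from \<open>A\<close> and the counit pulled back from
    \<open>B\<close>; that \<open>F\<close> preserves both gives the two other triangles.\<close>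
  define u where "u = \<phi> \<cdot> unt A"
  define e where "e = counit B \<cdot> \<psi>"
  have [simp]: "u \<in> Arr C" "Dom C u = \<I>" "Cod C u = S" "e \<in> Arr C" "Dom C e = S" "Cod C e = \<I>"
    by (simp_all add: u_def e_def)
  have \<psi>u: "\<psi> \<cdot> u = unt B" and e\<phi>: "e \<cdot> \<phi> = counit A" by (simp_all add: u_def e_def F')
  have Comp:
    "z \<in> Arr C \<Longrightarrow> Cod C z = S \<otimes>\<^sub>o S \<Longrightarrow> \<psi> \<cdot> (m \<cdot> z) = mult B \<cdot> ((\<psi> \<otimes> \<psi>) \<cdot> z)"
    "z \<in> Arr C \<Longrightarrow> Cod C z = S \<Longrightarrow> (\<psi> \<otimes> \<psi>) \<cdot> (d \<cdot> z) = comult B \<cdot> (\<psi> \<cdot> z)"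
    "z \<in> Arr C \<Longrightarrow> Cod C z = carr A \<otimes>\<^sub>o carr A \<Longrightarrow> m \<cdot> ((\<phi> \<otimes> \<phi>) \<cdot> z) = \<phi> \<cdot> (mult A \<cdot> z)"
    "z \<in> Arr C \<Longrightarrow> Cod C z = carr A \<Longrightarrow> d \<cdot> (\<phi> \<cdot> z) = (\<phi> \<otimes> \<phi>) \<cdot> (comult A \<cdot> z)"
    "z \<in> Arr C \<Longrightarrow> Cod C z = carr A \<Longrightarrow> e \<cdot> (\<phi> \<cdot> z) = counit A \<cdot> z" for z
    using Comp_eq_Comp[OF \<psi>m, of z] Comp_eq_Comp[OF \<psi>d, of z] Comp_eq_Comp[OF m\<phi>, of z]
      Comp_eq_Comp[OF d\<phi>, of z] Comp_assoc'[of z \<phi> e] e\<phi> by simp_all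

  have "algebra S m u"
    unfolding algebra_def
  proof (intro conjI)
    note algB = braided_bialgebraD(1)[OF bB]
    have "\<psi> \<cdot> (m \<cdot> (m \<otimes> \<one> S)) = mult B \<cdot> ((mult B \<cdot> (\<psi> \<otimes> \<psi>)) \<otimes> \<psi>)" by (simp add: Comp \<psi>m)
    also have "\<dots> = \<psi> \<cdot> (m \<cdot> (\<one> S \<otimes> m) \<cdot> \<a> S S S)"
      by (simp add: algebra_assoc[OF algB] Comp \<psi>m)
    finally show "m \<cdot> (m \<otimes> \<one> S) = m \<cdot> (\<one> S \<otimes> m) \<cdot> \<a> S S S" by (rule monicD[OF \<psi>]) simp_all
    have lB: "mult B \<cdot> (unt B \<otimes> \<one> (carr B)) = \<l> (carr B)" and rB: "mult B \<cdot> (\<one> (carr B) \<otimes> unt B) = \<r> (carr B)"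
      using algB by (simp_all add: algebra_def)
    have "\<psi> \<cdot> (m \<cdot> (u \<otimes> \<one> S)) = (mult B \<cdot> (unt B \<otimes> \<one> (carr B))) \<cdot> (\<one> \<I> \<otimes> \<psi>)" by (simp add: Comp \<psi>u)
    also have "\<dots> = \<psi> \<cdot> \<l> S" unfolding lB using LUnit_natural[of \<psi> S "carr B"] by simp
    finally show "m \<cdot> (u \<otimes> \<one> S) = \<l> S" by (rule monicD[OF \<psi>]) simp_all
    have "\<psi> \<cdot> (m \<cdot> (\<one> S \<otimes> u)) = (mult B \<cdot> (\<one> (carr B) \<otimes> unt B)) \<cdot> (\<psi> \<otimes> \<one> \<I>)" by (simp add: Comp \<psi>u)
    also have "\<dots> = \<psi> \<cdot> \<r> S" unfolding rB using RUnit_natural[of \<psi> S "carr B"] by simp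
    finally show "m \<cdot> (\<one> S \<otimes> u) = \<r> S" by (rule monicD[OF \<psi>]) simp_all
  qed simp_all
  moreover have "coalgebra S d e"
    unfolding coalgebra_def
  proof (intro conjI)
    have coA: "\<a> (carr A) (carr A) (carr A) \<cdot> (comult A \<otimes> \<one> (carr A)) \<cdot> comult A =
        (\<one> (carr A) \<otimes> comult A) \<cdot> comult A"
      "\<l> (carr A) \<cdot> (counit A \<otimes> \<one> (carr A)) \<cdot> comult A = \<one> (carr A)"
      "\<r> (carr A) \<cdot> (\<one> (carr A) \<otimes> counit A) \<cdot> comult A = \<one> (carr A)"
      using braided_bialgebraD(2)[OF bA] by (simp_all add: coalgebra_def)
    have "\<a> S S S \<cdot> (d \<otimes> \<one> S) \<cdot> d \<cdot> \<phi> =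
        (\<phi> \<otimes> (\<phi> \<otimes> \<phi>)) \<cdot> (\<a> (carr A) (carr A) (carr A) \<cdot> (comult A \<otimes> \<one> (carr A)) \<cdot> comult A)"
      by (simp add: d\<phi>)
    also have "\<dots> = (\<one> S \<otimes> d) \<cdot> d \<cdot> \<phi>" unfolding coA(1) by (simp add: d\<phi>)
    finally show "\<a> S S S \<cdot> (d \<otimes> \<one> S) \<cdot> d = (\<one> S \<otimes> d) \<cdot> d" by (rule epicD[OF \<phi>]) simp_all
    have nat: "\<l> S \<cdot> ((\<one> \<I> \<otimes> \<phi>) \<cdot> z) = \<phi> \<cdot> (\<l> (carr A) \<cdot> z)" if "z \<in> Arr C" "Cod C z = \<I> \<otimes>\<^sub>o carr A" for z
      by (rule Comp_eq_Comp[OF LUnit_natural]) (use that in simp_all)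
    have "\<l> S \<cdot> (e \<otimes> \<one> S) \<cdot> d \<cdot> \<phi> = \<l> S \<cdot> ((\<one> \<I> \<otimes> \<phi>) \<cdot> ((counit A \<otimes> \<one> (carr A)) \<cdot> comult A))"
      by (simp add: d\<phi> e\<phi>)
    also have "\<dots> = \<phi> \<cdot> (\<l> (carr A) \<cdot> (counit A \<otimes> \<one> (carr A)) \<cdot> comult A)"
      by (subst nat) simp_all
    also have "\<dots> = \<one> S \<cdot> \<phi>" unfolding coA(2) by simp
    finally show "\<l> S \<cdot> (e \<otimes> \<one> S) \<cdot> d = \<one> S" by (rule epicD[OF \<phi>]) simp_all
    have nat: "\<r> S \<cdot> ((\<phi> \<otimes> \<one> \<I>) \<cdot> z) = \<phi> \<cdot> (\<r> (carr A) \<cdot> z)" if "z \<in> Arr C" "Cod C z = carr A \<otimes>\<^sub>o \<I>" for z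
      by (rule Comp_eq_Comp[OF RUnit_natural]) (use that in simp_all)
    have "\<r> S \<cdot> (\<one> S \<otimes> e) \<cdot> d \<cdot> \<phi> = \<r> S \<cdot> ((\<phi> \<otimes> \<one> \<I>) \<cdot> ((\<one> (carr A) \<otimes> counit A) \<cdot> comult A))"
      by (simp add: d\<phi> e\<phi>)
    also have "\<dots> = \<phi> \<cdot> (\<r> (carr A) \<cdot> (\<one> (carr A) \<otimes> counit A) \<cdot> comult A)"
      by (subst nat) simp_all
    also have "\<dots> = \<one> S \<cdot> \<phi>" unfolding coA(3) by simp
    finally show "\<r> S \<cdot> (\<one> S \<otimes> e) \<cdot> d = \<one> S" by (rule epicD[OF \<phi>]) simp_all
  qed simp_all
  moreover have "d \<cdot> m = (m \<otimes> m) \<cdot> swap_middle S S S S \<cdot> (d \<otimes> d)"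
  proof (rule epicD[OF \<phi>\<phi>])
    have swap: "swap_middle S S S S \<cdot> (((\<phi> \<otimes> \<phi>) \<otimes> (\<phi> \<otimes> \<phi>)) \<cdot> z) =
        ((\<phi> \<otimes> \<phi>) \<otimes> (\<phi> \<otimes> \<phi>)) \<cdot> (swap_middle (carr A) (carr A) (carr A) (carr A) \<cdot> z)"
      if "z \<in> Arr C" "Cod C z = (carr A \<otimes>\<^sub>o carr A) \<otimes>\<^sub>o (carr A \<otimes>\<^sub>o carr A)" for z
      by (rule Comp_eq_Comp) (use swap_middle_natural[of \<phi> \<phi> \<phi> \<phi>] that in simp_all)
    have "d \<cdot> m \<cdot> (\<phi> \<otimes> \<phi>) = (\<phi> \<otimes> \<phi>) \<cdot> (comult A \<cdot> mult A)" by (simp add: m\<phi> Comp)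
    also have "\<dots> = (m \<otimes> m) \<cdot> (((\<phi> \<otimes> \<phi>) \<otimes> (\<phi> \<otimes> \<phi>)) \<cdot>
        (swap_middle (carr A) (carr A) (carr A) (carr A) \<cdot> (comult A \<otimes> comult A)))"
      unfolding braided_bialgebraD(3)[OF bA] by (simp add: m\<phi>)
    also have "\<dots> = (m \<otimes> m) \<cdot> swap_middle S S S S \<cdot> (d \<otimes> d) \<cdot> (\<phi> \<otimes> \<phi>)"
      unfolding swap[of "comult A \<otimes> comult A", simplified, symmetric] by (simp add: d\<phi>)
    finally show "d \<cdot> m \<cdot> (\<phi> \<otimes> \<phi>) = (m \<otimes> m) \<cdot> swap_middle S S S S \<cdot> (d \<otimes> d) \<cdot> (\<phi> \<otimes> \<phi>)" .
  qed simp_all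
  moreover have "e \<cdot> m = \<l> \<I> \<cdot> (e \<otimes> e)"
    by (rule epicD[OF \<phi>\<phi>]) (simp_all add: m\<phi> Comp e\<phi> braided_bialgebraD(4)[OF bA])
  moreover have "d \<cdot> u = (u \<otimes> u) \<cdot> inverse_of C (\<l> \<I>)"
    by (simp add: u_def Comp braided_bialgebraD(5)[OF bA])
  moreover have "e \<cdot> u = \<one> \<I>"
    by (simp add: u_def Comp braided_bialgebraD(6)[OF bA])
  ultimately have bI: "braided_bialgebra \<lparr>carr = S, mult = m, unt = u, comult = d, counit = e, grading = G\<rparr>"
    (is "braided_bialgebra ?I")
    by (simp add: braided_bialgebra_def)
  have gI: "graded_braided_bialgebra ?I"
  proof (rule graded_braided_bialgebraI[OF bI])
    fix k a b :: nat assume k: "k \<noteq> a + b"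
    \<comment> \<open>Composing with the degreewise epimorphisms turns this into a component of the
      product in \<open>A\<close>, which vanishes by gradedness there.\<close>
    have "prj G k \<cdot> (m \<cdot> (inc G a \<otimes> inc G b)) = \<zero> (cmp G a \<otimes>\<^sub>o cmp G b) (cmp G k)"
    proof (rule epicD[OF epic_TenA[OF \<phi>n[of a] \<phi>n[of b]]])
      have "prj G k \<cdot> (m \<cdot> (inc G a \<otimes> inc G b)) \<cdot> (\<phi>n a \<otimes> \<phi>n b) =
          prj G k \<cdot> (m \<cdot> ((\<phi> \<otimes> \<phi>) \<cdot> (inc (grading A) a \<otimes> inc (grading A) b)))"
        by (simp add: \<phi>_inc)
      also have "\<dots> = (prj G k \<cdot> \<phi>) \<cdot> (mult A \<cdot> (inc (grading A) a \<otimes> inc (grading A) b))"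
        by (subst Comp) simp_all
      also have "\<dots> = \<phi>n k \<cdot> (prj (grading A) k \<cdot> (mult A \<cdot> (inc (grading A) a \<otimes> inc (grading A) b)))"
        unfolding \<phi>_prj by simp
      also have "\<dots> = \<zero> (cmp G a \<otimes>\<^sub>o cmp G b) (cmp G k) \<cdot> (\<phi>n a \<otimes> \<phi>n b)"
        unfolding graded_braided_bialgebra_prj(1)[OF A k] by simp
      finally show "prj G k \<cdot> (m \<cdot> (inc G a \<otimes> inc G b)) \<cdot> (\<phi>n a \<otimes> \<phi>n b) =
          \<zero> (cmp G a \<otimes>\<^sub>o cmp G b) (cmp G k) \<cdot> (\<phi>n a \<otimes> \<phi>n b)" .
    qed simp_all
    then show "prj (grading ?I) k \<cdot> (mult ?I \<cdot> (inc (grading ?I) a \<otimes> inc (grading ?I) b)) =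
        \<zero> (cmp (grading ?I) a \<otimes>\<^sub>o cmp (grading ?I) b) (cmp (grading ?I) k)" by simp
    have "(prj G a \<otimes> prj G b) \<cdot> (d \<cdot> inc G k) = \<zero> (cmp G k) (cmp G a \<otimes>\<^sub>o cmp G b)"
    proof (rule epicD[OF \<phi>n[of k]])
      have "(prj G a \<otimes> prj G b) \<cdot> (d \<cdot> inc G k) \<cdot> \<phi>n k =
          (prj G a \<otimes> prj G b) \<cdot> (d \<cdot> (\<phi> \<cdot> inc (grading A) k))"
        by (simp add: \<phi>_inc)
      also have "\<dots> = ((prj G a \<cdot> \<phi>) \<otimes> (prj G b \<cdot> \<phi>)) \<cdot> (comult A \<cdot> inc (grading A) k)"
        by (subst Comp) simp_all
      also have "\<dots> = (\<phi>n a \<otimes> \<phi>n b) \<cdot> ((prj (grading A) a \<otimes> prj (grading A) b) \<cdot> (comult A \<cdot> inc (grading A) k))"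
        unfolding \<phi>_prj by simp
      also have "\<dots> = \<zero> (cmp G k) (cmp G a \<otimes>\<^sub>o cmp G b) \<cdot> \<phi>n k"
        unfolding graded_braided_bialgebra_prj(2)[OF A k] by simp
      finally show "(prj G a \<otimes> prj G b) \<cdot> (d \<cdot> inc G k) \<cdot> \<phi>n k =
          \<zero> (cmp G k) (cmp G a \<otimes>\<^sub>o cmp G b) \<cdot> \<phi>n k" .
    qed simp_all
    then show "(prj (grading ?I) a \<otimes> prj (grading ?I) b) \<cdot> (comult ?I \<cdot> inc (grading ?I) k) =
        \<zero> (cmp (grading ?I) k) (cmp (grading ?I) a \<otimes>\<^sub>o cmp (grading ?I) b)" by simp
  qed (simp_all add: gG)
  have "graded_morphism (grading A) G \<phi>" "graded_morphism G (grading B) \<psi>"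
    using \<phi>s \<psi>s by (auto simp: graded_morphism_def)
  then have I: "image_bialgebra A B G \<phi> \<psi> ?I"
    unfolding image_bialgebra_def graded_bialgebra_hom_def algebra_hom_def coalgebra_hom_def
    using gI by (simp add: m\<phi> \<psi>m d\<phi> \<psi>d \<psi>u e\<phi> u_def[symmetric] e_def[symmetric])
  show ?thesis
  proof (rule ex1I[of _ ?I])
    show "image_bialgebra A B G \<phi> \<psi> ?I" by (rule I)
    \<comment> \<open>The structure is determined by \<open>\<phi>\<close> alone, because
      \<open>\<phi>\<close> and \<open>\<phi> \<otimes> \<phi>\<close> are epic.\<close>
    fix J assume J: "image_bialgebra A B G \<phi> \<psi> J"
    then have gJ: "graded_braided_bialgebra J" and GJ: "grading J = G"
      and \<phi>J: "algebra_hom A J \<phi>" "coalgebra_hom A J \<phi>"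
      unfolding image_bialgebra_def graded_bialgebra_hom_def by blast+
    have S: "carr J = S" using graded_braided_bialgebraD(3)[OF gJ] GJ by simp
    note [simp] = braided_bialgebra_type[OF graded_braided_bialgebraD(1)[OF gJ], unfolded S]
    have "mult J = m" by (rule epicD[OF \<phi>\<phi>]) (use \<phi>J in \<open>simp_all add: algebra_hom_def m\<phi>\<close>)
    moreover have "unt J = u" using \<phi>J by (simp add: algebra_hom_def u_def)
    moreover have "comult J = d" by (rule epicD[OF \<phi>]) (use \<phi>J in \<open>simp_all add: coalgebra_hom_def d\<phi>\<close>)
    moreover have "counit J = e" by (rule epicD[OF \<phi>]) (use \<phi>J in \<open>simp_all add: coalgebra_hom_def e\<phi>\<close>)
    ultimately show "J = ?I" using S GJ by (cases J) simp
  qed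
qed

section \<open>Uniqueness of the homomorphisms and assembly of the result\<close>

lemma canonical_hom_ext:
  assumes T: "tensor_bialgebra H M T" and B: "graded_braided_bialgebra B"
    and f: "algebra_hom T B f" and g: "algebra_hom T B g"
    and "f \<cdot> inc (grading T) 0 = g \<cdot> inc (grading T) 0"
    and "f \<cdot> inc (grading T) (Suc 0) = g \<cdot> inc (grading T) (Suc 0)"
  shows "f = g"
  by (rule tensor_bialgebra_hom_ext[OF T, of "mult B" "carr B"])
    (use assms braided_bialgebra_type[OF graded_braided_bialgebraD(1)[OF B]] in \<open>simp_all add: algebra_hom_def\<close>)

lemma canonical_cohom_ext:
  assumes T: "cotensor_bialgebra H M T" and B: "graded_braided_bialgebra B"
    and f: "coalgebra_hom B T f" and g: "coalgebra_hom B T g"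
    and "prj (grading T) 0 \<cdot> f = prj (grading T) 0 \<cdot> g"
    and "prj (grading T) (Suc 0) \<cdot> f = prj (grading T) (Suc 0) \<cdot> g"
  shows "f = g"
  by (rule cotensor_bialgebra_hom_ext[OF T, of "comult B" "carr B"])
    (use assms braided_bialgebra_type[OF graded_braided_bialgebraD(1)[OF B]] in \<open>simp_all add: coalgebra_hom_def\<close>)

text \<open>\<open>F\<close> is an identity in degrees 0 and 1, so by convention its factorization
  is trivial there, which identifies the low components of \<open>\<phi>\<close> and
  \<open>\<psi>\<close>. Each equivalence packs the validity of the conditions for
  \<open>\<phi>\<close> or \<open>\<psi>\<close> together with uniqueness.\<close>

lemma canonical_image:
  assumes T: "tensor_bialgebra H M T" and Tc: "cotensor_bialgebra H M Tc"
    and F0: "F \<cdot> inc (grading T) 0 = inc (grading Tc) 0"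
    and F1: "F \<cdot> inc (grading T) (Suc 0) = inc (grading Tc) (Suc 0)"
    and G: "graded_image (grading T) (grading Tc) F G \<phi> \<psi>" and I: "image_bialgebra T Tc G \<phi> \<psi> I"
  shows "cmp (grading I) 0 = carr H" "cmp (grading I) (Suc 0) = mcarr M"
    "g = \<phi> \<longleftrightarrow> algebra_hom T I g \<and> g \<cdot> inc (grading T) 0 = inc (grading I) 0 \<and>
      g \<cdot> inc (grading T) (Suc 0) = inc (grading I) (Suc 0)"
    "h = \<psi> \<longleftrightarrow> coalgebra_hom I Tc h \<and> prj (grading Tc) 0 \<cdot> h = prj (grading I) 0 \<and>
      prj (grading Tc) (Suc 0) \<cdot> h = prj (grading I) (Suc 0)"
proof -
  note X = graded_braided_bialgebraD(2)[OF tensor_bialgebraD(1)[OF T]]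
    and Y = graded_braided_bialgebraD(2)[OF cotensor_bialgebraD(1)[OF Tc]]
  obtain \<phi>n \<psi>n where gG: "graded_object G" and \<phi>: "is_direct_sum_of (grading T) G \<phi> \<phi>n"
    and \<psi>: "is_direct_sum_of G (grading Tc) \<psi> \<psi>n"
    and triv: "\<And>n. F \<cdot> inc (grading T) n = inc (grading Tc) n \<Longrightarrow>
      \<phi>n n = \<one> (cmp (grading T) n) \<and> \<psi>n n = \<one> (cmp (grading T) n)"
    using graded_imageD[OF X Y G] by metis
  have gI: "graded_braided_bialgebra I" and GI: "grading I = G"
    and \<phi>I: "algebra_hom T I \<phi>" and \<psi>I: "coalgebra_hom I Tc \<psi>"
    using I unfolding image_bialgebra_def graded_bialgebra_hom_def by blast+
  note [simp] = graded_objectD[OF X] graded_objectD[OF Y] graded_objectD[OF gG]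
  have *: "cmp G n = cmp (grading T) n" "\<phi> \<cdot> inc (grading T) n = inc G n"
    "prj (grading Tc) n \<cdot> \<psi> = prj G n" if n: "F \<cdot> inc (grading T) n = inc (grading Tc) n" for n
  proof -
    show 1: "cmp G n = cmp (grading T) n"
      using is_direct_sum_ofD(3)[OF X gG \<phi>, of n] triv[OF n] by simp
    show "\<phi> \<cdot> inc (grading T) n = inc G n"
      using is_direct_sum_ofD(7)[OF X gG \<phi>, of n] triv[OF n] 1[symmetric] by simp
    show "prj (grading Tc) n \<cdot> \<psi> = prj G n"
      using is_direct_sum_ofD(8)[OF gG Y \<psi>, of n] triv[OF n] 1[symmetric] by simp
  qed
  show "cmp (grading I) 0 = carr H" "cmp (grading I) (Suc 0) = mcarr M"
    using *(1)[OF F0] *(1)[OF F1] tensor_bialgebraD(7,8)[OF T] GI by simp_all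
  show "g = \<phi> \<longleftrightarrow> algebra_hom T I g \<and> g \<cdot> inc (grading T) 0 = inc (grading I) 0 \<and>
      g \<cdot> inc (grading T) (Suc 0) = inc (grading I) (Suc 0)"
    using canonical_hom_ext[OF T gI, of g \<phi>] \<phi>I *(2)[OF F0] *(2)[OF F1] GI by auto
  show "h = \<psi> \<longleftrightarrow> coalgebra_hom I Tc h \<and> prj (grading Tc) 0 \<cdot> h = prj (grading I) 0 \<and>
      prj (grading Tc) (Suc 0) \<cdot> h = prj (grading I) (Suc 0)"
    using canonical_cohom_ext[OF Tc gI, of h \<psi>] \<psi>I *(3)[OF F0] *(3)[OF F1] GI by auto
qed

end

theorem theorem6p6:
  fixes C :: "('o, 'm, 'z) preadditive_braided_category_scheme"
    and small :: "'u set \<Rightarrow> bool"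
    and H :: "('o, 'm) bialg"
    and M :: "('o, 'm) hopf_bimod"
    and T Tc :: "('o, 'm) graded_bialg"
  assumes "smallness small"
    and "braided_monoidal_category C"
    and "abelian_monoidal C" and "coabelian_monoidal C"
    and "cocomplete small C" and "complete small C" and "AB5 small C"
    and "tensor_commutes_with_direct_sums small C"
    and "braided_data.braided_bialgebra C H"
    and "braided_data.hopf_bimodule C H M"
    and "braided_data.tensor_bialgebra C H M T"
    and "braided_data.cotensor_bialgebra C H M Tc"
  shows
    "(\<exists>!F. braided_data.algebra_hom C T Tc F \<and>
        F \<cdot>\<^bsub>C\<^esub> inc (grading T) 0 = inc (grading Tc) 0 \<and> F \<cdot>\<^bsub>C\<^esub> inc (grading T) 1 = inc (grading Tc) 1) \<and>
     (\<forall>F. braided_data.algebra_hom C T Tc F \<and>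
        F \<cdot>\<^bsub>C\<^esub> inc (grading T) 0 = inc (grading Tc) 0 \<and> F \<cdot>\<^bsub>C\<^esub> inc (grading T) 1 = inc (grading Tc) 1 \<longrightarrow>
        braided_data.graded_bialgebra_hom C T Tc F \<and>
        (\<exists>Fn. braided_data.is_direct_sum_of C (grading T) (grading Tc) F Fn \<and>
           Fn 0 = \<one>\<^bsub>C\<^esub> (carr H) \<and> Fn 1 = \<one>\<^bsub>C\<^esub> (mcarr M)) \<and>
        (\<exists>G \<phi> \<psi>. braided_data.graded_image C (grading T) (grading Tc) F G \<phi> \<psi>) \<and>
        (\<forall>G \<phi> \<psi>. braided_data.graded_image C (grading T) (grading Tc) F G \<phi> \<psi> \<longrightarrow>
           F = \<psi> \<cdot>\<^bsub>C\<^esub> \<phi> \<and> epic C \<phi> \<and> monic C \<psi> \<and>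
           (\<exists>!I. braided_data.image_bialgebra C T Tc G \<phi> \<psi> I) \<and>
           (\<forall>I. braided_data.image_bialgebra C T Tc G \<phi> \<psi> I \<longrightarrow>
              (braided_data.graded_braided_bialgebra C I \<and>
               cmp (grading I) 0 = carr H \<and>
               cmp (grading I) 1 = mcarr M) \<and>
              (\<forall>g. g = \<phi> \<longleftrightarrow> braided_data.algebra_hom C T I g \<and>
                 g \<cdot>\<^bsub>C\<^esub> inc (grading T) 0 = inc (grading I) 0 \<and> g \<cdot>\<^bsub>C\<^esub> inc (grading T) 1 = inc (grading I) 1) \<and>
              (\<forall>g. g = \<psi> \<longleftrightarrow> braided_data.coalgebra_hom C I Tc g \<and>
                 prj (grading Tc) 0 \<cdot>\<^bsub>C\<^esub> g = prj (grading I) 0 \<and> prj (grading Tc) 1 \<cdot>\<^bsub>C\<^esub> g = prj (grading I) 1))))"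
proof -
  have "abelian_category C" using assms(3) by (simp add: abelian_monoidal_def)
  then interpret braided_abelian C small
    by (intro braided_abelian.intro braided_abelian_axioms.intro assms)
  note H = assms(9) and M = assms(10) and T = assms(11) and Tc = assms(12)
  note gT = tensor_bialgebraD(1)[OF T] and gTc = cotensor_bialgebraD(1)[OF Tc]
  note X = graded_braided_bialgebraD(2)[OF gT] and Y = graded_braided_bialgebraD(2)[OF gTc]
  have unique: "\<exists>!F. algebra_hom T Tc F \<and> F \<cdot>\<^bsub>C\<^esub> inc (grading T) 0 = inc (grading Tc) 0 \<and>
      F \<cdot>\<^bsub>C\<^esub> inc (grading T) 1 = inc (grading Tc) 1"
  proof -
    obtain F where F: "algebra_hom T Tc F" "F \<cdot>\<^bsub>C\<^esub> inc (grading T) 0 = inc (grading Tc) 0"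
      "F \<cdot>\<^bsub>C\<^esub> inc (grading T) (Suc 0) = inc (grading Tc) (Suc 0)"
      using canonical_hom_exists[OF H M T Tc] .
    show ?thesis
    proof (rule ex1I[of _ F])
      fix F' assume "algebra_hom T Tc F' \<and> F' \<cdot>\<^bsub>C\<^esub> inc (grading T) 0 = inc (grading Tc) 0 \<and>
        F' \<cdot>\<^bsub>C\<^esub> inc (grading T) 1 = inc (grading Tc) 1"
      then show "F' = F" using canonical_hom_ext[OF T gTc, of F' F] F by simp
    qed (use F in simp)
  qed
  have hom: "graded_bialgebra_hom T Tc F \<and>
      (\<exists>Fn. is_direct_sum_of (grading T) (grading Tc) F Fn \<and> Fn 0 = \<one>\<^bsub>C\<^esub> (carr H) \<and> Fn 1 = \<one>\<^bsub>C\<^esub> (mcarr M)) \<and>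
      (\<exists>G \<phi> \<psi>. graded_image (grading T) (grading Tc) F G \<phi> \<psi>)"
    if F: "algebra_hom T Tc F" and F0: "F \<cdot>\<^bsub>C\<^esub> inc (grading T) 0 = inc (grading Tc) 0"
      and F1: "F \<cdot>\<^bsub>C\<^esub> inc (grading T) (Suc 0) = inc (grading Tc) (Suc 0)" for F
  proof -
    note Fn = canonical_hom_graded[OF T Tc F F0 F1]
    then have "graded_morphism (grading T) (grading Tc) F" by (auto simp: graded_morphism_def)
    then have "graded_bialgebra_hom T Tc F"
      using F canonical_hom_coalgebra_hom[OF H M T Tc F F0 F1] by (simp add: graded_bialgebra_hom_def)
    moreover have "prj (grading Tc) 0 \<cdot>\<^bsub>C\<^esub> (F \<cdot>\<^bsub>C\<^esub> inc (grading T) 0) = \<one>\<^bsub>C\<^esub> (carr H)"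
      "prj (grading Tc) 1 \<cdot>\<^bsub>C\<^esub> (F \<cdot>\<^bsub>C\<^esub> inc (grading T) 1) = \<one>\<^bsub>C\<^esub> (mcarr M)"
      by (simp_all add: F0 F1 graded_objectD[OF Y] cotensor_bialgebraD(7,8)[OF Tc])
    moreover have "\<exists>G \<phi> \<psi>. graded_image (grading T) (grading Tc) F G \<phi> \<psi>"
      using graded_image_exists[OF X Y Fn] by metis
    ultimately show ?thesis using Fn by blast
  qed
  show ?thesis
  proof (intro conjI allI impI)
    fix F assume "algebra_hom T Tc F \<and> F \<cdot>\<^bsub>C\<^esub> inc (grading T) 0 = inc (grading Tc) 0 \<and>
      F \<cdot>\<^bsub>C\<^esub> inc (grading T) 1 = inc (grading Tc) 1"
    then have F: "algebra_hom T Tc F" and F0: "F \<cdot>\<^bsub>C\<^esub> inc (grading T) 0 = inc (grading Tc) 0"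
      and F1: "F \<cdot>\<^bsub>C\<^esub> inc (grading T) (Suc 0) = inc (grading Tc) (Suc 0)" by simp_all
    show "graded_bialgebra_hom T Tc F"
      "\<exists>Fn. is_direct_sum_of (grading T) (grading Tc) F Fn \<and> Fn 0 = \<one>\<^bsub>C\<^esub> (carr H) \<and> Fn 1 = \<one>\<^bsub>C\<^esub> (mcarr M)"
      "\<exists>G \<phi> \<psi>. graded_image (grading T) (grading Tc) F G \<phi> \<psi>"
      using hom[OF F F0 F1] by blast+
    fix G \<phi> \<psi> assume G: "graded_image (grading T) (grading Tc) F G \<phi> \<psi>"
    show "F = \<psi> \<cdot>\<^bsub>C\<^esub> \<phi>" "epic C \<phi>" "monic C \<psi>"
      using graded_imageD[OF X Y G] by metis+
    show "\<exists>!I. image_bialgebra T Tc G \<phi> \<psi> I"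
      using image_bialgebra_exists_unique[OF gT gTc _ G] hom[OF F F0 F1] by blast
    fix I assume I: "image_bialgebra T Tc G \<phi> \<psi> I"
    show "graded_braided_bialgebra I" using I by (simp add: image_bialgebra_def)
    note image = canonical_image[OF T Tc F0 F1 G I]
    show "cmp (grading I) 0 = carr H" "cmp (grading I) 1 = mcarr M" using image(1,2) by simp_all
    show "g = \<phi> \<longleftrightarrow> algebra_hom T I g \<and> g \<cdot>\<^bsub>C\<^esub> inc (grading T) 0 = inc (grading I) 0 \<and>
        g \<cdot>\<^bsub>C\<^esub> inc (grading T) 1 = inc (grading I) 1" for g
      using image(3) by simp
    show "g = \<psi> \<longleftrightarrow> coalgebra_hom I Tc g \<and> prj (grading Tc) 0 \<cdot>\<^bsub>C\<^esub> g = prj (grading I) 0 \<and>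
        prj (grading Tc) 1 \<cdot>\<^bsub>C\<^esub> g = prj (grading I) 1" for g
      using image(4) by simp
  qed (rule unique)
qed

end
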